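(* Let $G$ be a graph on the vertex set $[n]=\{1,\dots,n\}$. Assume that $\mathbb{K}$ is an infinite field and $\operatorname{char}(\mathbb{K})\neq 2$. If $L_G$ is an almost complete intersection ideal, then $L_G$ is generated by a homogeneous $d$-sequence. In particular, $L_G$ is of linear type.
   Context: All graphs are finite and simple; $S=\mathbb{K}[x_1,\dots,x_n,y_1,\dots,y_n]$. The Lovász-Saks-Schrijver (LSS) ideal of $G$ is $L_G=(x_ix_j+y_iy_j : \{i,j\}\in E(G))\subset S$. For a homogeneous ideal $I\subset S$, $\mu(I)$ is the cardinality of a minimal homogeneous generating set; $I$ is a complete intersection if $\mu(I)=\operatorname{ht}(I)$, and an almost complete intersection if $\mu(I)=\operatorname{ht}(I)+1$ and $I_{\mathfrak p}$ is a complete intersection (i.e. $\mu(I_{\mathfrak p})=\operatorname{ht}(I_{\mathfrak p})$) for every minimal prime $\mathfrak p$ of $I$. In a commutative ring $A$, set $d_0=0$; a sequence $d_1,\dots,d_m$ of elements is a $d$-sequence if $(d_0,d_1,\dots,d_i):d_{i+1}d_j=(d_0,d_1,\dots,d_i):d_j$ for all $0\le i\le m-1$ and all $j\ge i+1$. It is homogeneous if all its elements are homogeneous. An ideal $I$ is of linear type if its symmetric algebra and its Rees algebra $\mathcal{R}(I)=\bigoplus_{k\ge 0}I^kt^k$ are isomorphic (via the canonical surjection $\operatorname{Sym}(I)\to\mathcal{R}(I)$), equivalently the defining ideal of the Rees algebra is generated by forms linear in the presentation variables. *)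

theory Defs
  imports
    "HOL-Algebra.Algebraic_Closure_Type"
    "HOL-Algebra.Ideal_Product"
    "HOL-Algebra.QuotRing"
    "HOL-Computational_Algebra.Polynomial"
    "HOL-Library.Poly_Mapping"
    "HOL-Library.Extended_Nat"
begin

section \<open>Minimal primes, height, number of generators\<close>

definition minimal_prime :: "('a, 'b) ring_scheme \<Rightarrow> 'a set \<Rightarrow> 'a set \<Rightarrow> bool" where
  "minimal_prime R I P \<longleftrightarrow> primeideal P R \<and> I \<subseteq> P \<and>
     (\<forall>Q. primeideal Q R \<and> I \<subseteq> Q \<and> Q \<subseteq> P \<longrightarrow> Q = P)"

definition prime_height :: "('a, 'b) ring_scheme \<Rightarrow> 'a set \<Rightarrow> enat" where
  "prime_height R P = (SUP k \<in> {k. \<exists>C :: nat \<Rightarrow> 'a set.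
     (\<forall>i\<le>k. primeideal (C i) R) \<and> (\<forall>i<k. C i \<subset> C (Suc i)) \<and> C k = P}. enat k)"

definition ideal_height :: "('a, 'b) ring_scheme \<Rightarrow> 'a set \<Rightarrow> enat" where
  "ideal_height R I = (INF P \<in> {P. primeideal P R \<and> I \<subseteq> P}. prime_height R P)"

text \<open>The infimum of the empty set is \<open>\<infinity>\<close>, which is the value for an ideal that is not
  finitely generated.\<close>

definition min_gens :: "('a, 'b) ring_scheme \<Rightarrow> 'a set \<Rightarrow> enat" where
  "min_gens R I =
     (INF B \<in> {B. finite B \<and> B \<subseteq> carrier R \<and> I = Idl\<^bsub>R\<^esub> B}. enat (card B))"

section \<open>Localization at a prime ideal\<close>

definition loc_rel :: "('a, 'b) ring_scheme \<Rightarrow> 'a set \<Rightarrow> (('a \<times> 'a) \<times> ('a \<times> 'a)) set" where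
  "loc_rel R P = {((a, s), (b, t)). a \<in> carrier R \<and> s \<in> carrier R - P \<and>
     b \<in> carrier R \<and> t \<in> carrier R - P \<and>
     (\<exists>u \<in> carrier R - P. u \<otimes>\<^bsub>R\<^esub> (a \<otimes>\<^bsub>R\<^esub> t \<ominus>\<^bsub>R\<^esub> b \<otimes>\<^bsub>R\<^esub> s) = \<zero>\<^bsub>R\<^esub>)}"

definition loc_frac :: "('a, 'b) ring_scheme \<Rightarrow> 'a set \<Rightarrow> 'a \<Rightarrow> 'a \<Rightarrow> ('a \<times> 'a) set" where
  "loc_frac R P a s = loc_rel R P `` {(a, s)}"

definition localization :: "('a, 'b) ring_scheme \<Rightarrow> 'a set \<Rightarrow> ('a \<times> 'a) set ring" where
  "localization R P =
     \<lparr> carrier = (carrier R \<times> (carrier R - P)) // loc_rel R P,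
       monoid.mult = (\<lambda>U V. \<Union>((a, s), (b, t)) \<in> U \<times> V. loc_frac R P (a \<otimes>\<^bsub>R\<^esub> b) (s \<otimes>\<^bsub>R\<^esub> t)),
       one = loc_frac R P \<one>\<^bsub>R\<^esub> \<one>\<^bsub>R\<^esub>,
       ring.zero = loc_frac R P \<zero>\<^bsub>R\<^esub> \<one>\<^bsub>R\<^esub>,
       add = (\<lambda>U V. \<Union>((a, s), (b, t)) \<in> U \<times> V.
                loc_frac R P (a \<otimes>\<^bsub>R\<^esub> t \<oplus>\<^bsub>R\<^esub> b \<otimes>\<^bsub>R\<^esub> s) (s \<otimes>\<^bsub>R\<^esub> t)) \<rparr>"

definition localized_ideal :: "('a, 'b) ring_scheme \<Rightarrow> 'a set \<Rightarrow> 'a set \<Rightarrow> ('a \<times> 'a) set set" where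
  "localized_ideal R P I = Idl\<^bsub>localization R P\<^esub> ((\<lambda>a. loc_frac R P a \<one>\<^bsub>R\<^esub>) ` I)"

section \<open>d-sequences\<close>

definition colon :: "('a, 'b) ring_scheme \<Rightarrow> 'a set \<Rightarrow> 'a \<Rightarrow> 'a set" where
  "colon R I a = {r \<in> carrier R. r \<otimes>\<^bsub>R\<^esub> a \<in> I}"

text \<open>With \<open>d\<^sub>0 = 0\<close> and \<open>d\<^sub>k = ds ! (k - 1)\<close> for \<open>1 \<le> k \<le> length ds\<close>, the ideal
  \<open>(d\<^sub>0, \<dots>, d\<^sub>i)\<close> is generated by \<open>0\<close> and the first \<open>i\<close> entries of the list, and \<open>d\<^sub>i\<^sub>+\<^sub>1\<close> is
  \<open>ds ! i\<close>; the index \<open>j\<close> below is smaller by one than in the usual formulation.\<close>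

definition d_sequence :: "('a, 'b) ring_scheme \<Rightarrow> 'a list \<Rightarrow> bool" where
  "d_sequence R ds \<longleftrightarrow> set ds \<subseteq> carrier R \<and>
     (\<forall>i < length ds. \<forall>j. i \<le> j \<and> j < length ds \<longrightarrow>
        colon R (Idl\<^bsub>R\<^esub> (insert \<zero>\<^bsub>R\<^esub> (set (take i ds)))) (ds ! i \<otimes>\<^bsub>R\<^esub> ds ! j) =
        colon R (Idl\<^bsub>R\<^esub> (insert \<zero>\<^bsub>R\<^esub> (set (take i ds)))) (ds ! j))"

section \<open>Symmetric algebra, Rees algebra, linear type\<close>

text \<open>For an ideal \<open>I\<close> of a ring \<open>A\<close> (a type of class \<open>comm_ring_1\<close>), the symmetric algebra is
  presented as the polynomial ring over \<open>A\<close> with one variable \<open>T\<^sub>a\<close> for each element \<open>a \<in> I\<close>,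
  modulo \<open>T\<^sub>a\<^sub>+\<^sub>b - T\<^sub>a - T\<^sub>b\<close> and \<open>T\<^sub>r\<^sub>a - r T\<^sub>a\<close>. The variables are indexed by the whole type
  \<open>'a\<close>, and the carrier singles out the polynomials in the \<open>T\<^sub>a\<close> with \<open>a \<in> I\<close>.\<close>

definition sym_var :: "'a::comm_ring_1 \<Rightarrow> ('a \<Rightarrow>\<^sub>0 nat) \<Rightarrow>\<^sub>0 'a" where
  "sym_var a = Poly_Mapping.single (Poly_Mapping.single a 1) 1"

definition sym_free :: "'a::comm_ring_1 set \<Rightarrow> (('a \<Rightarrow>\<^sub>0 nat) \<Rightarrow>\<^sub>0 'a) ring" where
  "sym_free I = ring_of_type_algebra
     \<lparr> carrier := {p. \<forall>m \<in> Poly_Mapping.keys p. Poly_Mapping.keys m \<subseteq> I} \<rparr>"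

definition sym_rels :: "'a::comm_ring_1 set \<Rightarrow> (('a \<Rightarrow>\<^sub>0 nat) \<Rightarrow>\<^sub>0 'a) set" where
  "sym_rels I =
     {sym_var (a + b) - sym_var a - sym_var b | a b. a \<in> I \<and> b \<in> I} \<union>
     {sym_var (r * a) - Poly_Mapping.single 0 r * sym_var a | r a. a \<in> I}"

definition symmetric_algebra :: "'a::comm_ring_1 set \<Rightarrow> (('a \<Rightarrow>\<^sub>0 nat) \<Rightarrow>\<^sub>0 'a) set ring" where
  "symmetric_algebra I = sym_free I Quot (Idl\<^bsub>sym_free I\<^esub> (sym_rels I))"

text \<open>The subring of \<open>A[t]\<close> of the polynomials whose \<open>k\<close>-th coefficient lies in \<open>I\<^sup>k\<close>
  (with \<open>I\<^sup>0 = A\<close>).\<close>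

definition rees_algebra :: "'a::comm_ring_1 set \<Rightarrow> 'a poly ring" where
  "rees_algebra I = ring_of_type_algebra
     \<lparr> carrier := {f. \<forall>k. coeff f k \<in> I [^]\<^bsub>ideals_set ring_of_type_algebra\<^esub> k} \<rparr>"

text \<open>The substitution \<open>T\<^sub>a \<mapsto> a t\<close>.\<close>

definition rees_eval :: "(('a::comm_ring_1 \<Rightarrow>\<^sub>0 nat) \<Rightarrow>\<^sub>0 'a) \<Rightarrow> 'a poly" where
  "rees_eval p = (\<Sum>m \<in> Poly_Mapping.keys p. [:Poly_Mapping.lookup p m:] *
     (\<Prod>a \<in> Poly_Mapping.keys m. Polynomial.monom a 1 ^ Poly_Mapping.lookup m a))"

text \<open>The canonical surjection from the symmetric algebra takes a residue class to the
  value of \<open>rees_eval\<close> that is common to all its members.\<close>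

definition linear_type :: "'a::comm_ring_1 set \<Rightarrow> bool" where
  "linear_type I \<longleftrightarrow>
     (\<lambda>U. the_elem (rees_eval ` U)) \<in> ring_iso (symmetric_algebra I) (rees_algebra I)"

section \<open>Polynomials in \<open>x\<^sub>v, y\<^sub>v\<close> and LSS ideals\<close>

datatype 'v xy_var = XVar 'v | YVar 'v

type_synonym ('v, 'k) xy_poly = "('v xy_var \<Rightarrow>\<^sub>0 nat) \<Rightarrow>\<^sub>0 'k"

abbreviation xy_ring :: "('v, 'k::field) xy_poly ring" where
  "xy_ring \<equiv> ring_of_type_algebra"

definition poly_var :: "'v xy_var \<Rightarrow> ('v, 'k::field) xy_poly" where
  "poly_var z = Poly_Mapping.single (Poly_Mapping.single z 1) 1"

text \<open>The zero polynomial is homogeneous of every degree.\<close>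

definition homogeneous :: "('v, 'k::field) xy_poly \<Rightarrow> bool" where
  "homogeneous p \<longleftrightarrow> (\<exists>d. \<forall>m \<in> Poly_Mapping.keys p.
     (\<Sum>z \<in> Poly_Mapping.keys m. Poly_Mapping.lookup m z) = d)"

definition minimal_homogeneous_generating_set ::
  "('v, 'k::field) xy_poly set \<Rightarrow> ('v, 'k) xy_poly set \<Rightarrow> bool" where
  "minimal_homogeneous_generating_set I B \<longleftrightarrow> finite B \<and> (\<forall>b\<in>B. homogeneous b) \<and>
     I = Idl\<^bsub>xy_ring\<^esub> B \<and> (\<forall>B'. B' \<subset> B \<longrightarrow> Idl\<^bsub>xy_ring\<^esub> B' \<noteq> I)"

text \<open>All minimal homogeneous generating sets of a homogeneous ideal have the same
  cardinality, so the infimum merely selects that common value.\<close>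

definition homogeneous_min_gens :: "('v, 'k::field) xy_poly set \<Rightarrow> enat" where
  "homogeneous_min_gens I =
     (INF B \<in> {B. minimal_homogeneous_generating_set I B}. enat (card B))"

definition almost_complete_intersection :: "('v, 'k::field) xy_poly set \<Rightarrow> bool" where
  "almost_complete_intersection I \<longleftrightarrow>
     homogeneous_min_gens I = ideal_height xy_ring I + 1 \<and>
     (\<forall>P. minimal_prime xy_ring I P \<longrightarrow>
        min_gens (localization xy_ring P) (localized_ideal xy_ring P I) =
        ideal_height (localization xy_ring P) (localized_ideal xy_ring P I))"

definition simple_graph :: "'v set set \<Rightarrow> bool" where
  "simple_graph E \<longleftrightarrow> (\<forall>e\<in>E. card e = 2)"

definition LSS_ideal :: "'v set set \<Rightarrow> ('v, 'k::field) xy_poly set" where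
  "LSS_ideal E =
     Idl\<^bsub>xy_ring\<^esub>
       {poly_var (XVar i) * poly_var (XVar j) + poly_var (YVar i) * poly_var (YVar j) | i j. {i, j} \<in> E}"

end

theory Submission
  imports Defs
begin

text \<open>An almost complete intersection generated by quadrics is, after discarding superfluous
  generators, generated by \<open>h + 1\<close> quadrics, where \<open>h\<close> is its height. As the field is infinite,
  general linear combinations \<open>f\<^sub>1, \<dots>, f\<^sub>h\<close> of them form a regular sequence and generate the ideal
  locally at each of its minimal primes of height \<open>h\<close>; one further combination \<open>f\<close> completes
  them to a generating set. Every associated prime of \<open>J = (f\<^sub>1, \<dots>, f\<^sub>h)\<close> has height at most \<open>h\<close>, so
  one that contains \<open>f\<close> is a minimal prime of the ideal, and there \<open>f\<close> lies in \<open>J\<close> locally; hence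
  \<open>J : f\<^sup>2 = J : f\<close>, which makes \<open>f\<^sub>1, \<dots>, f\<^sub>h, f\<close> a d-sequence.

  The height bound replaces Macaulay's unmixedness theorem. By exchanging nonzerodivisors, the
  homogeneous maximal ideal is not associated to a regular sequence that is shorter than the number
  \<open>n\<close> of variables, so general linear forms extend \<open>f\<^sub>1, \<dots>, f\<^sub>i\<close> to a regular sequence of length
  \<open>n\<close>. The \<open>n - i\<close> linear forms added are algebraically independent modulo every annihilator in
  the quotient by \<open>f\<^sub>1, \<dots>, f\<^sub>i\<close>, while each strict inclusion in a chain of primes provides
  one more algebraically independent element.\<close>

section \<open>Ideals and primes of Noetherian rings\<close>

text \<open>The choice of \<open>f_1, ..., f_h\<close> is steered by the number of local generators:
  after \<open>i\<close> choices, \<open>h - i\<close> further elements must still suffice at all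
  primes in question. So \<open>f_(i+1)\<close> has to avoid two finite families of ideals at once:
  certain associated primes of \<open>J = (f_1, ..., f_i)\<close> that cover its zero divisors, and,
  for each prime \<open>P\<close> in question, the contraction of \<open>J + P I\<close> from the
  localization, outside of which an element can replace a local generator. The second family does
  not consist of primes in general, so avoidance is linear algebra over the infinite field. The
  combinations are homogeneous because all generators have the same degree. Linear type rests on a
  colon condition: an element of the ideal whose product with \<open>d_(i+1)\<close> lies in
  \<open>(d_1, ..., d_i)\<close> lies there itself. By a double induction on the degree and on the
  number of generators, it rewrites every polynomial relation between the generators, modulo the
  linear relations, with one generator fewer, until nothing is left.\<close>

global_interpretation idl: Modules.module "(*) :: 'a::comm_ring_1 \<Rightarrow> 'a \<Rightarrow> 'a"
  by standard (simp_all add: algebra_simps)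

\<comment> \<open>as a simp rule it reassociates products to the left and loops with \<open>mult.assoc\<close>\<close>
declare idl.scale_scale [simp del]

text \<open>With the ring acting on itself by multiplication, \<open>idl.subspace\<close> means
  ideal and \<open>idl.span\<close> is the generated ideal, so the theory of modules serves for
  ideals.\<close>

definition prime_ideal :: "'a::comm_ring_1 set \<Rightarrow> bool" where
  "prime_ideal P \<longleftrightarrow> idl.subspace P \<and> 1 \<notin> P \<and> (\<forall>a b. a * b \<in> P \<longrightarrow> a \<in> P \<or> b \<in> P)"

definition noetherian :: "'a::comm_ring_1 itself \<Rightarrow> bool" where
  "noetherian (_ :: 'a itself) \<longleftrightarrow>
     (\<forall>J :: 'a set. idl.subspace J \<longrightarrow> (\<exists>B. finite B \<and> idl.span B = J))"

text \<open>The colon ideal \<open>J : z\<close>, that is the annihilator of the class of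
  \<open>z\<close> modulo \<open>J\<close>. The associated primes of \<open>J\<close> are the prime
  ideals among the \<open>col J z\<close>.\<close>

definition col :: "'a::comm_ring_1 set \<Rightarrow> 'a \<Rightarrow> 'a set" where
  "col J z = {r. r * z \<in> J}"

definition nzd :: "'a::comm_ring_1 set \<Rightarrow> 'a \<Rightarrow> bool" where
  "nzd J f \<longleftrightarrow> (\<forall>r. r * f \<in> J \<longrightarrow> r \<in> J)"

lemma prime_idealD:
  assumes "prime_ideal P"
  shows "idl.subspace P" "1 \<notin> P" "a * b \<in> P \<Longrightarrow> a \<in> P \<or> b \<in> P"
  using assms by (auto simp: prime_ideal_def)

lemma ideal_mult:
  assumes "idl.subspace J" "(x::'a::comm_ring_1) \<in> J"
  shows "r * x \<in> J" "x * r \<in> J"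
  using idl.subspace_scale[OF assms(1), of x r] assms(2) by (simp_all add: mult.commute)

lemma subspace_col: "idl.subspace J \<Longrightarrow> idl.subspace (col J z)"
  by (auto simp: idl.subspace_def col_def distrib_right mult.assoc)

lemma col_superset: "idl.subspace J \<Longrightarrow> J \<subseteq> col J z"
  by (auto simp: col_def ideal_mult)

lemma col_mult_superset:
  assumes "idl.subspace J"
  shows "col J z \<subseteq> col J (s * z)"
proof
  fix r assume "r \<in> col J z"
  then have "s * (r * z) \<in> J" using ideal_mult(1)[OF assms] by (simp add: col_def)
  then show "r \<in> col J (s * z)" by (simp add: col_def mult.left_commute[of r s])
qed

text \<open>The union of a chain is finitely generated, and its generators already lie in one member
  of the chain; Zorn's lemma does the rest.\<close>

lemma noetherian_max:
  assumes "noetherian TYPE('a::comm_ring_1)" "\<A> \<noteq> {}" "\<And>A :: 'a set. A \<in> \<A> \<Longrightarrow> idl.subspace A"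
  shows "\<exists>M\<in>\<A>. \<forall>A\<in>\<A>. M \<subseteq> A \<longrightarrow> A = M"
proof (rule subset_Zorn_nonempty[OF assms(2)])
  fix \<C> :: "'a set set" assume C: "\<C> \<noteq> {}" "subset.chain \<A> \<C>"
  have sub: "idl.subspace A" if "A \<in> \<C>" for A
    using C(2) that assms(3) by (auto simp: subset.chain_def)
  have "idl.subspace (\<Union>\<C>)"
  proof (rule idl.subspaceI)
    show "0 \<in> \<Union>\<C>" using C(1) sub idl.subspace_0 by blast
    show "x + y \<in> \<Union>\<C>" if xy: "x \<in> \<Union>\<C>" "y \<in> \<Union>\<C>" for x y
    proof -
      obtain B where "B \<in> \<C>" "{x, y} \<subseteq> B"
        using finite_subset_Union_chain[of "{x,y}" \<C> \<A>] xy C by blast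
      then show ?thesis using sub idl.subspace_add by blast
    qed
    show "c * x \<in> \<Union>\<C>" if "x \<in> \<Union>\<C>" for c x
      using that sub idl.subspace_scale by blast
  qed
  then obtain B where B: "finite B" "idl.span B = \<Union>\<C>"
    using assms(1) by (auto simp: noetherian_def)
  then have "B \<subseteq> \<Union>\<C>" using idl.span_superset by blast
  then obtain D where D: "D \<in> \<C>" "B \<subseteq> D"
    using finite_subset_Union_chain[of B \<C> \<A>] B(1) C by blast
  then have "\<Union>\<C> \<subseteq> D" using B(2) sub idl.span_minimal by blast
  then have "\<Union>\<C> = D" using D by blast
  then show "\<Union>\<C> \<in> \<A>" using D C(2) by (auto simp: subset.chain_def)
qed

text \<open>If \<open>a * b * z \<in> J\<close> but \<open>b * z \<notin> J\<close>, the annihilator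
  of \<open>b * z\<close> contains that of \<open>z\<close>, equals it by maximality, and contains
  \<open>a\<close>. The set \<open>W\<close> says among which elements the annihilator is
  maximal.\<close>

lemma prime_col_of_max:
  assumes J: "idl.subspace J" and W: "z \<in> W" "z \<notin> J" "\<And>b. b * z \<notin> J \<Longrightarrow> b * z \<in> W"
    and max: "\<And>w. w \<in> W \<Longrightarrow> col J z \<subseteq> col J w \<Longrightarrow> col J w = col J z"
  shows "prime_ideal (col J (z::'a::comm_ring_1))"
  unfolding prime_ideal_def
proof (intro conjI allI impI)
  show "idl.subspace (col J z)" by (rule subspace_col[OF J])
  show "1 \<notin> col J z" using W by (simp add: col_def)
  fix a b assume ab: "a * b \<in> col J z"
  show "a \<in> col J z \<or> b \<in> col J z"
  proof (rule disjCI)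
    assume "b \<notin> col J z"
    then have "b * z \<notin> J" by (simp add: col_def)
    then have "col J (b * z) = col J z" using max W(3) col_mult_superset[OF J] by blast
    moreover have "a \<in> col J (b * z)" using ab by (simp add: col_def mult.assoc)
    ultimately show "a \<in> col J z" by simp
  qed
qed

text \<open>Maximality is taken among the multiples of \<open>w\<close> only, so that the associated
  prime annihilates a multiple of the given element.\<close>

lemma exists_prime_col:
  assumes N: "noetherian TYPE('a::comm_ring_1)" and J: "idl.subspace J" and w: "(w::'a) \<notin> J"
  shows "\<exists>s. s * w \<notin> J \<and> prime_ideal (col J (s * w))"
proof -
  define W where "W = {s * w | s. s * w \<notin> J}"
  have "1 * w \<in> W" using w by (auto simp: W_def intro!: exI[of _ 1])
  then have "col J ` W \<noteq> {}" by auto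
  from noetherian_max[OF N this] obtain M where M: "M \<in> col J ` W"
    "\<forall>A\<in>col J ` W. M \<subseteq> A \<longrightarrow> A = M"
    using subspace_col[OF J] by (metis (no_types, lifting) imageE)
  from M(1) obtain z where z: "z \<in> W" "M = col J z" by blast
  then obtain s where s: "z = s * w" "s * w \<notin> J" by (auto simp: W_def)
  have mem: "b * z \<in> W" if "b * z \<notin> J" for b
    using that unfolding W_def s(1) mult.assoc[symmetric] by blast
  have "prime_ideal (col J z)"
    by (rule prime_col_of_max[OF J z(1)]) (use mem s M(2) z(2) in auto)
  then show ?thesis using s by blast
qed

text \<open>Finiteness comes from a single product instead of primary decomposition:
  \<open>J\<close> and \<open>Z\<close> generate the same ideal as \<open>J\<close> and a finite
  \<open>Z0\<close>. If a prime \<open>col J z\<close> differed from all \<open>col J z0\<close>,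
  elements \<open>a z0\<close> of the latter outside the former would have a product that
  annihilates \<open>Z0\<close>, hence also \<open>z\<close>, against primality.\<close>

lemma zero_divisors_finite_primes:
  assumes N: "noetherian TYPE('a::comm_ring_1)" and J: "idl.subspace (J::'a set)"
  shows "\<exists>\<P>. finite \<P> \<and> (\<forall>P\<in>\<P>. prime_ideal P \<and> (\<exists>z. z \<notin> J \<and> P = col J z)) \<and>
           (\<forall>r. nzd J r \<or> (\<exists>P\<in>\<P>. r \<in> P))"
proof -
  \<comment> \<open>The elements outside \<open>J\<close> with maximal annihilator; every zero
    divisor modulo \<open>J\<close> lies in one of these annihilators.\<close>
  define Z where "Z = {z. z \<notin> J \<and> (\<forall>w. w \<notin> J \<longrightarrow> col J z \<subseteq> col J w \<longrightarrow> col J w = col J z)}"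
  have prime: "prime_ideal (col J z)" if "z \<in> Z" for z
    by (rule prime_col_of_max[OF J, where W = "- J"]) (use that in \<open>auto simp: Z_def\<close>)
  have Z: "\<exists>z\<in>Z. col J w \<subseteq> col J z" if "w \<notin> J" for w
  proof -
    define W where "W = {v. v \<notin> J \<and> col J w \<subseteq> col J v}"
    have "col J ` W \<noteq> {}" using that by (auto simp: W_def)
    from noetherian_max[OF N this] obtain M where M: "M \<in> col J ` W"
      "\<forall>A\<in>col J ` W. M \<subseteq> A \<longrightarrow> A = M"
      using subspace_col[OF J] by (metis (no_types, lifting) imageE)
    from M(1) obtain z where z: "z \<in> W" "M = col J z" by blast
    have "z \<in> Z"
      unfolding Z_def
    proof (intro CollectI conjI allI impI)
      show "z \<notin> J" using z by (simp add: W_def)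
      fix v assume v: "v \<notin> J" "col J z \<subseteq> col J v"
      then have "v \<in> W" using z(1) by (auto simp: W_def)
      then show "col J v = col J z" using M(2) z(2) v(2) by blast
    qed
    then show ?thesis using z(1) by (auto simp: W_def)
  qed
  obtain B where B: "finite B" "idl.span B = idl.span (J \<union> Z)"
    using N idl.subspace_span unfolding noetherian_def by blast
  have "\<exists>Z0. finite Z0 \<and> Z0 \<subseteq> Z \<and> b \<in> idl.span (J \<union> Z0)" if "b \<in> idl.span (J \<union> Z)" for b
  proof -
    obtain t r where t: "finite t" "t \<subseteq> J \<union> Z" "(\<Sum>a\<in>t. r a * a) = b"
      using \<open>b \<in> idl.span (J \<union> Z)\<close> by (auto simp: idl.span_explicit)
    have "b \<in> idl.span t" unfolding t(3)[symmetric] by (intro idl.span_sum idl.span_scale idl.span_base)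
    then have "b \<in> idl.span (J \<union> (t \<inter> Z))"
      using idl.span_mono[of t "J \<union> (t \<inter> Z)"] t(2) by blast
    then show ?thesis using t(1) by (intro exI[of _ "t \<inter> Z"]) auto
  qed
  then have "\<forall>b\<in>B. \<exists>Z0. finite Z0 \<and> Z0 \<subseteq> Z \<and> b \<in> idl.span (J \<union> Z0)"
    using B(2) idl.span_base by blast
  then obtain F where F: "\<And>b. b \<in> B \<Longrightarrow> finite (F b) \<and> F b \<subseteq> Z \<and> b \<in> idl.span (J \<union> F b)"
    by metis
  define Z0 where "Z0 = (\<Union>b\<in>B. F b)"
  have Z0: "finite Z0" "Z0 \<subseteq> Z" using F B(1) by (auto simp: Z0_def)
  have "B \<subseteq> idl.span (J \<union> Z0)"
  proof
    fix b assume b: "b \<in> B"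
    then have "J \<union> F b \<subseteq> J \<union> Z0" by (auto simp: Z0_def)
    from idl.span_mono[OF this] F[OF b] show "b \<in> idl.span (J \<union> Z0)" by blast
  qed
  then have span: "idl.span (J \<union> Z) \<subseteq> idl.span (J \<union> Z0)"
    unfolding B(2)[symmetric] using idl.span_minimal idl.subspace_span by blast
  have eq: "\<exists>z0\<in>Z0. col J z = col J z0" if z: "z \<in> Z" for z
  proof (rule ccontr)
    assume no: "\<not> ?thesis"
    have "\<exists>a. a \<in> col J z0 \<and> a \<notin> col J z" if "z0 \<in> Z0" for z0
    proof (rule ccontr)
      assume "\<not> ?thesis"
      then have "col J z0 \<subseteq> col J z" by blast
      moreover have "z0 \<in> Z" "z \<notin> J" using that Z0(2) z by (auto simp: Z_def)
      ultimately have "col J z = col J z0" by (auto simp: Z_def)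
      then show False using no that by blast
    qed
    then obtain a where a: "\<And>z0. z0 \<in> Z0 \<Longrightarrow> a z0 \<in> col J z0 \<and> a z0 \<notin> col J z" by metis
    define p where "p = (\<Prod>z0\<in>Z0. a z0)"
    have "p \<notin> col J z"
      using Z0(1) a unfolding p_def
    proof (induction Z0 rule: finite_induct)
      case empty then show ?case using prime[OF z] prime_idealD(2) by simp
    next
      case (insert x F)
      then show ?case using prime_idealD(3)[OF prime[OF z]] by auto
    qed
    moreover have "J \<union> Z0 \<subseteq> col J p"
    proof
      fix x assume x: "x \<in> J \<union> Z0"
      show "x \<in> col J p"
      proof (cases "x \<in> J")
        case True then show ?thesis using ideal_mult[OF J] by (auto simp: col_def)
      next
        case False
        then have "x \<in> Z0" using x by auto
        then have "p = a x * prod a (Z0 - {x})" unfolding p_def by (simp add: Z0(1) prod.remove)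
        then have "x * p = (a x * x) * prod a (Z0 - {x})" by (simp add: algebra_simps)
        moreover have "a x * x \<in> J" using a[OF \<open>x \<in> Z0\<close>] by (simp add: col_def)
        ultimately show ?thesis using ideal_mult[OF J] by (simp add: col_def)
      qed
    qed
    then have "idl.span (J \<union> Z0) \<subseteq> col J p"
      by (rule idl.span_minimal) (rule subspace_col[OF J])
    then have "z \<in> col J p" using span z idl.span_base by blast
    ultimately show False by (simp add: col_def mult.commute)
  qed
  have "nzd J r \<or> (\<exists>P\<in>col J ` Z0. r \<in> P)" for r
  proof (rule disjCI)
    assume no: "\<not> (\<exists>P\<in>col J ` Z0. r \<in> P)"
    show "nzd J r"
      unfolding nzd_def
    proof (intro allI impI, rule ccontr)
      fix w assume "w * r \<in> J" "w \<notin> J"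
      then obtain z where "z \<in> Z" "col J w \<subseteq> col J z" using Z by blast
      moreover have "r \<in> col J w" using \<open>w * r \<in> J\<close> by (simp add: col_def mult.commute)
      ultimately show False using eq no by blast
    qed
  qed
  then show ?thesis
    using Z0 prime by (intro exI[of _ "col J ` Z0"]) (auto simp: Z_def)
qed

text \<open>Noetherian induction: a maximal counterexample \<open>M\<close> is not prime, so
  \<open>a * b \<in> M\<close> with \<open>a\<close> and \<open>b\<close> outside. Each prime above
  \<open>M\<close> contains \<open>a\<close> or \<open>b\<close>, and the families for the two
  larger ideals together serve \<open>M\<close>. The family may contain primes that are not
  minimal.\<close>

lemma finite_minimal_primes:
  assumes N: "noetherian TYPE('a::comm_ring_1)" and I: "idl.subspace (I::'a set)"
  shows "\<exists>\<P>. finite \<P> \<and> (\<forall>P\<in>\<P>. prime_ideal P \<and> I \<subseteq> P) \<and>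
           (\<forall>Q. prime_ideal Q \<longrightarrow> I \<subseteq> Q \<longrightarrow> (\<exists>P\<in>\<P>. P \<subseteq> Q))" (is "?good I")
proof (rule ccontr)
  assume "\<not> ?good I"
  then have "{A. idl.subspace A \<and> \<not> ?good A} \<noteq> {}" using I by blast
  from noetherian_max[OF N this] obtain M where M: "idl.subspace M" "\<not> ?good M"
    "\<And>A. idl.subspace A \<Longrightarrow> \<not> ?good A \<Longrightarrow> M \<subseteq> A \<Longrightarrow> A = M" by auto
  have "1 \<notin> M"
  proof
    assume "1 \<in> M"
    then have "?good M" by (intro exI[of _ "{}"]) (auto simp: prime_ideal_def)
    then show False using M(2) by blast
  qed
  moreover have "\<not> prime_ideal M"
  proof
    assume "prime_ideal M"
    then have "?good M" by (intro exI[of _ "{M}"]) auto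
    then show False using M(2) by blast
  qed
  ultimately obtain a b where ab: "a * b \<in> M" "a \<notin> M" "b \<notin> M"
    using M(1) by (auto simp: prime_ideal_def)
  have good: "?good (idl.span (insert c M))" if "c \<notin> M" for c
  proof (rule ccontr)
    assume "\<not> ?thesis"
    then have "idl.span (insert c M) = M"
      by (intro M(3)) (auto intro: idl.span_base idl.subspace_span)
    then show False using that idl.span_base by blast
  qed
  obtain \<P>1 where P1: "finite \<P>1" "\<forall>P\<in>\<P>1. prime_ideal P \<and> idl.span (insert a M) \<subseteq> P"
    "\<forall>Q. prime_ideal Q \<longrightarrow> idl.span (insert a M) \<subseteq> Q \<longrightarrow> (\<exists>P\<in>\<P>1. P \<subseteq> Q)" using good[OF ab(2)] by blast
  obtain \<P>2 where P2: "finite \<P>2" "\<forall>P\<in>\<P>2. prime_ideal P \<and> idl.span (insert b M) \<subseteq> P"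
    "\<forall>Q. prime_ideal Q \<longrightarrow> idl.span (insert b M) \<subseteq> Q \<longrightarrow> (\<exists>P\<in>\<P>2. P \<subseteq> Q)" using good[OF ab(3)] by blast
  have "?good M"
  proof (intro exI[of _ "\<P>1 \<union> \<P>2"] conjI allI impI ballI)
    show "finite (\<P>1 \<union> \<P>2)" using P1 P2 by simp
    show "prime_ideal P" if "P \<in> \<P>1 \<union> \<P>2" for P using that P1(2) P2(2) by auto
    show "M \<subseteq> P" if "P \<in> \<P>1 \<union> \<P>2" for P
    proof -
      have "idl.span (insert a M) \<subseteq> P \<or> idl.span (insert b M) \<subseteq> P"
        using that P1(2) P2(2) by auto
      then show ?thesis
        using idl.span_superset[of "insert a M"] idl.span_superset[of "insert b M"] by fastforce
    qed
    fix Q assume Q: "prime_ideal Q" "M \<subseteq> Q"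
    then have "a \<in> Q \<or> b \<in> Q" using ab(1) prime_idealD(3) by blast
    then have "idl.span (insert a M) \<subseteq> Q \<or> idl.span (insert b M) \<subseteq> Q"
      using Q idl.span_minimal[of "insert a M" Q] idl.span_minimal[of "insert b M" Q]
      by (auto simp: prime_ideal_def)
    then show "\<exists>P\<in>\<P>1 \<union> \<P>2. P \<subseteq> Q" using Q(1) unfolding bex_Un using P1(3) P2(3) by metis
  qed
  then show False using M(2) by blast
qed

section \<open>The Hilbert basis theorem\<close>

text \<open>Subrings and their ideals are subsets of one type, so that variables can be adjoined one
  after the other without a change of type.\<close>

definition subring_set :: "'a::comm_ring_1 set \<Rightarrow> bool" where
  "subring_set A \<longleftrightarrow> 1 \<in> A \<and> (\<forall>x\<in>A. \<forall>y\<in>A. x - y \<in> A \<and> x * y \<in> A)"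

definition subspace_over :: "'a::comm_ring_1 set \<Rightarrow> 'a set \<Rightarrow> bool" where
  "subspace_over A J \<longleftrightarrow> 0 \<in> J \<and> (\<forall>x\<in>J. \<forall>y\<in>J. x + y \<in> J) \<and> (\<forall>a\<in>A. \<forall>x\<in>J. a * x \<in> J)"

definition span_over :: "'a::comm_ring_1 set \<Rightarrow> 'a set \<Rightarrow> 'a set" where
  "span_over A B = {\<Sum>b\<in>B. c b * b | c. \<forall>b\<in>B. c b \<in> A}"

definition noetherian_on :: "'a::comm_ring_1 set \<Rightarrow> bool" where
  "noetherian_on A \<longleftrightarrow>
     (\<forall>J\<subseteq>A. subspace_over A J \<longrightarrow> (\<exists>B. finite B \<and> B \<subseteq> J \<and> J \<subseteq> span_over A B))"

definition adjoin :: "'a::comm_ring_1 set \<Rightarrow> 'a \<Rightarrow> 'a set" where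
  "adjoin A u = {poly p u | p. \<forall>i. coeff p i \<in> A}"

lemma subring_setD:
  assumes "subring_set A"
  shows "0 \<in> A" "1 \<in> A" "x \<in> A \<Longrightarrow> y \<in> A \<Longrightarrow> x + y \<in> A" "x \<in> A \<Longrightarrow> y \<in> A \<Longrightarrow> x - y \<in> A"
    "x \<in> A \<Longrightarrow> y \<in> A \<Longrightarrow> x * y \<in> A" "x \<in> A \<Longrightarrow> - x \<in> A"
proof -
  show 0: "0 \<in> A" using assms unfolding subring_set_def by (metis diff_self)
  show m: "- x \<in> A" if "x \<in> A" for x using assms 0 that unfolding subring_set_def by (metis diff_0)
  show "x + y \<in> A" if "x \<in> A" "y \<in> A"
    using assms m[OF that(2)] that unfolding subring_set_def by (metis diff_minus_eq_add)
qed (use assms in \<open>auto simp: subring_set_def\<close>)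

lemma subring_sum: "subring_set A \<Longrightarrow> (\<And>x. x \<in> S \<Longrightarrow> f x \<in> A) \<Longrightarrow> sum f S \<in> A"
  by (induction S rule: infinite_finite_induct) (auto simp: subring_setD)

lemma subspace_over_sum: "subspace_over A J \<Longrightarrow> (\<And>x. x \<in> S \<Longrightarrow> f x \<in> J) \<Longrightarrow> sum f S \<in> J"
  by (induction S rule: infinite_finite_induct) (auto simp: subspace_over_def)

lemma subspace_over_span_over:
  assumes "subring_set A"
  shows "subspace_over A (span_over A B)"
  unfolding subspace_over_def
proof (intro conjI ballI)
  show "0 \<in> span_over A B"
    unfolding span_over_def using subring_setD(1)[OF assms] by (intro CollectI exI[of _ "\<lambda>_. 0"]) auto
next
  fix x y assume "x \<in> span_over A B" "y \<in> span_over A B"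
  then obtain c d where "x = (\<Sum>b\<in>B. c b * b)" "y = (\<Sum>b\<in>B. d b * b)" "\<forall>b\<in>B. c b \<in> A \<and> d b \<in> A"
    by (auto simp: span_over_def)
  then show "x + y \<in> span_over A B"
    unfolding span_over_def using subring_setD(3)[OF assms]
    by (intro CollectI exI[of _ "\<lambda>b. c b + d b"]) (auto simp: distrib_right sum.distrib)
next
  fix a x assume "a \<in> A" "x \<in> span_over A B"
  then obtain c where "x = (\<Sum>b\<in>B. c b * b)" "\<forall>b\<in>B. c b \<in> A" by (auto simp: span_over_def)
  then show "a * x \<in> span_over A B"
    unfolding span_over_def using subring_setD(5)[OF assms \<open>a \<in> A\<close>]
    by (intro CollectI exI[of _ "\<lambda>b. a * c b"]) (auto simp: sum_distrib_left mult.assoc)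
qed

lemma span_over_base:
  assumes "subring_set A" "finite B" "b \<in> B"
  shows "b \<in> span_over A B"
  unfolding span_over_def using subring_setD(1,2)[OF assms(1)] assms(2,3)
  by (intro CollectI exI[of _ "\<lambda>x. if x = b then 1 else 0"]) (auto simp: if_distrib[of "\<lambda>c. c * _"] cong: if_cong)

lemma coeff_mult_in:
  assumes "subring_set A" "\<forall>i. coeff p i \<in> A" "\<forall>i. coeff q i \<in> A"
  shows "coeff (p * q) i \<in> A"
  unfolding coeff_mult
  by (rule subring_sum[OF assms(1)]) (use assms(2,3) in \<open>auto intro: subring_setD(5)[OF assms(1)]\<close>)

lemma adjoinI: "(\<And>i. coeff p i \<in> A) \<Longrightarrow> poly p u \<in> adjoin A u"
  by (auto simp: adjoin_def)

lemma adjoin_base: "subring_set A \<Longrightarrow> a \<in> A \<Longrightarrow> a \<in> adjoin A u"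
  unfolding adjoin_def by (rule CollectI, rule exI[of _ "[:a:]"]) (auto simp: coeff_pCons subring_setD split: nat.split)

lemma adjoin_var: "subring_set A \<Longrightarrow> u \<in> adjoin A u"
  unfolding adjoin_def by (rule CollectI, rule exI[of _ "[:0, 1:]"]) (auto simp: coeff_pCons subring_setD split: nat.split)

lemma subring_adjoin:
  assumes "subring_set A"
  shows "subring_set (adjoin A u)"
  unfolding subring_set_def
proof (intro conjI ballI)
  show "1 \<in> adjoin A u" by (rule adjoin_base[OF assms subring_setD(2)[OF assms]])
  fix x y assume "x \<in> adjoin A u" "y \<in> adjoin A u"
  then obtain p q where pq: "x = poly p u" "y = poly q u" "\<forall>i. coeff p i \<in> A" "\<forall>i. coeff q i \<in> A"
    by (auto simp: adjoin_def)
  have "poly (p - q) u \<in> adjoin A u" by (rule adjoinI) (use pq subring_setD(4)[OF assms] in auto)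
  then show "x - y \<in> adjoin A u" using pq by simp
  have "poly (p * q) u \<in> adjoin A u" by (rule adjoinI) (use pq coeff_mult_in[OF assms] in auto)
  then show "x * y \<in> adjoin A u" using pq by simp
qed

text \<open>Hilbert's argument with leading coefficients, carried out for the polynomials over
  \<open>A\<close> whose value at \<open>u\<close> lies in \<open>J\<close>; it thus covers
  algebraic and transcendental \<open>u\<close> alike.\<close>

lemma noetherian_on_adjoin:
  assumes A: "subring_set A" and N: "noetherian_on A"
  shows "noetherian_on (adjoin A u)"
  unfolding noetherian_on_def
proof (intro allI impI)
  fix J assume J: "J \<subseteq> adjoin A u" "subspace_over (adjoin A u) J"
  note D = subring_setD[OF A]
  define PJ where "PJ = {p. (\<forall>i. coeff p i \<in> A) \<and> poly p u \<in> J}"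
  \<comment> \<open>Coefficients in degree \<open>n\<close> of members of degree at most
    \<open>n\<close>, so that \<open>0\<close> is included and the sets increase with
    \<open>n\<close>.\<close>
  define L where "L n = {coeff p n | p. p \<in> PJ \<and> (\<forall>i>n. coeff p i = 0)}" for n
  have PJ0: "0 \<in> PJ" and PJadd: "p \<in> PJ \<Longrightarrow> q \<in> PJ \<Longrightarrow> p + q \<in> PJ"
    and PJmult: "\<forall>i. coeff r i \<in> A \<Longrightarrow> p \<in> PJ \<Longrightarrow> r * p \<in> PJ" for p q r
    using J(2) D coeff_mult_in[OF A] adjoinI[of r A u]
    by (auto simp: PJ_def subspace_over_def)
  have PJsmult: "smult a p \<in> PJ" if "a \<in> A" "p \<in> PJ" for a p
    using PJmult[of "[:a:]" p] that D(1) by (auto simp: coeff_pCons split: nat.split)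
  have PJdiff: "p - q \<in> PJ" if "p \<in> PJ" "q \<in> PJ" for p q
    using PJadd[OF that(1) PJsmult[of "-1" q]] that(2) D(6)[OF D(2)] by simp
  have PJsum: "sum f S \<in> PJ" if "\<And>x. x \<in> S \<Longrightarrow> f x \<in> PJ" for f :: "'a \<Rightarrow> 'a poly" and S
    using that by (induction S rule: infinite_finite_induct) (auto simp: PJ0 PJadd)
  have LA: "L n \<subseteq> A" for n by (auto simp: L_def PJ_def)
  have L: "subspace_over A (L n)" for n
    unfolding subspace_over_def
  proof (intro conjI ballI)
    show "0 \<in> L n" unfolding L_def using PJ0 by (intro CollectI exI[of _ 0]) auto
  next
    fix x y assume "x \<in> L n" "y \<in> L n"
    then obtain p q where "x = coeff p n" "y = coeff q n" "p \<in> PJ" "q \<in> PJ"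
      "\<forall>i>n. coeff p i = 0" "\<forall>i>n. coeff q i = 0" by (auto simp: L_def)
    then show "x + y \<in> L n" unfolding L_def using PJadd by (intro CollectI exI[of _ "p + q"]) auto
  next
    fix a x assume "a \<in> A" "x \<in> L n"
    then obtain p where "x = coeff p n" "p \<in> PJ" "\<forall>i>n. coeff p i = 0" by (auto simp: L_def)
    then show "a * x \<in> L n" unfolding L_def using PJsmult \<open>a \<in> A\<close>
      by (intro CollectI exI[of _ "smult a p"]) auto
  qed
  have shift: "monom 1 k * p \<in> PJ" if "p \<in> PJ" for k p
    by (rule PJmult) (use that D(1,2) in \<open>auto simp: coeff_monom\<close>)
  have Lmono: "L n \<subseteq> L (n + k)" for n k
  proof
    fix x assume "x \<in> L n"
    then obtain p where p: "x = coeff p n" "p \<in> PJ" "\<forall>i>n. coeff p i = 0" by (auto simp: L_def)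
    show "x \<in> L (n + k)" unfolding L_def
      using p shift[OF p(2), of k]
      by (intro CollectI exI[of _ "monom 1 k * p"]) (auto simp: coeff_monom_mult)
  qed
  have Lmono': "L m \<subseteq> L n" if "m \<le> n" for m n
    using Lmono[of m "n - m"] that by simp
  define LL where "LL = (\<Union>n. L n)"
  have LL1: "subspace_over A LL"
    unfolding subspace_over_def
  proof (intro conjI ballI)
    show "0 \<in> LL" using L by (auto simp: LL_def subspace_over_def)
    show "a * x \<in> LL" if "a \<in> A" "x \<in> LL" for a x
      using that L unfolding LL_def subspace_over_def by blast
    fix x y assume "x \<in> LL" "y \<in> LL"
    then obtain m n where "x \<in> L m" "y \<in> L n" by (auto simp: LL_def)
    then have "x \<in> L (max m n)" "y \<in> L (max m n)" using Lmono'[of m "max m n"] Lmono'[of n "max m n"] by auto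
    then show "x + y \<in> LL" using L by (auto simp: LL_def subspace_over_def)
  qed
  have LL2: "LL \<subseteq> A" using LA by (auto simp: LL_def)
  note N' = N[unfolded noetherian_on_def, rule_format]
  obtain B where B: "finite B" "B \<subseteq> LL" "LL \<subseteq> span_over A B"
    using N'[OF LL2 LL1] by blast
  \<comment> \<open>The finitely many generators of the union appear at a common stage
    \<open>m\<close>, from which on they generate all \<open>L n\<close>.\<close>
  have "\<exists>m. B \<subseteq> L m"
    using B(1,2)
  proof (induction B rule: finite_induct)
    case (insert x F)
    then obtain m n where "F \<subseteq> L m" "x \<in> L n" by (auto simp: LL_def)
    then have "insert x F \<subseteq> L (max m n)" using Lmono'[of m "max m n"] Lmono'[of n "max m n"] by auto
    then show ?case by blast
  qed auto
  then obtain m where m: "B \<subseteq> L m" by blast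
  have "\<forall>n. \<exists>C. finite C \<and> C \<subseteq> L n \<and> L n \<subseteq> span_over A C"
    using N'[OF LA L] by blast
  then obtain C where C: "\<And>n. finite (C n)" "\<And>n. C n \<subseteq> L n" "\<And>n. L n \<subseteq> span_over A (C n)" by metis
  have "\<forall>n. \<forall>b\<in>L n. \<exists>p. p \<in> PJ \<and> (\<forall>i>n. coeff p i = 0) \<and> coeff p n = b"
    by (auto simp: L_def)
  then obtain g where g: "\<And>n b. b \<in> L n \<Longrightarrow> g n b \<in> PJ" "\<And>n b i. b \<in> L n \<Longrightarrow> i > n \<Longrightarrow> coeff (g n b) i = 0"
    "\<And>n b. b \<in> L n \<Longrightarrow> coeff (g n b) n = b" by metis
  define G where "G = (\<lambda>p. poly p u) ` ((\<Union>n<m. g n ` C n) \<union> g m ` B)"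
  define S where "S = span_over (adjoin A u) G"
  have fin: "finite G" using B(1) C(1) by (auto simp: G_def)
  have GJ: "G \<subseteq> J" using g(1) C(2) m by (auto simp: G_def PJ_def)
  have S: "subspace_over (adjoin A u) S" unfolding S_def by (rule subspace_over_span_over[OF subring_adjoin[OF A]])
  have GS: "x \<in> S" if "x \<in> G" for x
    unfolding S_def by (rule span_over_base[OF subring_adjoin[OF A] fin that])
  have main: "poly p u \<in> S" if "p \<in> PJ" "\<forall>i\<ge>n. coeff p i = 0" for p n
    using that
  proof (induction n arbitrary: p)
    case 0
    then have "p = 0" by (auto intro: poly_eqI)
    then show ?case using S by (auto simp: subspace_over_def)
  next
    case (Suc n)
    have pL: "coeff p n \<in> L n" using Suc.prems by (auto simp: L_def Suc_le_eq)
    \<comment> \<open>Below degree \<open>m\<close> the chosen lifts for \<open>L n\<close> serve;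
      from \<open>m\<close> on, the lifts for \<open>L m\<close> are multiplied by a power of the
      variable.\<close>
    have "\<exists>B' h. finite B' \<and> coeff p n \<in> span_over A B' \<and>
       (\<forall>b\<in>B'. h b \<in> PJ \<and> (\<forall>i>n. coeff (h b) i = 0) \<and> coeff (h b) n = b \<and> poly (h b) u \<in> S)"
    proof (cases "n < m")
      case True
      have "poly (g n b) u \<in> S" if "b \<in> C n" for b
        by (rule GS) (use that True in \<open>auto simp: G_def\<close>)
      then show ?thesis using C g pL by (intro exI[of _ "C n"] exI[of _ "g n"]) blast
    next
      case False
      have 1: "poly (monom 1 (n - m) * g m b) u \<in> S" if "b \<in> B" for b
      proof -
        have "poly (g m b) u \<in> S" by (rule GS) (use that in \<open>auto simp: G_def\<close>)
        moreover have "poly (monom 1 (n - m)) u \<in> adjoin A u"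
          by (rule adjoinI) (use D(1,2) in \<open>auto simp: coeff_monom\<close>)
        ultimately show ?thesis using S by (auto simp: subspace_over_def)
      qed
      have 2: "coeff p n \<in> span_over A B" using pL B(3) by (auto simp: LL_def)
      show ?thesis
      proof (intro exI[of _ B] exI[of _ "\<lambda>b. monom 1 (n - m) * g m b"] conjI ballI allI impI)
        fix b assume b: "b \<in> B"
        then have bL: "b \<in> L m" using m by blast
        show "monom 1 (n - m) * g m b \<in> PJ" using shift g(1)[OF bL] by blast
        show "coeff (monom 1 (n - m) * g m b) i = 0" if "i > n" for i
          using that False g(2)[OF bL, of "i - (n - m)"] by (auto simp: coeff_monom_mult)
        show "coeff (monom 1 (n - m) * g m b) n = b"
          using False g(3)[OF bL] by (simp add: coeff_monom_mult)
        show "poly (monom 1 (n - m) * g m b) u \<in> S" using 1 b by blast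
      qed (use B(1) 2 in auto)
    qed
    then obtain B' h where h: "finite B'" "coeff p n \<in> span_over A B'"
      "\<And>b. b \<in> B' \<Longrightarrow> h b \<in> PJ" "\<And>b i. b \<in> B' \<Longrightarrow> i > n \<Longrightarrow> coeff (h b) i = 0"
      "\<And>b. b \<in> B' \<Longrightarrow> coeff (h b) n = b" "\<And>b. b \<in> B' \<Longrightarrow> poly (h b) u \<in> S" by metis
    then obtain c where c: "coeff p n = (\<Sum>b\<in>B'. c b * b)" "\<And>b. b \<in> B' \<Longrightarrow> c b \<in> A"
      by (auto simp: span_over_def)
    define s where "s = (\<Sum>b\<in>B'. smult (c b) (h b))"
    have sPJ: "s \<in> PJ" unfolding s_def by (rule PJsum) (use PJsmult c h in blast)
    have "poly s u = (\<Sum>b\<in>B'. c b * poly (h b) u)" by (simp add: s_def poly_sum)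
    also have "\<dots> \<in> S"
      by (rule subspace_over_sum[OF S])
        (use S c(2) h(6) adjoin_base[OF A] in \<open>auto simp: subspace_over_def\<close>)
    finally have sS: "poly s u \<in> S" .
    have s0: "coeff s i = 0" if "i > n" for i using h(4) that by (simp add: s_def coeff_sum)
    have sn: "coeff s n = coeff p n" unfolding c(1) s_def coeff_sum by (rule sum.cong) (use h in auto)
    have "poly (p - s) u \<in> S"
    proof (rule Suc.IH)
      show "p - s \<in> PJ" using PJdiff Suc.prems(1) sPJ by blast
      show "\<forall>i\<ge>n. coeff (p - s) i = 0"
      proof (intro allI impI)
        fix i assume "n \<le> i"
        then show "coeff (p - s) i = 0" using sn s0[of i] Suc.prems(2) by (cases "i = n") auto
      qed
    qed
    then have "poly (p - s) u + poly s u \<in> S" using sS S unfolding subspace_over_def by blast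
    then show ?case by simp
  qed
  have "J \<subseteq> S"
  proof
    fix x assume "x \<in> J"
    then obtain p where "x = poly p u" "\<forall>i. coeff p i \<in> A" using J(1) by (auto simp: adjoin_def)
    moreover have "\<forall>i\<ge>Suc (degree p). coeff p i = 0" by (auto intro: coeff_eq_0)
    ultimately show "x \<in> S" using main[of p "Suc (degree p)"] \<open>x \<in> J\<close> by (auto simp: PJ_def)
  qed
  then show "\<exists>B. finite B \<and> B \<subseteq> J \<and> J \<subseteq> span_over (adjoin A u) B"
    using fin GJ by (auto simp: S_def)
qed

section \<open>Polynomial rings over a field\<close>

type_synonym ('x, 'k) mpoly = "('x \<Rightarrow>\<^sub>0 nat) \<Rightarrow>\<^sub>0 'k"

definition cst :: "'k::field \<Rightarrow> ('x, 'k) mpoly" where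
  "cst c = Poly_Mapping.single 0 c"

definition mvar :: "'x \<Rightarrow> ('x, 'k::field) mpoly" where
  "mvar v = Poly_Mapping.single (Poly_Mapping.single v 1) 1"

lemma cst_simps [simp]: "cst 0 = 0" "cst 1 = 1"
  by (simp_all add: cst_def)

lemma cst_add: "cst (a + b) = cst a + cst b"
  and cst_mult: "cst (a * b) = cst a * cst b"
  and cst_diff: "cst (a - b) = cst a - cst b"
  by (simp_all add: cst_def single_add mult_single single_diff)

lemma cst_inverse: "c \<noteq> 0 \<Longrightarrow> cst (inverse c) * cst c = 1"
  by (simp flip: cst_mult)

text \<open>A second structure on the same polynomials: \<open>kv.span\<close> forms combinations
  with constant coefficients, which preserve the degree, in contrast to
  \<open>idl.span\<close>.\<close>

global_interpretation kv: vector_space "\<lambda>c p. cst c * p :: ('x, 'k::field) mpoly"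
  by standard (simp_all add: algebra_simps cst_add cst_mult)

declare kv.scale_scale [simp del]

lemma poly_mapping_sum_single: "p = (\<Sum>m\<in>Poly_Mapping.keys p. Poly_Mapping.single m (Poly_Mapping.lookup p m))"
  by (rule poly_mapping_eqI) (simp add: lookup_sum lookup_single when_def in_keys_iff sum.delta)

lemma single_eq_cst_mult: "Poly_Mapping.single m c = cst c * Poly_Mapping.single m 1"
  by (simp add: cst_def mult_single)

lemma single_in_subring:
  fixes A :: "('x::finite, 'k::field) mpoly set"
  assumes "subring_set A" "range cst \<subseteq> A" "\<And>v. mvar v \<in> A"
  shows "Poly_Mapping.single m c \<in> A"
proof (induction "\<Sum>v\<in>UNIV. Poly_Mapping.lookup m v" arbitrary: m)
  case 0
  then have "m = 0" by (intro poly_mapping_eqI) auto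
  then show ?case using assms(2) by (auto simp: cst_def)
next
  case (Suc n)
  then obtain v where v: "Poly_Mapping.lookup m v \<noteq> 0" by (metis sum.neutral nat.distinct(1))
  define m' where "m' = m - Poly_Mapping.single v 1"
  have m: "m = Poly_Mapping.single v 1 + m'"
    using v by (intro poly_mapping_eqI) (auto simp: m'_def lookup_add lookup_minus lookup_single when_def)
  have "Suc n = Suc (\<Sum>v\<in>UNIV. Poly_Mapping.lookup m' v)"
    unfolding Suc.hyps(2) m by (simp add: lookup_add lookup_single sum.distrib when_def sum.delta)
  then have "Poly_Mapping.single m' c \<in> A" using Suc.hyps(1) by blast
  then have "mvar v * Poly_Mapping.single m' c \<in> A" using subring_setD(5)[OF assms(1)] assms(3) by blast
  then show ?case by (simp add: m mvar_def mult_single)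
qed

lemma subring_eq_UNIV:
  fixes A :: "('x::finite, 'k::field) mpoly set"
  assumes "subring_set A" "range cst \<subseteq> A" "\<And>v. mvar v \<in> A"
  shows "p \<in> A"
  by (subst poly_mapping_sum_single) (intro subring_sum[OF assms(1)] single_in_subring assms)

primrec adj :: "('x, 'k::field) mpoly list \<Rightarrow> ('x, 'k) mpoly set" where
  "adj [] = range cst"
| "adj (u # us) = adjoin (adj us) u"

lemma subring_adj: "subring_set (adj us)"
proof (induction us)
  case Nil
  show ?case
    unfolding subring_set_def
    by (auto simp flip: cst_simps(2) cst_diff cst_mult)
qed (simp add: subring_adjoin)

lemma cst_in_adj: "cst c \<in> adj us"
  by (induction us) (auto intro: adjoin_base subring_adj)

lemma var_in_adj: "u \<in> set us \<Longrightarrow> u \<in> adj us"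
  by (induction us) (auto intro: adjoin_base adjoin_var subring_adj)

lemma noetherian_on_adj: "noetherian_on (adj us)"
proof (induction us)
  case Nil
  show ?case
    unfolding noetherian_on_def
  proof (intro allI impI)
    fix J :: "(('a \<Rightarrow>\<^sub>0 nat) \<Rightarrow>\<^sub>0 'b) set" assume J: "J \<subseteq> adj []" "subspace_over (adj []) J"
    show "\<exists>B. finite B \<and> B \<subseteq> J \<and> J \<subseteq> span_over (adj []) B"
    proof (cases "J \<subseteq> {0}")
      case True
      then show ?thesis by (intro exI[of _ "{}"]) (auto simp: span_over_def)
    next
      case False
      then obtain c where c: "cst c \<in> J" "c \<noteq> 0" using J(1) by fastforce
      have "x \<in> span_over (adj []) {cst c}" if "x \<in> J" for x
      proof -
        obtain d where "x = cst d" using J(1) \<open>x \<in> J\<close> by auto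
        then have "x = cst (d / c) * cst c" using c(2) by (simp flip: cst_mult)
        then show ?thesis unfolding span_over_def by (intro CollectI exI[of _ "\<lambda>_. cst (d / c)"]) auto
      qed
      then show ?thesis using c by (intro exI[of _ "{cst c}"]) auto
    qed
  qed
qed (simp add: noetherian_on_adjoin subring_adj)

lemma noetherian_polynomials: "noetherian TYPE(('x::finite, 'k::field) mpoly)"
  unfolding noetherian_def
proof (intro allI impI)
  fix J :: "('x, 'k) mpoly set" assume J: "idl.subspace J"
  obtain xs :: "'x list" where xs: "set xs = UNIV" using finite_list[OF finite_UNIV] by blast
  have "p \<in> adj (map mvar xs)" for p :: "('x, 'k) mpoly"
    by (rule subring_eq_UNIV[OF subring_adj]) (use cst_in_adj xs in \<open>auto intro: var_in_adj\<close>)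
  then have "adj (map mvar xs) = (UNIV :: ('x, 'k) mpoly set)" by blast
  then have "noetherian_on (UNIV :: ('x, 'k) mpoly set)" using noetherian_on_adj by metis
  moreover have "subspace_over UNIV J" using J by (auto simp: subspace_over_def idl.subspace_def)
  ultimately obtain B where B: "finite B" "B \<subseteq> J" "J \<subseteq> span_over UNIV B"
    unfolding noetherian_on_def by blast
  have "idl.span B = J"
  proof
    show "idl.span B \<subseteq> J" by (rule idl.span_minimal[OF B(2) J])
    show "J \<subseteq> idl.span B" using B(1,3) by (auto simp: span_over_def idl.span_finite)
  qed
  then show "\<exists>B. finite B \<and> idl.span B = J" using B(1) by blast
qed

section \<open>Algebraic independence modulo an ideal\<close>

text \<open>Algebraic independence over the field modulo \<open>P\<close>, built from the end of the
  list: each entry is transcendental over the subalgebra of the later ones. Here \<open>P\<close>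
  stands for annihilators of arbitrary elements as well as for primes.\<close>

primrec indep :: "('x, 'k::field) mpoly set \<Rightarrow> ('x, 'k) mpoly list \<Rightarrow> bool" where
  "indep P [] \<longleftrightarrow> 1 \<notin> P"
| "indep P (u # us) \<longleftrightarrow> indep P us \<and> (\<forall>p. p \<noteq> 0 \<longrightarrow> (\<forall>i. coeff p i \<in> adj us) \<longrightarrow> poly p u \<notin> P)"

text \<open>Coefficients taken from the subalgebra of an independent list stay nonzero modulo
  \<open>P\<close>; for constants this is because they are units.\<close>

lemma indep_not_in:
  assumes "idl.subspace P" "indep P us" "x \<in> adj us" "x \<noteq> 0"
  shows "x \<notin> P"
proof (cases us)
  case Nil
  then obtain c where c: "x = cst c" using assms(3) by auto
  then have "c \<noteq> 0" using assms(4) by auto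
  then have "cst (inverse c) * x = 1" unfolding c by (rule cst_inverse)
  then show ?thesis using ideal_mult(1)[OF assms(1)] assms(2) Nil by (metis indep.simps(1))
next
  case (Cons u us')
  then obtain p where "x = poly p u" "\<forall>i. coeff p i \<in> adj us'"
    using assms(3) by (auto simp: adjoin_def)
  then show ?thesis using assms(2,4) Cons by (metis indep.simps(2) poly_0)
qed

lemma indep_antimono: "P \<subseteq> P' \<Longrightarrow> indep P' us \<Longrightarrow> indep P us"
  by (induction us) auto

text \<open>Isolates the lowest nonzero coefficient \<open>a\<close>: once the power of the variable
  is cancelled, \<open>a\<close> is what remains modulo the element substituted for the
  variable.\<close>

lemma poly_factor_X_power:
  fixes p :: "'a::comm_ring_1 poly"
  assumes "p \<noteq> 0"
  obtains k a r where "p = monom 1 k * pCons a r" "a \<noteq> 0" "\<And>i. coeff (pCons a r) i = coeff p (i + k)"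
proof -
  define k where "k = (LEAST i. coeff p i \<noteq> 0)"
  have k: "coeff p k \<noteq> 0" unfolding k_def by (rule LeastI_ex) (use assms in \<open>auto simp: poly_eq_iff\<close>)
  have lt: "coeff p i = 0" if "i < k" for i using that not_less_Least unfolding k_def by blast
  obtain a r where ar: "poly_shift k p = pCons a r" by (cases "poly_shift k p")
  have c: "coeff (pCons a r) i = coeff p (i + k)" for i unfolding ar[symmetric] by (simp add: coeff_poly_shift)
  have "p = monom 1 k * pCons a r"
  proof (rule poly_eqI)
    show "coeff p n = coeff (monom 1 k * pCons a r) n" for n
      using c[of "n - k"] lt[of n] by (simp add: coeff_monom_mult del: mult_pCons_right)
  qed
  moreover have "a \<noteq> 0" using c[of 0] k by simp
  ultimately show ?thesis using that c by blast
qed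

text \<open>In a relation for \<open>f\<close> modulo \<open>P\<close>, the power of
  \<open>f\<close> cancels because \<open>P\<close> is prime. Modulo the larger \<open>P'\<close>,
  where \<open>f\<close> vanishes, only the constant term is left, and it contradicts the
  independence of \<open>us\<close>.\<close>

lemma indep_Cons_of_prime:
  assumes P: "prime_ideal P" and P': "idl.subspace P'" and sub: "P \<subseteq> P'"
    and f: "f \<in> P'" "f \<notin> P" and us: "indep P' us"
  shows "indep P (f # us)"
  unfolding indep.simps
proof (intro conjI allI impI)
  show "indep P us" by (rule indep_antimono[OF sub us])
  fix p :: "(('a \<Rightarrow>\<^sub>0 nat) \<Rightarrow>\<^sub>0 'b) poly" assume p: "p \<noteq> 0" "\<forall>i. coeff p i \<in> adj us"
  obtain k a r where ar: "p = monom 1 k * pCons a r" "a \<noteq> 0" "\<And>i. coeff (pCons a r) i = coeff p (i + k)"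
    using poly_factor_X_power[OF p(1)] by blast
  show "poly p f \<notin> P"
  proof
    assume "poly p f \<in> P"
    then have "f ^ k * poly (pCons a r) f \<in> P"
      unfolding ar(1) poly_mult poly_monom mult_1_left .
    moreover have "x \<in> P" if "f ^ k * x \<in> P" for x
      using that f(2) prime_idealD(3)[OF P] by (induction k) (auto simp: mult.assoc)
    ultimately have "poly (pCons a r) f \<in> P'" using sub by blast
    then have 1: "a + f * poly r f \<in> P'" by simp
    have "(a + f * poly r f) - f * poly r f \<in> P'"
      by (rule idl.subspace_diff[OF P' 1 ideal_mult(2)[OF P' f(1)]])
    then have "a \<in> P'" by simp
    moreover have "a \<in> adj us" using ar(3)[of 0] p(2) by (metis coeff_pCons_0)
    ultimately show False using indep_not_in[OF P' us] ar(2) by blast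
  qed
qed

section \<open>Counting monomials: no more independent elements than variables\<close>

primrec mons :: "nat \<Rightarrow> 'a::comm_ring_1 list \<Rightarrow> 'a set" where
  "mons d [] = {1}"
| "mons d (u # us) = (\<lambda>(j, b). u ^ j * b) ` ({..d} \<times> mons d us)"

text \<open>A linear relation, grouped by powers of \<open>u\<close>, is a polynomial over
  \<open>adj us\<close> with value \<open>0\<close> at \<open>u\<close>; it is the zero polynomial,
  and its coefficients are linear relations between the monomials in \<open>us\<close>.\<close>

lemma mons_independent:
  assumes P: "idl.subspace P" and "indep P us"
  shows "finite (mons d us) \<and> mons d us \<subseteq> adj us \<and> kv.independent (mons d us) \<and>
         card (mons d us) = Suc d ^ length us"
  using assms(2)
proof (induction us)
  case Nil
  have "kv.independent {1 :: ('a \<Rightarrow>\<^sub>0 nat) \<Rightarrow>\<^sub>0 'b}" by simp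
  moreover have "1 \<in> range cst" by (metis cst_simps(2) rangeI)
  ultimately show ?case by simp
next
  case (Cons u us)
  then have IH: "finite (mons d us)" "mons d us \<subseteq> adj us" "kv.independent (mons d us)"
    "card (mons d us) = Suc d ^ length us" by auto
  \<comment> \<open>The value \<open>0\<close> lies in \<open>P\<close>, so independence modulo
    \<open>P\<close> excludes nonzero polynomials.\<close>
  have nz: "p = 0" if "\<And>i. coeff p i \<in> adj us" "poly p u = 0" for p
    using that Cons.prems idl.subspace_0[OF P] by fastforce
  note D = subring_setD[OF subring_adj[of us]]
  have inj: "inj_on (\<lambda>(j, b). u ^ j * b) ({..d} \<times> mons d us)"
  proof (rule inj_onI, clarify)
    fix i b j c assume *: "b \<in> mons d us" "c \<in> mons d us" "u ^ i * b = u ^ j * c"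
    have "monom b i - monom c j = 0"
      by (rule nz) (use * IH(2) D in \<open>auto simp: coeff_monom poly_monom mult.commute intro!: D(4)\<close>)
    then have eq: "monom b i = monom c j" by simp
    have "b \<noteq> 0" using * IH(3) kv.dependent_zero by blast
    have "i = j"
    proof (rule ccontr)
      assume "i \<noteq> j"
      then have "coeff (monom c j) i = 0" by (simp add: coeff_monom)
      then show False using \<open>b \<noteq> 0\<close> by (simp flip: eq)
    qed
    then show "i = j \<and> b = c" using eq by simp
  qed
  have "kv.independent (mons d (u # us))"
  proof (rule kv.independent_if_scalars_zero)
    show "finite (mons d (u # us))" using IH(1) by simp
    fix f x assume f: "(\<Sum>x\<in>mons d (u # us). cst (f x) * x) = 0" and x: "x \<in> mons d (u # us)"
    define p where "p = (\<Sum>j\<in>{..d}. monom (\<Sum>b\<in>mons d us. cst (f (u ^ j * b)) * b) j)"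
    have "p = 0"
    proof (rule nz)
      show "coeff p i \<in> adj us" for i
        unfolding p_def coeff_sum coeff_monom
        using D IH(2) cst_in_adj by (auto intro!: subring_sum[OF subring_adj] D(5))
      have "poly p u = (\<Sum>j\<in>{..d}. \<Sum>b\<in>mons d us. cst (f (u ^ j * b)) * (u ^ j * b))"
        unfolding p_def by (simp add: poly_sum poly_monom sum_distrib_left mult_ac)
      also have "\<dots> = (\<Sum>(j, b)\<in>{..d} \<times> mons d us. cst (f (u ^ j * b)) * (u ^ j * b))"
        by (simp add: sum.cartesian_product)
      also have "\<dots> = (\<Sum>x\<in>mons d (u # us). cst (f x) * x)"
        unfolding mons.simps sum.reindex[OF inj] by (simp add: case_prod_unfold)
      finally show "poly p u = 0" using f by simp
    qed
    obtain j b where jb: "j \<le> d" "b \<in> mons d us" "x = u ^ j * b" using x by auto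
    have "coeff p j = (\<Sum>b\<in>mons d us. cst (f (u ^ j * b)) * b)"
      unfolding p_def using jb(1) by (simp add: coeff_sum coeff_monom)
    then have sum0: "(\<Sum>b\<in>mons d us. cst (f (u ^ j * b)) * b) = 0" using \<open>p = 0\<close> by simp
    show "f x = 0"
    proof (rule ccontr)
      assume "f x \<noteq> 0"
      then have "kv.dependent (mons d us)"
        unfolding kv.dependent_finite[OF IH(1)]
        using sum0 jb(2,3) by (intro exI[of _ "\<lambda>b. f (u ^ j * b)"]) auto
      then show False using IH(3) by blast
    qed
  qed
  moreover have "mons d (u # us) \<subseteq> adj (u # us)"
  proof clarsimp
    fix j b assume "b \<in> mons d us"
    then have "poly (monom b j) u \<in> adjoin (adj us) u"
      by (intro adjoinI) (use IH(2) D in \<open>auto simp: coeff_monom\<close>)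
    then show "u ^ j * b \<in> adjoin (adj us) u" by (simp add: poly_monom mult.commute)
  qed
  ultimately show ?case using IH by (simp add: card_image[OF inj] card_cartesian_product)
qed

text \<open>The exponent of each variable is bounded separately, so that exactly
  \<open>(M + 1)^n\<close> monomials in \<open>n\<close> variables are allowed.\<close>

definition exp_bound :: "nat \<Rightarrow> ('x, 'k::field) mpoly \<Rightarrow> bool" where
  "exp_bound M p \<longleftrightarrow> (\<forall>m\<in>Poly_Mapping.keys p. \<forall>v. Poly_Mapping.lookup m v \<le> M)"

lemma exp_bound_mult: "exp_bound M p \<Longrightarrow> exp_bound N q \<Longrightarrow> exp_bound (M + N) (p * q)"
  using keys_mult[of p q] unfolding exp_bound_def by (fastforce simp: lookup_add intro: add_mono)

lemma exp_bound_power: "exp_bound M p \<Longrightarrow> exp_bound (j * M) (p ^ j)"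
proof (induction j)
  case (Suc j) then show ?case using exp_bound_mult[of M p "j * M" "p ^ j"] by simp
qed (simp add: exp_bound_def)

lemma exp_bound_mono: "exp_bound M p \<Longrightarrow> M \<le> N \<Longrightarrow> exp_bound N p"
  unfolding exp_bound_def by (meson order_trans)

lemma exp_bound_ex: "\<exists>M. exp_bound M (p :: ('x::finite, 'k::field) mpoly)"
proof -
  define S where "S = (\<Union>m\<in>Poly_Mapping.keys p. range (Poly_Mapping.lookup m))"
  have "finite S" by (auto simp: S_def)
  then show ?thesis unfolding exp_bound_def
    by (intro exI[of _ "Max (insert 0 S)"]) (auto intro!: Max_ge simp: S_def)
qed

lemma exp_bound_mons:
  assumes "\<And>u. u \<in> set us \<Longrightarrow> exp_bound M u" "x \<in> mons d us"
  shows "exp_bound (length us * (d * M)) x"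
  using assms
proof (induction us arbitrary: x)
  case Nil then show ?case by (simp add: exp_bound_def)
next
  case (Cons u us)
  then obtain j b where jb: "j \<le> d" "b \<in> mons d us" "x = u ^ j * b" by auto
  have "exp_bound (d * M) (u ^ j)"
    using exp_bound_mono[OF exp_bound_power[of M u j], of "d * M"] Cons.prems(1) jb(1) by simp
  from exp_bound_mult[OF this Cons.IH[OF _ jb(2)]] Cons.prems(1) show ?case by (simp add: jb(3))
qed

lemma exp_bound_span:
  fixes M :: nat
  defines "E \<equiv> {m :: 'x::finite \<Rightarrow>\<^sub>0 nat. \<forall>v. Poly_Mapping.lookup m v \<le> M}"
  shows "finite E" "card E \<le> Suc M ^ card (UNIV :: 'x set)"
    "exp_bound M p \<Longrightarrow> p \<in> kv.span ((\<lambda>m. Poly_Mapping.single m 1 :: ('x, 'k::field) mpoly) ` E)"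
proof -
  let ?F = "PiE (UNIV :: 'x set) (\<lambda>_. {..M})"
  have inj: "inj_on Poly_Mapping.lookup E" by (rule inj_onI) (rule poly_mapping_eqI, simp)
  have sub: "Poly_Mapping.lookup ` E \<subseteq> ?F" by (auto simp: E_def)
  have finF: "finite ?F" by (rule finite_PiE) auto
  show "finite E" by (rule inj_on_finite[OF inj sub finF])
  have "card ?F = Suc M ^ card (UNIV :: 'x set)" by (simp add: card_PiE)
  then show "card E \<le> Suc M ^ card (UNIV :: 'x set)" using card_inj_on_le[OF inj sub finF] by simp
  assume "exp_bound M p"
  then have *: "Poly_Mapping.keys p \<subseteq> E" by (auto simp: exp_bound_def E_def)
  show "p \<in> kv.span ((\<lambda>m. Poly_Mapping.single m 1) ` E)"
  proof -
    have "p = (\<Sum>m\<in>Poly_Mapping.keys p. cst (Poly_Mapping.lookup p m) * Poly_Mapping.single m 1)"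
      unfolding single_eq_cst_mult[symmetric] by (rule poly_mapping_sum_single)
    also have "\<dots> \<in> kv.span ((\<lambda>m. Poly_Mapping.single m 1) ` E)"
      by (intro kv.span_sum kv.span_scale kv.span_base) (use * in auto)
    finally show ?thesis .
  qed
qed

text \<open>With exponents up to \<open>C\<close>, the list has \<open>(C + 1)^(length us)\<close>
  linearly independent monomials, while their exponents grow only linearly in \<open>C\<close>, so
  they live in a space of dimension of order \<open>C^n\<close>.\<close>

lemma indep_length_le:
  fixes us :: "('x::finite, 'k::field) mpoly list"
  assumes P: "idl.subspace P" and us: "indep P us"
  shows "length us \<le> card (UNIV :: 'x set)"
proof (rule ccontr)
  assume "\<not> ?thesis"
  then have len: "Suc (card (UNIV :: 'x set)) \<le> length us" by simp
  have "\<exists>M. \<forall>u\<in>set us. exp_bound M u"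
  proof (induction us)
    case (Cons u us)
    then obtain M N where "\<forall>u\<in>set us. exp_bound M u" "exp_bound N u" using exp_bound_ex by blast
    then show ?case by (intro exI[of _ "max M N"]) (auto intro: exp_bound_mono)
  qed auto
  then obtain M where M: "\<And>u. u \<in> set us \<Longrightarrow> exp_bound M u" by blast
  \<comment> \<open>Chosen such that the dimension is at most
    \<open>((length us * M + 1) * (C + 1))^n = C * (C + 1)^n\<close>, which is less than
    \<open>(C + 1)^(n + 1)\<close>.\<close>
  define C where "C = Suc (length us * M) ^ card (UNIV :: 'x set)"
  let ?M = "length us * (C * M)"
  let ?E = "{m :: 'x \<Rightarrow>\<^sub>0 nat. \<forall>v. Poly_Mapping.lookup m v \<le> ?M}"
  let ?B = "(\<lambda>m. Poly_Mapping.single m 1 :: ('x, 'k) mpoly) ` ?E"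
  have "card (mons C us) \<le> card ?B"
  proof (rule kv.independent_span_bound[THEN conjunct2])
    show "finite ?B" by (rule finite_imageI[OF exp_bound_span(1)])
    show "kv.independent (mons C us)" using mons_independent[OF P us] by blast
    show "mons C us \<subseteq> kv.span ?B"
      by (intro subsetI exp_bound_span(3)) (rule exp_bound_mons[OF M])
  qed
  also have "\<dots> \<le> card ?E" by (rule card_image_le[OF exp_bound_span(1)])
  also have "\<dots> \<le> Suc ?M ^ card (UNIV :: 'x set)" by (rule exp_bound_span(2))
  also have "\<dots> \<le> (Suc (length us * M) * Suc C) ^ card (UNIV :: 'x set)" by (rule power_mono) (auto simp: algebra_simps)
  also have "\<dots> = C * Suc C ^ card (UNIV :: 'x set)" unfolding power_mult_distrib C_def[symmetric] by (rule refl)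
  also have "\<dots> < Suc C * Suc C ^ card (UNIV :: 'x set)" by simp
  also have "\<dots> \<le> Suc C ^ length us" using power_increasing[OF len, of "Suc C"] by simp
  finally show False using mons_independent[OF P us, of C] by simp
qed

text \<open>An inequality of the form height plus dimension of the quotient at most
  \<open>n\<close>, where the independent list \<open>us\<close> stands in for the
  dimension.\<close>

lemma prime_chain_length:
  fixes C :: "nat \<Rightarrow> ('x::finite, 'k::field) mpoly set"
  assumes C: "\<And>i. i \<le> k \<Longrightarrow> prime_ideal (C i)" "\<And>i. i < k \<Longrightarrow> C i \<subset> C (Suc i)"
    and us: "indep (C k) us"
  shows "k + length us \<le> card (UNIV :: 'x set)"
proof -
  have "\<exists>vs. length vs = j + length us \<and> indep (C (k - j)) vs" if "j \<le> k" for j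
    using that
  proof (induction j)
    case 0 then show ?case using us by auto
  next
    case (Suc j)
    then obtain vs where vs: "length vs = j + length us" "indep (C (k - j)) vs" by auto
    have "Suc (k - Suc j) = k - j" using Suc.prems by simp
    then have "C (k - Suc j) \<subset> C (k - j)" using C(2)[of "k - Suc j"] Suc.prems by simp
    then obtain f where f: "f \<in> C (k - j)" "f \<notin> C (k - Suc j)" "C (k - Suc j) \<subseteq> C (k - j)" by blast
    have "indep (C (k - Suc j)) (f # vs)"
      by (rule indep_Cons_of_prime[OF C(1) prime_idealD(1)[OF C(1)] f(3,1,2) vs(2)]) simp_all
    then show ?case using vs(1) by (intro exI[of _ "f # vs"]) auto
  qed
  from this[of k] obtain vs where "length vs = k + length us" "indep (C 0) vs" by auto
  then show ?thesis using indep_length_le[OF prime_idealD(1)[OF C(1)[of 0]]] by fastforce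
qed

section \<open>Regular sequences\<close>

text \<open>Weakly regular sequences modulo the ideal of \<open>S\<close>: properness is no part of
  the notion and is obtained from membership of the entries in \<open>irrelevant\<close>.\<close>

primrec reg :: "'a::comm_ring_1 set \<Rightarrow> 'a list \<Rightarrow> bool" where
  "reg S [] \<longleftrightarrow> True"
| "reg S (f # fs) \<longleftrightarrow> nzd (idl.span S) f \<and> reg (insert f S) fs"

lemma reg_append: "reg S (fs @ gs) \<longleftrightarrow> reg S fs \<and> reg (S \<union> set fs) gs"
  by (induction fs arbitrary: S) auto

lemma reg_nth:
  assumes "reg S fs" "j < length fs"
  shows "nzd (idl.span (S \<union> set (take j fs))) (fs ! j)"
proof -
  have "reg S (take j fs @ fs ! j # drop (Suc j) fs)"
    using assms by (simp add: id_take_nth_drop[symmetric])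
  then show ?thesis unfolding reg_append by simp
qed

lemma nzd_power:
  assumes "nzd J f" "r * f ^ n \<in> J"
  shows "r \<in> J"
  using assms(2)
proof (induction n)
  case (Suc n)
  then have "(r * f ^ n) * f \<in> J" by (simp add: ac_simps)
  then show ?case using Suc.IH assms(1) unfolding nzd_def by blast
qed simp

text \<open>The half of the permutability of regular sequences that holds in every ring: from
  \<open>r f = k c\<close> modulo \<open>S\<close> one gets \<open>k = t f\<close>, and
  \<open>f\<close> cancels from \<open>(r - t c) f\<close>.\<close>

lemma nzd_swap:
  assumes f: "nzd (idl.span S) f" and c: "nzd (idl.span (insert f S)) c"
  shows "nzd (idl.span (insert c S)) f"
  unfolding nzd_def
proof (intro allI impI)
  fix r assume "r * f \<in> idl.span (insert c S)"
  then obtain k where k: "r * f - k * c \<in> idl.span S" by (auto simp: idl.span_breakdown_eq)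
  have "- (r * f - k * c) \<in> idl.span S" using k by (rule idl.span_neg)
  then have "k * c - r * f \<in> idl.span S" by simp
  then have "k * c \<in> idl.span (insert f S)" by (auto simp: idl.span_breakdown_eq)
  then have "k \<in> idl.span (insert f S)" using c by (simp add: nzd_def)
  then obtain t where t: "k - t * f \<in> idl.span S" by (auto simp: idl.span_breakdown_eq)
  have "(r * f - k * c) + c * (k - t * f) \<in> idl.span S"
    by (rule idl.span_add[OF k idl.span_scale[OF t]])
  then have "(r - t * c) * f \<in> idl.span S" by (simp add: algebra_simps)
  then have "r - t * c \<in> idl.span S" using f by (simp add: nzd_def)
  then show "r \<in> idl.span (insert c S)" by (auto simp: idl.span_breakdown_eq)
qed

text \<open>A nonzerodivisor modulo every initial segment can be put in front: each entry is swapped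
  past \<open>c\<close> by \<open>nzd_swap\<close>.\<close>

lemma reg_insert:
  assumes "reg S fs" "\<And>j. j \<le> length fs \<Longrightarrow> nzd (idl.span (S \<union> set (take j fs))) c"
  shows "reg (insert c S) fs"
  using assms
proof (induction fs arbitrary: S)
  case (Cons f fs)
  have "nzd (idl.span (insert f S)) c" using Cons.prems(2)[of 1] by simp
  then have "nzd (idl.span (insert c S)) f" using nzd_swap Cons.prems(1) by auto
  moreover have "reg (insert c (insert f S)) fs"
  proof (rule Cons.IH)
    show "reg (insert f S) fs" using Cons.prems(1) by simp
    show "nzd (idl.span (insert f S \<union> set (take j fs))) c" if "j \<le> length fs" for j
      using Cons.prems(2)[of "Suc j"] that by simp
  qed
  ultimately show ?case by (simp add: insert_commute)
qed simp

definition irrelevant :: "('x, 'k::field) mpoly set" where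
  "irrelevant = idl.span (range mvar)"

text \<open>The quotient by \<open>J\<close> has a nonzero socle; equivalently, the homogeneous
  maximal ideal is associated to \<open>J\<close>.\<close>

definition soc :: "('x, 'k::field) mpoly set \<Rightarrow> bool" where
  "soc J \<longleftrightarrow> (\<exists>z. z \<notin> J \<and> (\<forall>v. mvar v * z \<in> J))"

lemma irrelevant_mult:
  assumes J: "idl.subspace J" and "\<forall>v. mvar v * z \<in> J" "f \<in> irrelevant"
  shows "f * z \<in> J"
proof -
  have "irrelevant \<subseteq> col J z"
    unfolding irrelevant_def
    by (rule idl.span_minimal[OF _ subspace_col[OF J]]) (use assms(2) in \<open>auto simp: col_def\<close>)
  then show ?thesis using assms(3) by (auto simp: col_def)
qed

lemma not_soc_of_nzd:
  assumes "idl.subspace J" "nzd J f" "f \<in> irrelevant"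
  shows "\<not> soc J"
proof
  assume "soc J"
  then obtain z where "z \<notin> J" "\<forall>v. mvar v * z \<in> J" by (auto simp: soc_def)
  then show False using irrelevant_mult[OF assms(1) _ assms(3)] assms(2) by (auto simp: nzd_def mult.commute)
qed

text \<open>If \<open>z\<close> is a socle element modulo \<open>a\<close>, then
  \<open>b z = w a\<close> modulo \<open>S\<close> for some \<open>w\<close>, and \<open>w\<close>
  is a socle element modulo \<open>b\<close>: both claims about \<open>w\<close> follow by
  cancelling \<open>a\<close> or \<open>b\<close>.\<close>

lemma soc_exchange:
  assumes a: "nzd (idl.span S) a" and b: "nzd (idl.span S) b" and "b \<in> irrelevant"
    and soc: "soc (idl.span (insert a S))"
  shows "soc (idl.span (insert b S))"
proof -
  obtain z where z: "z \<notin> idl.span (insert a S)" "\<forall>v. mvar v * z \<in> idl.span (insert a S)"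
    using soc by (auto simp: soc_def)
  have "b * z \<in> idl.span (insert a S)"
    by (rule irrelevant_mult[OF idl.subspace_span z(2) assms(3)])
  then obtain w where w: "b * z - w * a \<in> idl.span S" by (auto simp: idl.span_breakdown_eq)
  have "w \<notin> idl.span (insert b S)"
  proof
    assume "w \<in> idl.span (insert b S)"
    then obtain t where t: "w - t * b \<in> idl.span S" by (auto simp: idl.span_breakdown_eq)
    have "(b * z - w * a) + a * (w - t * b) \<in> idl.span S"
      by (rule idl.span_add[OF w idl.span_scale[OF t]])
    then have "(z - t * a) * b \<in> idl.span S" by (simp add: algebra_simps)
    then have "z - t * a \<in> idl.span S" using b by (simp add: nzd_def)
    then show False using z(1) by (auto simp: idl.span_breakdown_eq)
  qed
  moreover have "mvar v * w \<in> idl.span (insert b S)" for v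
  proof -
    obtain t where t: "mvar v * z - t * a \<in> idl.span S" using z(2) by (auto simp: idl.span_breakdown_eq)
    have "b * (mvar v * z - t * a) - mvar v * (b * z - w * a) \<in> idl.span S"
      by (rule idl.span_diff[OF idl.span_scale[OF t] idl.span_scale[OF w]])
    then have "(mvar v * w - t * b) * a \<in> idl.span S" by (simp add: algebra_simps)
    then have "mvar v * w - t * b \<in> idl.span S" using a by (simp add: nzd_def)
    then show ?thesis by (auto simp: idl.span_breakdown_eq)
  qed
  ultimately show ?thesis by (auto simp: soc_def)
qed

section \<open>General linear combinations\<close>

text \<open>Linear algebra in place of prime avoidance, because contracted ideals are among those to
  be avoided: a vector space over an infinite field is no finite union of proper subspaces.\<close>

lemma avoid_ideals:
  fixes \<P> :: "('x, 'k::field) mpoly set set"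
  assumes K: "infinite (UNIV :: 'k set)" and "finite \<P>" "\<And>P. P \<in> \<P> \<Longrightarrow> idl.subspace P \<and> \<not> B \<subseteq> P"
  shows "\<exists>f\<in>kv.span B. \<forall>P\<in>\<P>. f \<notin> P"
  using assms(2,3)
proof (induction \<P> rule: finite_induct)
  case empty
  show ?case using kv.span_zero by blast
next
  case (insert P \<P>)
  then obtain f where f: "f \<in> kv.span B" "\<forall>P\<in>\<P>. f \<notin> P" by auto
  show ?case
  proof (cases "f \<in> P")
    case False
    then show ?thesis using f by auto
  next
    case True
    obtain g where g: "g \<in> B" "g \<notin> P" using insert.prems by blast
    have P: "idl.subspace P" using insert.prems by blast
    \<comment> \<open>Two parameters \<open>s\<close> and \<open>t\<close> would put
      \<open>(s - t) f\<close>, hence \<open>f\<close>, into \<open>Q\<close>; so each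
      \<open>Q\<close> excludes at most one parameter.\<close>
    have "finite {t. g + cst t * f \<in> Q}" if Q: "Q \<in> \<P>" for Q
    proof -
      have sQ: "idl.subspace Q" using insert.prems Q by blast
      have "s = t" if st: "g + cst s * f \<in> Q" "g + cst t * f \<in> Q" for s t
      proof (rule ccontr)
        assume "s \<noteq> t"
        have "(g + cst s * f) - (g + cst t * f) \<in> Q" using idl.subspace_diff[OF sQ st] .
        then have "cst (s - t) * f \<in> Q" by (simp add: cst_diff algebra_simps)
        then have "cst (inverse (s - t)) * (cst (s - t) * f) \<in> Q" by (rule ideal_mult(1)[OF sQ])
        moreover have "cst (inverse (s - t)) * cst (s - t) = (1 :: ('x, 'k) mpoly)"
          using \<open>s \<noteq> t\<close> by (intro cst_inverse) simp
        ultimately have "f \<in> Q" by (metis mult.assoc mult_1_left)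
        then show False using f(2) Q by blast
      qed
      then have "{t. g + cst t * f \<in> Q} = {} \<or> (\<exists>a. {t. g + cst t * f \<in> Q} = {a})" by blast
      then show ?thesis by (metis finite.emptyI finite.insertI)
    qed
    then have "finite (\<Union>Q\<in>\<P>. {t. g + cst t * f \<in> Q})" using insert.hyps(1) by blast
    then obtain t where t: "t \<notin> (\<Union>Q\<in>\<P>. {t. g + cst t * f \<in> Q})" using K ex_new_if_finite by blast
    have "g + cst t * f \<notin> P"
    proof
      assume "g + cst t * f \<in> P"
      from idl.subspace_diff[OF P this ideal_mult(1)[OF P True, of "cst t"]] show False using g(2) by simp
    qed
    moreover have "g + cst t * f \<in> kv.span B" 
      by (rule kv.span_add[OF kv.span_base[OF g(1)] kv.span_scale[OF f(1)]])
    ultimately show ?thesis using t by auto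
  qed
qed

lemma kv_span_subset_idl_span: "kv.span B \<subseteq> idl.span B"
proof
  fix x assume "x \<in> kv.span B"
  then show "x \<in> idl.span B"
    by (induction rule: kv.span_induct_alt) (auto intro: idl.span_zero idl.span_add idl.span_scale idl.span_base)
qed

text \<open>Without a socle, no associated prime contains all variables, so a general linear form
  avoids the finitely many primes that contain the zero divisors.\<close>

lemma exists_linear_nzd:
  fixes \<J> :: "('x::finite, 'k::field) mpoly set set"
  assumes K: "infinite (UNIV :: 'k set)" and "finite \<J>" "\<And>J. J \<in> \<J> \<Longrightarrow> idl.subspace J \<and> \<not> soc J"
  shows "\<exists>c\<in>kv.span (range mvar). \<forall>J\<in>\<J>. nzd J c"
proof -
  have "\<forall>J\<in>\<J>. \<exists>\<P>. finite \<P> \<and> (\<forall>P\<in>\<P>. prime_ideal P \<and> (\<exists>z. z \<notin> J \<and> P = col J z)) \<and>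
           (\<forall>r. nzd J r \<or> (\<exists>P\<in>\<P>. r \<in> P))"
    using zero_divisors_finite_primes[OF noetherian_polynomials] assms(3) by blast
  then obtain A where A: "\<And>J. J \<in> \<J> \<Longrightarrow> finite (A J)"
    "\<And>J P. J \<in> \<J> \<Longrightarrow> P \<in> A J \<Longrightarrow> prime_ideal P \<and> (\<exists>z. z \<notin> J \<and> P = col J z)"
    "\<And>J r. J \<in> \<J> \<Longrightarrow> nzd J r \<or> (\<exists>P\<in>A J. r \<in> P)" by metis
  have "idl.subspace P \<and> \<not> range mvar \<subseteq> P" if P: "P \<in> \<Union> (A ` \<J>)" for P
  proof -
    obtain J where J: "J \<in> \<J>" "P \<in> A J" using P by blast
    obtain z where z: "z \<notin> J" "P = col J z" "prime_ideal P" using A(2)[OF J] by blast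
    have "\<not> range mvar \<subseteq> P" using assms(3)[OF J(1)] z(1,2) by (auto simp: soc_def col_def)
    then show ?thesis using z(3) by (simp add: prime_ideal_def)
  qed
  moreover have "finite (\<Union> (A ` \<J>))" using assms(2) A(1) by blast
  ultimately obtain c where "c \<in> kv.span (range mvar)" "\<forall>P\<in>\<Union> (A ` \<J>). c \<notin> P"
    using avoid_ideals[OF K] by metis
  then show ?thesis using A(3) by (intro bexI[of _ c]) blast+
qed

lemma linear_irrelevant: "c \<in> kv.span (range mvar) \<Longrightarrow> c \<in> irrelevant"
  using kv_span_subset_idl_span unfolding irrelevant_def by blast

text \<open>Induction on the common length. A linear form \<open>c\<close> replaces the last entry
  of either sequence by \<open>soc_exchange\<close> and moves to the front by
  \<open>reg_insert\<close>; over the base \<open>insert c S\<close> the shortened sequences are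
  compared by the induction hypothesis.\<close>

lemma soc_independent:
  fixes S :: "('x::finite, 'k::field) mpoly set"
  assumes K: "infinite (UNIV :: 'k set)" and "length fs = length gs" "reg S fs" "reg S gs"
    and "set fs \<subseteq> irrelevant" "set gs \<subseteq> irrelevant" "soc (idl.span (S \<union> set fs))"
  shows "soc (idl.span (S \<union> set gs))"
  using assms(2-)
proof (induction "length fs" arbitrary: S fs gs)
  case 0 then show ?case by simp
next
  case (Suc n)
  obtain fs' f where f: "fs = fs' @ [f]" using Suc.hyps(2) by (metis length_0_conv nat.distinct(1) rev_exhaust)
  obtain gs' g where g: "gs = gs' @ [g]" using Suc.hyps(2) Suc.prems(1) by (metis length_0_conv nat.distinct(1) rev_exhaust)
  \<comment> \<open>Proper initial segments of both sequences: the next entry is a nonzerodivisor in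
    the irrelevant ideal, so none of them has a socle and one linear form serves them all.\<close>
  define \<J> where "\<J> = (\<lambda>j. idl.span (S \<union> set (take j fs'))) ` {..length fs'} \<union>
    (\<lambda>j. idl.span (S \<union> set (take j gs'))) ` {..length gs'}"
  have nosoc: "\<not> soc (idl.span (S \<union> set (take j hs')))" if "j \<le> length hs'" "reg S (hs' @ [h])" "set (hs' @ [h]) \<subseteq> irrelevant"
    for j hs' and h :: "('x, 'k) mpoly"
  proof (rule not_soc_of_nzd[OF idl.subspace_span])
    show "nzd (idl.span (S \<union> set (take j hs'))) ((hs' @ [h]) ! j)"
      using reg_nth[OF that(2), of j] that(1) by simp
    have "j < length (hs' @ [h])" using that(1) by simp
    from nth_mem[OF this] show "(hs' @ [h]) ! j \<in> irrelevant" using that(3) by blast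
  qed
  have "idl.subspace J \<and> \<not> soc J" if "J \<in> \<J>" for J
    using that nosoc[of _ fs' f] nosoc[of _ gs' g] Suc.prems f g by (auto simp: \<J>_def)
  then obtain c where c: "c \<in> kv.span (range mvar)" "\<forall>J\<in>\<J>. nzd J c"
    using exists_linear_nzd[OF K, of \<J>] unfolding \<J>_def by blast
  have cm: "c \<in> irrelevant" by (rule linear_irrelevant[OF c(1)])
  have cf: "nzd (idl.span (S \<union> set (take j fs'))) c" if "j \<le> length fs'" for j
    using c(2) that by (auto simp: \<J>_def)
  have cg: "nzd (idl.span (S \<union> set (take j gs'))) c" if "j \<le> length gs'" for j
    using c(2) that by (auto simp: \<J>_def)
  have fs': "reg S fs'" "nzd (idl.span (S \<union> set fs')) f" and gs': "reg S gs'" "nzd (idl.span (S \<union> set gs')) g"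
    using Suc.prems f g by (auto simp: reg_append)
  have "soc (idl.span (insert f (S \<union> set fs')))" using Suc.prems(6) f by simp
  from soc_exchange[OF fs'(2) cf[of "length fs'", simplified] cm this]
  have "soc (idl.span (insert c S \<union> set fs'))" by simp
  then have "soc (idl.span (insert c S \<union> set gs'))"
    using Suc.hyps(1)[of fs' gs' "insert c S"] reg_insert[OF fs'(1) cf] reg_insert[OF gs'(1) cg] Suc.hyps(2) Suc.prems f g
    by auto
  then have "soc (idl.span (insert c (S \<union> set gs')))" by simp
  from soc_exchange[OF cg[of "length gs'", simplified] gs'(2) _ this]
  show ?case using Suc.prems(5) g by simp
qed

section \<open>The sequence of variables\<close>

lemma lookup_mvar_mult: "Poly_Mapping.lookup (mvar w * r) (Poly_Mapping.single w 1 + m) = Poly_Mapping.lookup r m"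
proof -
  have "mvar w * r = mvar w * (\<Sum>m\<in>Poly_Mapping.keys r. Poly_Mapping.single m (Poly_Mapping.lookup r m))"
    using poly_mapping_sum_single[of r] by simp
  also have "\<dots> = (\<Sum>m\<in>Poly_Mapping.keys r. Poly_Mapping.single (Poly_Mapping.single w 1 + m) (Poly_Mapping.lookup r m))"
    by (simp add: sum_distrib_left mvar_def mult_single)
  finally show ?thesis
    by (simp add: lookup_sum lookup_single when_def in_keys_iff sum.delta)
qed

text \<open>Membership in a monomial ideal is decided monomial by monomial; this makes the variables
  a regular sequence.\<close>

lemma mem_span_vars:
  fixes p :: "('x, 'k::field) mpoly"
  shows "p \<in> idl.span (mvar ` V) \<longleftrightarrow> (\<forall>m\<in>Poly_Mapping.keys p. \<exists>v\<in>V. Poly_Mapping.lookup m v \<noteq> 0)"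
proof
  let ?T = "{p :: ('x, 'k) mpoly. \<forall>m\<in>Poly_Mapping.keys p. \<exists>v\<in>V. Poly_Mapping.lookup m v \<noteq> 0}"
  have "idl.subspace ?T"
  proof (rule idl.subspaceI)
    show "x + y \<in> ?T" if "x \<in> ?T" "y \<in> ?T" for x y using that keys_add[of x y] by blast
    show "c * x \<in> ?T" if x: "x \<in> ?T" for c x
    proof (rule CollectI, rule ballI)
      fix m assume "m \<in> Poly_Mapping.keys (c * x)"
      then obtain a b where "m = a + b" "b \<in> Poly_Mapping.keys x" using keys_mult[of c x] by blast
      moreover from this obtain v where "v \<in> V" "Poly_Mapping.lookup b v \<noteq> 0" using x by blast
      ultimately show "\<exists>v\<in>V. Poly_Mapping.lookup m v \<noteq> 0" by (intro bexI[of _ v]) (simp_all add: lookup_add)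
    qed
  qed simp
  moreover have "mvar v \<in> ?T" if "v \<in> V" for v
    using that by (auto simp: mvar_def intro!: bexI[of _ v])
  ultimately have "idl.span (mvar ` V) \<subseteq> ?T" using idl.span_minimal[of "mvar ` V" ?T] by blast
  then show "p \<in> idl.span (mvar ` V) \<Longrightarrow> \<forall>m\<in>Poly_Mapping.keys p. \<exists>v\<in>V. Poly_Mapping.lookup m v \<noteq> 0" by blast
next
  assume *: "\<forall>m\<in>Poly_Mapping.keys p. \<exists>v\<in>V. Poly_Mapping.lookup m v \<noteq> 0"
  have "Poly_Mapping.single m c \<in> idl.span (mvar ` V)" if m: "m \<in> Poly_Mapping.keys p" for m and c :: 'k
  proof -
    obtain v where v: "v \<in> V" "Poly_Mapping.lookup m v \<noteq> 0" using * m by blast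
    define m' where "m' = m - Poly_Mapping.single v 1"
    have "m = m' + Poly_Mapping.single v 1"
      using v by (intro poly_mapping_eqI) (auto simp: m'_def lookup_add lookup_minus lookup_single when_def)
    then have "Poly_Mapping.single m c = Poly_Mapping.single m' c * mvar v" by (simp add: mvar_def mult_single)
    then show ?thesis using v(1) by (simp add: idl.span_scale idl.span_base)
  qed
  then have "(\<Sum>m\<in>Poly_Mapping.keys p. Poly_Mapping.single m (Poly_Mapping.lookup p m)) \<in> idl.span (mvar ` V)"
    by (intro idl.span_sum) blast
  then show "p \<in> idl.span (mvar ` V)" using poly_mapping_sum_single[of p] by simp
qed

lemma nzd_mvar: "w \<notin> V \<Longrightarrow> nzd (idl.span (mvar ` V)) (mvar w :: ('x, 'k::field) mpoly)"
  unfolding nzd_def mem_span_vars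
proof (intro allI impI ballI)
  fix r :: "('x, 'k) mpoly" and m
  assume w: "w \<notin> V" and *: "\<forall>m\<in>Poly_Mapping.keys (r * mvar w). \<exists>v\<in>V. Poly_Mapping.lookup m v \<noteq> 0" "m \<in> Poly_Mapping.keys r"
  have "Poly_Mapping.lookup (r * mvar w) (Poly_Mapping.single w 1 + m) = Poly_Mapping.lookup r m"
    by (subst mult.commute) (rule lookup_mvar_mult)
  then have "Poly_Mapping.single w 1 + m \<in> Poly_Mapping.keys (r * mvar w)"
    using *(2) by (simp add: in_keys_iff)
  then obtain v where "v \<in> V" "Poly_Mapping.lookup (Poly_Mapping.single w 1 + m) v \<noteq> 0" using *(1) by blast
  then show "\<exists>v\<in>V. Poly_Mapping.lookup m v \<noteq> 0" using w
    by (intro bexI[of _ v]) (auto simp: lookup_add lookup_single when_def split: if_splits)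
qed

lemma mvar_irrelevant: "mvar w \<in> irrelevant"
  unfolding irrelevant_def by (rule idl.span_base) simp

lemma reg_mvars: "distinct vs \<Longrightarrow> set vs \<inter> V = {} \<Longrightarrow> reg (mvar ` V) (map mvar vs :: ('x, 'k::field) mpoly list)"
proof (induction vs arbitrary: V)
  case (Cons v vs)
  have "reg (mvar ` insert v V) (map mvar vs :: ('x, 'k) mpoly list)" by (rule Cons.IH) (use Cons.prems in auto)
  then show ?case using nzd_mvar[of v V] Cons.prems by simp
qed simp

text \<open>Comparison with equally many variables: modulo these, a remaining variable is a
  nonzerodivisor, so there is no socle.\<close>

lemma not_soc_of_short_reg:
  fixes fs :: "('x::finite, 'k::field) mpoly list"
  assumes K: "infinite (UNIV :: 'k set)" and "reg {} fs" "set fs \<subseteq> irrelevant"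
    and len: "length fs < card (UNIV :: 'x set)"
  shows "\<not> soc (idl.span (set fs))"
proof
  assume soc: "soc (idl.span (set fs))"
  obtain xs :: "'x list" where xs: "set xs = UNIV" "distinct xs"
    using finite_distinct_list[OF finite_UNIV] by blast
  then have "length xs = card (UNIV :: 'x set)" by (metis distinct_card)
  define vs where "vs = take (length fs) xs"
  have vs: "length vs = length fs" "distinct vs" "set vs \<noteq> UNIV"
    using xs len \<open>length xs = _\<close> distinct_card[of vs] by (auto simp: vs_def)
  have r: "reg {} (map mvar vs :: ('x, 'k) mpoly list)" using reg_mvars[of vs "{}"] vs(2) by simp
  have "soc (idl.span ({} \<union> set (map mvar vs :: ('x, 'k) mpoly list)))"
    by (rule soc_independent[OF K _ assms(2) r assms(3)]) (use vs(1) mvar_irrelevant soc in auto)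
  then have *: "soc (idl.span (mvar ` set vs) :: ('x, 'k) mpoly set)" by simp
  obtain w where w: "w \<notin> set vs" using vs(3) by blast
  show False by (rule notE[OF not_soc_of_nzd[OF idl.subspace_span nzd_mvar[OF w] mvar_irrelevant] *])
qed

lemma extend_reg:
  fixes fs :: "('x::finite, 'k::field) mpoly list"
  assumes K: "infinite (UNIV :: 'k set)" and "reg {} fs" "set fs \<subseteq> irrelevant"
    and "length fs + n = card (UNIV :: 'x set)"
  shows "\<exists>cs. length cs = n \<and> reg (set fs) cs \<and> set cs \<subseteq> kv.span (range mvar)"
  using assms(2-)
proof (induction n arbitrary: fs)
  case (Suc n)
  have "\<not> soc (idl.span (set fs))" by (rule not_soc_of_short_reg[OF K]) (use Suc.prems in auto)
  then obtain c where c: "c \<in> kv.span (range mvar)" "nzd (idl.span (set fs)) c"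
    using exists_linear_nzd[OF K, of "{idl.span (set fs)}"] by auto
  have "\<exists>cs. length cs = n \<and> reg (set (fs @ [c])) cs \<and> set cs \<subseteq> kv.span (range mvar)"
    by (rule Suc.IH) (use Suc.prems c linear_irrelevant in \<open>auto simp: reg_append\<close>)
  then obtain cs where "length cs = n" "reg (insert c (set fs)) cs" "set cs \<subseteq> kv.span (range mvar)" by auto
  then show ?case using c by (intro exI[of _ "c # cs"]) auto
qed simp

section \<open>Homogeneous ideals\<close>

definition mdeg :: "('x \<Rightarrow>\<^sub>0 nat) \<Rightarrow> nat" where
  "mdeg m = (\<Sum>v\<in>Poly_Mapping.keys m. Poly_Mapping.lookup m v)"

definition homog :: "nat \<Rightarrow> ('x, 'k::comm_ring_1) mpoly \<Rightarrow> bool" where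
  "homog d p \<longleftrightarrow> (\<forall>m\<in>Poly_Mapping.keys p. mdeg m = d)"

definition hcomp :: "nat \<Rightarrow> ('x, 'k::comm_ring_1) mpoly \<Rightarrow> ('x, 'k) mpoly" where
  "hcomp d p = Poly_Mapping.mapp (\<lambda>m c. c when mdeg m = d) p"

lemma mdeg_add: "mdeg (m + n) = mdeg m + mdeg n"
proof -
  let ?A = "Poly_Mapping.keys m \<union> Poly_Mapping.keys n"
  have *: "mdeg a = (\<Sum>v\<in>?A. Poly_Mapping.lookup a v)" if "Poly_Mapping.keys a \<subseteq> ?A" for a
    unfolding mdeg_def by (rule sum.mono_neutral_left) (use that in \<open>auto simp: in_keys_iff\<close>)
  show ?thesis using *[of m] *[of n] *[of "m + n"] keys_add[of m n]
    by (simp add: lookup_add sum.distrib)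
qed

lemma lookup_hcomp: "Poly_Mapping.lookup (hcomp d p) m = (if mdeg m = d then Poly_Mapping.lookup p m else 0)"
  by (auto simp: hcomp_def lookup_mapp when_def in_keys_iff)

lemma hcomp_add: "hcomp d (p + q) = hcomp d p + hcomp d q"
  and hcomp_zero [simp]: "hcomp d 0 = 0"
  and hcomp_diff: "hcomp d (p - q) = hcomp d p - hcomp d q"
  by (rule poly_mapping_eqI; simp add: lookup_hcomp lookup_add lookup_minus)+

lemma hcomp_sum: "hcomp d (sum f A) = (\<Sum>a\<in>A. hcomp d (f a))"
  by (induction A rule: infinite_finite_induct) (simp_all add: hcomp_add)

lemma homog_hcomp: "homog d (hcomp d p)"
  by (auto simp: homog_def in_keys_iff lookup_hcomp split: if_splits)

lemma hcomp_hom: "homog e p \<Longrightarrow> hcomp d p = (if d = e then p else 0)"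
  by (rule poly_mapping_eqI) (auto simp: homog_def lookup_hcomp in_keys_iff)

lemma sum_hcomp:
  assumes "finite D" "mdeg ` Poly_Mapping.keys p \<subseteq> D"
  shows "(\<Sum>d\<in>D. hcomp d p) = p"
proof (rule poly_mapping_eqI)
  fix m
  have "(\<Sum>d\<in>D. Poly_Mapping.lookup (hcomp d p) m) = (\<Sum>d\<in>D. if d = mdeg m then Poly_Mapping.lookup p m else 0)"
    by (rule sum.cong) (auto simp: lookup_hcomp)
  also have "\<dots> = Poly_Mapping.lookup p m"
    using assms by (auto simp: sum.delta in_keys_iff image_subset_iff)
  finally show "Poly_Mapping.lookup (\<Sum>d\<in>D. hcomp d p) m = Poly_Mapping.lookup p m" by (simp add: lookup_sum)
qed

lemma homog_mult: "homog d p \<Longrightarrow> homog e q \<Longrightarrow> homog (d + e) (p * q)"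
  unfolding homog_def using keys_mult[of p q] by (auto simp: mdeg_add)

lemma homog_power: "homog e p \<Longrightarrow> homog (n * e) (p ^ n)"
proof (induction n)
  case 0 then show ?case by (simp add: homog_def mdeg_def)
next
  case (Suc n) then show ?case using homog_mult[of e p "n * e" "p ^ n"] by simp
qed

lemma hcomp_mult_hom:
  assumes "homog e f"
  shows "hcomp d (r * f) = (if e \<le> d then hcomp (d - e) r * f else 0)"
proof -
  let ?D = "insert (d - e) (mdeg ` Poly_Mapping.keys r)"
  have "r * f = (\<Sum>i\<in>?D. hcomp i r) * f" by (subst sum_hcomp) auto
  then have "hcomp d (r * f) = (\<Sum>i\<in>?D. hcomp d (hcomp i r * f))"
    by (simp only: sum_distrib_right hcomp_sum)
  also have "\<dots> = (\<Sum>i\<in>?D. if d = i + e then hcomp i r * f else 0)"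
    by (rule sum.cong[OF refl]) (rule hcomp_hom[OF homog_mult[OF homog_hcomp assms]])
  also have "\<dots> = (\<Sum>i\<in>?D. if i = d - e then (if e \<le> d then hcomp (d - e) r * f else 0) else 0)"
    by (rule sum.cong[OF refl]) auto
  also have "\<dots> = (if e \<le> d then hcomp (d - e) r * f else 0)"
    by (subst sum.delta) auto
  finally show ?thesis .
qed

lemma hcomp_span:
  assumes "\<And>s. s \<in> S \<Longrightarrow> \<exists>e. homog e s" "p \<in> idl.span S"
  shows "hcomp d p \<in> idl.span S"
  using assms(2)
proof (induction rule: idl.span_induct_alt)
  case base then show ?case by (simp add: idl.span_zero)
next
  case (step c x y)
  obtain e where "homog e x" using assms(1) step(1) by blast
  then have "hcomp d (c * x) \<in> idl.span S"
    using step(1) by (auto simp: hcomp_mult_hom intro: idl.span_zero idl.span_scale idl.span_base)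
  then show ?case using step(2) by (simp add: hcomp_add idl.span_add)
qed

text \<open>A graded form of Krull's intersection theorem: an element divisible by all powers of
  \<open>t\<close> modulo a homogeneous ideal lies in the ideal, component by component.\<close>

lemma homog_separated:
  assumes S: "\<And>s. s \<in> S \<Longrightarrow> \<exists>e. homog e s" and t: "homog e t" "e > 0"
    and z: "\<And>n. \<exists>y. z - t ^ n * y \<in> idl.span S"
  shows "z \<in> idl.span S"
proof -
  have "hcomp d z \<in> idl.span S" for d
  proof -
    \<comment> \<open>The power \<open>d + 1\<close> has degree \<open>(d + 1) * e > d\<close>, so
      it does not reach the component of degree \<open>d\<close>.\<close>
    obtain y where y: "z - t ^ Suc d * y \<in> idl.span S" using z by blast
    have "\<not> Suc d * e \<le> d" using t(2) by (cases e) auto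
    then have "hcomp d (y * t ^ Suc d) = 0" using hcomp_mult_hom[OF homog_power[OF t(1), of "Suc d"], of d y] by simp
    moreover have "hcomp d (z - t ^ Suc d * y) \<in> idl.span S" by (rule hcomp_span[OF S y])
    ultimately show ?thesis by (simp add: hcomp_diff mult.commute)
  qed
  then have "(\<Sum>d\<in>mdeg ` Poly_Mapping.keys z. hcomp d z) \<in> idl.span S" by (intro idl.span_sum) blast
  then show ?thesis by (subst (asm) sum_hcomp) auto
qed

lemma homog_linear: "c \<in> kv.span (range mvar) \<Longrightarrow> homog 1 c"
proof (induction rule: kv.span_induct_alt)
  case base show ?case by (simp add: homog_def)
next
  case (step c x y)
  then have "homog 1 x" by (auto simp: homog_def mvar_def mdeg_def)
  then have "homog (0 + 1) (cst c * x)" by (intro homog_mult) (auto simp: homog_def cst_def mdeg_def)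
  then show ?case using step(2) keys_add[of "cst c * x" y] by (auto simp: homog_def)
qed

text \<open>Lowest terms in \<open>u\<close>: a relation annihilating \<open>z\<close> yields, modulo \<open>u\<close>, a relation
  with fewer elements annihilating some \<open>y\<close>, where \<open>z\<close> is a multiple of \<open>y\<close> by a power of \<open>u\<close>.\<close>

lemma indep_reg:
  assumes "reg S us" "\<And>s. s \<in> S \<Longrightarrow> \<exists>e. homog e s" "\<And>u. u \<in> set us \<Longrightarrow> homog 1 u" "z \<notin> idl.span S"
  shows "indep (col (idl.span S) z) us"
  using assms
proof (induction us arbitrary: S z)
  case Nil then show ?case by (simp add: col_def)
next
  case (Cons u us)
  let ?J = "idl.span S" and ?J' = "idl.span (insert u S)"
  have u: "nzd ?J u" "homog 1 u" using Cons.prems by auto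
  have S': "\<exists>e. homog e s" if "s \<in> insert u S" for s using that Cons.prems(2) u(2) by blast
  have JJ': "?J \<subseteq> ?J'" by (rule idl.span_mono) auto
  \<comment> \<open>The largest power of \<open>u\<close> dividing \<open>z\<close> modulo
    \<open>?J\<close> is split off; it exists because otherwise \<open>homog_separated\<close> would
    put \<open>z\<close> into \<open>?J\<close>.\<close>
  have "\<exists>n y. z - u ^ n * y \<in> ?J \<and> y \<notin> ?J'"
  proof (rule ccontr)
    assume no: "\<not> ?thesis"
    have "\<exists>y. z - u ^ n * y \<in> ?J" for n
    proof (induction n)
      case 0
      have "z - u ^ 0 * z \<in> ?J" by (simp add: idl.span_zero)
      then show ?case by blast
    next
      case (Suc n)
      then obtain y where y: "z - u ^ n * y \<in> ?J" by blast
      then have "y \<in> ?J'" using no by blast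
      then obtain k where k: "y - k * u \<in> ?J" by (auto simp: idl.span_breakdown_eq)
      have "(z - u ^ n * y) + u ^ n * (y - k * u) \<in> ?J" by (rule idl.span_add[OF y idl.span_scale[OF k]])
      then have "z - u ^ Suc n * k \<in> ?J" by (simp add: algebra_simps)
      then show ?case by blast
    qed
    then have "z \<in> ?J" using homog_separated[OF Cons.prems(2) u(2)] by simp
    then show False using Cons.prems(4) by blast
  qed
  then obtain n y where y: "z - u ^ n * y \<in> ?J" "y \<notin> ?J'" by blast
  have "col ?J z \<subseteq> col ?J y"
  proof
    fix r assume "r \<in> col ?J z"
    then have "r * z \<in> ?J" by (simp add: col_def)
    from idl.span_diff[OF this idl.span_scale[OF y(1)]] have "r * z - r * (z - u ^ n * y) \<in> ?J" .
    then have "(r * y) * u ^ n \<in> ?J" by (simp add: algebra_simps)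
    then show "r \<in> col ?J y" using nzd_power[OF u(1)] by (simp add: col_def)
  qed
  moreover have "indep (col ?J y) (u # us)"
    unfolding indep.simps
  proof (intro conjI allI impI)
    have IH: "indep (col ?J' y) us"
      by (rule Cons.IH) (use Cons.prems S' y in auto)
    show "indep (col ?J y) us" by (rule indep_antimono[OF _ IH]) (use JJ' in \<open>auto simp: col_def\<close>)
    fix p :: "(('a \<Rightarrow>\<^sub>0 nat) \<Rightarrow>\<^sub>0 'b) poly" assume p: "p \<noteq> 0" "\<forall>i. coeff p i \<in> adj us"
    obtain k a r where ar: "p = monom 1 k * pCons a r" "a \<noteq> 0" "\<And>i. coeff (pCons a r) i = coeff p (i + k)"
      using poly_factor_X_power[OF p(1)] by blast
    have a: "a \<in> adj us" using ar(3)[of 0] p(2) by (metis coeff_pCons_0)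
    show "poly p u \<notin> col ?J y"
    proof
      assume "poly p u \<in> col ?J y"
      then have "(u ^ k * poly (pCons a r) u) * y \<in> ?J"
        unfolding ar(1) poly_mult poly_monom mult_1_left by (simp add: col_def)
      then have "(poly (pCons a r) u * y) * u ^ k \<in> ?J" by (simp only: ac_simps)
      then have "poly (pCons a r) u * y \<in> ?J" by (rule nzd_power[OF u(1)])
      then have "a * y - (- (poly r u * y)) * u \<in> ?J" by (simp add: algebra_simps)
      then have "a * y \<in> ?J'" unfolding idl.span_breakdown_eq by blast
      then have "a \<in> col ?J' y" by (simp add: col_def)
      then show False using indep_not_in[OF subspace_col[OF idl.subspace_span] IH a ar(2)] by blast
    qed
  qed
  ultimately show ?case by (rule indep_antimono)
qed

section \<open>Bounds on chains of primes\<close>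

lemma associated_prime_chain:
  fixes C :: "nat \<Rightarrow> ('x::finite, 'k::field) mpoly set"
  assumes K: "infinite (UNIV :: 'k set)" and fs: "reg {} fs" "set fs \<subseteq> irrelevant"
    and homog: "\<And>f. f \<in> set fs \<Longrightarrow> \<exists>e. homog e f" and len: "length fs \<le> card (UNIV :: 'x set)"
    and z: "z \<notin> idl.span (set fs)" "C k = col (idl.span (set fs)) z"
    and C: "\<And>i. i \<le> k \<Longrightarrow> prime_ideal (C i)" "\<And>i. i < k \<Longrightarrow> C i \<subset> C (Suc i)"
  shows "k \<le> length fs"
proof -
  obtain cs where cs: "length cs = card (UNIV :: 'x set) - length fs" "reg (set fs) cs" "set cs \<subseteq> kv.span (range mvar)"
    using extend_reg[OF K fs, of "card (UNIV :: 'x set) - length fs"] len by auto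
  have "indep (C k) cs" unfolding z(2)
    by (rule indep_reg[OF cs(2) homog _ z(1)]) (use cs(3) homog_linear in blast)+
  then show ?thesis using prime_chain_length[where C = C and k = k and us = cs, OF C] cs(1) len by simp
qed

lemma irrelevant_prime_chain:
  fixes C :: "nat \<Rightarrow> ('x::finite, 'k::field) mpoly set"
  assumes "C k = irrelevant" "\<And>i. i \<le> k \<Longrightarrow> prime_ideal (C i)" "\<And>i. i < k \<Longrightarrow> C i \<subset> C (Suc i)"
  shows "k \<le> card (UNIV :: 'x set)"
  using prime_chain_length[where C = C and k = k and us = "[]", OF assms(2,3)] prime_idealD(2)[OF assms(2)[of k]] by simp

lemma mem_irrelevant: "p \<in> irrelevant \<longleftrightarrow> Poly_Mapping.lookup p 0 = 0"
proof -
  have "(\<exists>v. Poly_Mapping.lookup m v \<noteq> 0) \<longleftrightarrow> m \<noteq> 0" for m :: "'a \<Rightarrow>\<^sub>0 nat"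
    by (metis lookup_zero poly_mapping_eqI)
  then show ?thesis
    using mem_span_vars[of p UNIV] by (auto simp: irrelevant_def in_keys_iff)
qed

text \<open>The irrelevant ideal is the kernel of the constant coefficient, and modulo it
  \<open>a * b\<close> is the product of the constant coefficients \<open>c\<close> and
  \<open>d\<close>.\<close>

lemma prime_irrelevant: "prime_ideal irrelevant"
  unfolding prime_ideal_def
proof (intro conjI allI impI)
  show "idl.subspace irrelevant" by (simp add: irrelevant_def idl.subspace_span)
  show "1 \<notin> irrelevant" by (simp add: mem_irrelevant)
  fix a b :: "('a \<Rightarrow>\<^sub>0 nat) \<Rightarrow>\<^sub>0 'b" assume ab: "a * b \<in> irrelevant"
  show "a \<in> irrelevant \<or> b \<in> irrelevant"
  proof (rule ccontr)
    assume no: "\<not> ?thesis"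
    have dec: "x = cst (Poly_Mapping.lookup x 0) + (x - cst (Poly_Mapping.lookup x 0)) \<and>
        x - cst (Poly_Mapping.lookup x 0) \<in> irrelevant" for x :: "('a \<Rightarrow>\<^sub>0 nat) \<Rightarrow>\<^sub>0 'b"
      by (simp add: mem_irrelevant lookup_minus cst_def)
    define c d where "c = Poly_Mapping.lookup a 0" and "d = Poly_Mapping.lookup b 0"
    have cd: "c * d \<noteq> 0" using no by (simp add: mem_irrelevant c_def d_def)
    have "a * b - cst c * (b - cst d) - b * (a - cst c) \<in> irrelevant"
      using ab dec[of a] dec[of b] unfolding irrelevant_def c_def d_def
      by (metis idl.span_diff idl.span_scale)
    moreover have "a * b - cst c * (b - cst d) - b * (a - cst c) = cst (c * d)"
      by (simp add: algebra_simps cst_mult)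
    ultimately show False using cd by (simp add: mem_irrelevant cst_def)
  qed
qed

section \<open>Contraction of a localized ideal\<close>

text \<open>For an ideal \<open>J\<close>, the contraction of its extension to the localization at
  \<open>P\<close>. Thus \<open>I \<subseteq> loc_contr P J\<close> says that \<open>J\<close>
  contains \<open>I\<close> locally at \<open>P\<close>, without leaving the ring.\<close>

definition loc_contr :: "'a::comm_ring_1 set \<Rightarrow> 'a set \<Rightarrow> 'a set" where
  "loc_contr P J = {r. \<exists>s. s \<notin> P \<and> s * r \<in> J}"

lemma loc_contr_mono: "J \<subseteq> J' \<Longrightarrow> loc_contr P J \<subseteq> loc_contr P J'"
  by (auto simp: loc_contr_def)

lemma loc_contr_superset: "prime_ideal P \<Longrightarrow> J \<subseteq> loc_contr P J"
  by (auto simp: loc_contr_def prime_ideal_def intro!: exI[of _ 1])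

lemma loc_contrI: "s \<notin> P \<Longrightarrow> s * r \<in> J \<Longrightarrow> r \<in> loc_contr P J"
  by (auto simp: loc_contr_def)

lemma loc_contr_cancel:
  assumes "prime_ideal P" "s \<notin> P" "s * r \<in> loc_contr P J"
  shows "r \<in> loc_contr P J"
proof -
  obtain t where t: "t \<notin> P" "t * (s * r) \<in> J" using assms(3) by (auto simp: loc_contr_def)
  show ?thesis
    by (rule loc_contrI[of "t * s"]) (use t assms prime_idealD(3)[OF assms(1), of t s] in \<open>auto simp: mult.assoc\<close>)
qed

lemma subspace_loc_contr:
  assumes P: "prime_ideal P" and J: "idl.subspace J"
  shows "idl.subspace (loc_contr P J)"
proof (rule idl.subspaceI)
  show "0 \<in> loc_contr P J" using loc_contr_superset[OF P] idl.subspace_0[OF J] by blast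
next
  fix x y assume "x \<in> loc_contr P J" "y \<in> loc_contr P J"
  then obtain s t where st: "s \<notin> P" "s * x \<in> J" "t \<notin> P" "t * y \<in> J" by (auto simp: loc_contr_def)
  have "t * (s * x) + s * (t * y) \<in> J"
    by (rule idl.subspace_add[OF J ideal_mult(1)[OF J st(2)] ideal_mult(1)[OF J st(4)]])
  then have "(s * t) * (x + y) \<in> J" by (simp add: algebra_simps)
  then show "x + y \<in> loc_contr P J"
    using prime_idealD(3)[OF P, of s t] st by (intro loc_contrI[of "s * t"]) auto
next
  fix c x assume "x \<in> loc_contr P J"
  then obtain s where s: "s \<notin> P" "s * x \<in> J" by (auto simp: loc_contr_def)
  have "c * (s * x) \<in> J" by (rule ideal_mult(1)[OF J s(2)])
  then show "c * x \<in> loc_contr P J" using s by (intro loc_contrI[of s]) (auto simp: mult.left_commute)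
qed

section \<open>Nakayama's lemma and the exchange of local generators\<close>

definition scaled :: "'a::comm_ring_1 set \<Rightarrow> 'a set \<Rightarrow> 'a set" where
  "scaled P I = {p * a | p a. p \<in> P \<and> a \<in> I}"

lemma scaled_insert: "scaled P (insert x b) = scaled P b \<union> (\<lambda>p. p * x) ` P"
  by (auto simp: scaled_def)

lemma span_Un_scaled_singleton:
  assumes P: "idl.subspace P" and y: "y \<in> idl.span (A \<union> (\<lambda>p. p * x) ` P)"
  shows "\<exists>p\<in>P. y - p * x \<in> idl.span A"
proof -
  obtain a c where ac: "y = a + c" "a \<in> idl.span A" "c \<in> idl.span ((\<lambda>p. p * x) ` P)"
    using y unfolding idl.span_Un by blast
  have "idl.subspace ((\<lambda>p. p * x) ` P)"
  proof (rule idl.subspaceI)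
    show "0 \<in> (\<lambda>p. p * x) ` P" using idl.subspace_0[OF P] by (force intro: image_eqI[of _ _ 0])
    show "u + v \<in> (\<lambda>p. p * x) ` P" if "u \<in> (\<lambda>p. p * x) ` P" "v \<in> (\<lambda>p. p * x) ` P" for u v
      using that idl.subspace_add[OF P] by (auto simp flip: distrib_right)
    show "c * u \<in> (\<lambda>p. p * x) ` P" if "u \<in> (\<lambda>p. p * x) ` P" for c u
      using that ideal_mult(1)[OF P] by (auto simp flip: mult.assoc)
  qed
  then obtain p where "p \<in> P" "c = p * x" using ac(3) by (metis idl.span_eq_iff imageE)
  then show ?thesis using ac by (intro bexI[of _ p]) auto
qed

text \<open>Generators are eliminated one at a time: a relation \<open>s x = p x\<close> modulo the
  others, with \<open>p\<close> in \<open>P\<close> and \<open>s\<close> outside, has the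
  coefficient \<open>s - p\<close> outside \<open>P\<close>, which is a unit locally.\<close>

lemma Nakayama:
  assumes P: "prime_ideal P" and "finite b" "b \<subseteq> loc_contr P (idl.span (J \<union> scaled P b))"
  shows "b \<subseteq> loc_contr P (idl.span J)"
  using assms(2,3)
proof (induction b rule: finite_induct)
  case (insert x b)
  note sP = prime_idealD(1)[OF P]
  let ?A = "J \<union> scaled P b"
  have eq: "J \<union> scaled P (insert x b) = ?A \<union> (\<lambda>p. p * x) ` P" by (auto simp: scaled_insert)
  obtain s where s: "s \<notin> P" "s * x \<in> idl.span (?A \<union> (\<lambda>p. p * x) ` P)"
    using insert.prems unfolding eq by (auto simp: loc_contr_def)
  then obtain p where p: "p \<in> P" "s * x - p * x \<in> idl.span ?A" using span_Un_scaled_singleton[OF sP] by blast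
  have t: "s - p \<notin> P" using s(1) p(1) idl.subspace_add[OF sP, of "s - p" p] by auto
  have tx: "(s - p) * x \<in> idl.span ?A" using p(2) by (simp add: algebra_simps)
  have "b \<subseteq> loc_contr P (idl.span ?A)"
  proof
    fix y assume "y \<in> b"
    then obtain u where u: "u \<notin> P" "u * y \<in> idl.span (?A \<union> (\<lambda>p. p * x) ` P)"
      using insert.prems unfolding eq by (auto simp: loc_contr_def)
    then obtain q where q: "q \<in> P" "u * y - q * x \<in> idl.span ?A" using span_Un_scaled_singleton[OF sP] by blast
    have "(s - p) * (u * y - q * x) + q * ((s - p) * x) \<in> idl.span ?A"
      by (intro idl.span_add idl.span_scale q tx)
    then have "(s - p) * (u * y) \<in> idl.span ?A" by (simp add: algebra_simps)
    then have "((s - p) * u) * y \<in> idl.span ?A" by (simp only: mult.assoc)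
    moreover have "(s - p) * u \<notin> P" using t u(1) prime_idealD(3)[OF P] by blast
    ultimately show "y \<in> loc_contr P (idl.span ?A)" by (intro loc_contrI)
  qed
  then have b: "b \<subseteq> loc_contr P (idl.span J)" by (rule insert.IH)
  have "?A \<subseteq> loc_contr P (idl.span J)"
    using b idl.span_superset[of J] loc_contr_superset[OF P, of "idl.span J"]
      ideal_mult(1)[OF subspace_loc_contr[OF P idl.subspace_span[of J]]]
    by (auto simp: scaled_def)
  then have "idl.span ?A \<subseteq> loc_contr P (idl.span J)"
    by (rule idl.span_minimal[OF _ subspace_loc_contr[OF P idl.subspace_span]])
  then have "x \<in> loc_contr P (idl.span J)" using tx loc_contr_cancel[OF P t] by blast
  then show ?case using b by blast
qed simp

text \<open>As \<open>J\<close> and \<open>b\<close> generate \<open>I\<close> locally,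
  \<open>P I\<close> is locally contained in \<open>J + P b\<close>; this reduces the claim to the
  finite set \<open>b\<close>.\<close>

lemma Nakayama_ideal:
  assumes P: "prime_ideal P" and b: "finite b" "b \<subseteq> I" "I \<subseteq> loc_contr P (idl.span (J \<union> b))"
    and I: "I \<subseteq> loc_contr P (idl.span (J \<union> scaled P I))"
  shows "I \<subseteq> loc_contr P (idl.span J)"
proof -
  let ?L = "loc_contr P (idl.span (J \<union> scaled P b))"
  have L: "idl.subspace ?L" by (rule subspace_loc_contr[OF P idl.subspace_span])
  have base: "idl.span (J \<union> scaled P b) \<subseteq> ?L" by (rule loc_contr_superset[OF P])
  have "p * a \<in> ?L" if pa: "p \<in> P" "a \<in> I" for p a
  proof -
    obtain s where s: "s \<notin> P" "s * a \<in> idl.span (J \<union> b)" using b(3) pa(2) by (auto simp: loc_contr_def)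
    have "x * p \<in> idl.span (J \<union> scaled P b)" if "x \<in> J" for x
      by (rule ideal_mult(2)[OF idl.subspace_span idl.span_base]) (use that in simp)
    moreover have "x * p \<in> idl.span (J \<union> scaled P b)" if "x \<in> b" for x
      by (rule idl.span_base) (use that pa(1) in \<open>auto simp: scaled_def mult.commute[of x]\<close>)
    ultimately have "J \<union> b \<subseteq> col (idl.span (J \<union> scaled P b)) p" by (auto simp: col_def)
    then have "idl.span (J \<union> b) \<subseteq> col (idl.span (J \<union> scaled P b)) p"
      by (rule idl.span_minimal[OF _ subspace_col[OF idl.subspace_span]])
    then have "s * (p * a) \<in> idl.span (J \<union> scaled P b)" using s(2) by (auto simp: col_def ac_simps)
    then show ?thesis using s(1) by (intro loc_contrI)
  qed
  moreover have "J \<subseteq> ?L" using base idl.span_superset[of "J \<union> scaled P b"] by blast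
  ultimately have "J \<union> scaled P I \<subseteq> ?L" by (auto simp: scaled_def)
  then have sub: "idl.span (J \<union> scaled P I) \<subseteq> ?L" by (rule idl.span_minimal[OF _ L])
  have "b \<subseteq> ?L"
  proof
    fix x assume "x \<in> b"
    then obtain s where "s \<notin> P" "s * x \<in> idl.span (J \<union> scaled P I)" using b(2) I by (auto simp: loc_contr_def)
    then show "x \<in> ?L" using sub loc_contr_cancel[OF P] by blast
  qed
  then have "b \<subseteq> loc_contr P (idl.span J)" by (rule Nakayama[OF P b(1)])
  moreover have "J \<subseteq> loc_contr P (idl.span J)"
    using idl.span_superset[of J] loc_contr_superset[OF P, of "idl.span J"] by blast
  ultimately have sub2: "idl.span (J \<union> b) \<subseteq> loc_contr P (idl.span J)"
    by (intro idl.span_minimal subspace_loc_contr[OF P idl.subspace_span]) blast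
  show ?thesis
  proof
    fix a assume "a \<in> I"
    then obtain s where "s \<notin> P" "s * a \<in> idl.span (J \<union> b)" using b(3) by (auto simp: loc_contr_def)
    then show "a \<in> loc_contr P (idl.span J)" using sub2 loc_contr_cancel[OF P] by blast
  qed
qed

text \<open>Steinitz exchange modulo \<open>J + P I\<close>: in an expression of a multiple of
  \<open>f\<close> by \<open>J\<close> and \<open>b\<close>, some coefficient lies outside
  \<open>P\<close>, and the relation can be solved locally for that element of
  \<open>b\<close>.\<close>

lemma exchange_local_generator:
  assumes P: "prime_ideal P" and b: "finite b" "b \<subseteq> I" "I \<subseteq> loc_contr P (idl.span (J \<union> b))"
    and f: "f \<in> I" "f \<notin> loc_contr P (idl.span (J \<union> scaled P I))"
  shows "\<exists>x\<in>b. I \<subseteq> loc_contr P (idl.span (insert f J \<union> (b - {x})))"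
proof -
  obtain u where u: "u \<notin> P" "u * f \<in> idl.span (J \<union> b)" using b(3) f(1) by (auto simp: loc_contr_def)
  obtain j y where jy: "u * f = j + y" "j \<in> idl.span J" "y \<in> idl.span b"
    using u(2) unfolding idl.span_Un by blast
  obtain c where c: "y = (\<Sum>x\<in>b. c x * x)" using jy(3) unfolding idl.span_finite[OF b(1)] by blast
  have "\<exists>x\<in>b. c x \<notin> P"
  proof (rule ccontr)
    assume no: "\<not> ?thesis"
    have "y \<in> idl.span (scaled P I)"
      unfolding c using no b(2) by (intro idl.span_sum idl.span_base) (auto simp: scaled_def)
    then have "u * f \<in> idl.span (J \<union> scaled P I)" unfolding idl.span_Un using jy(1,2) by blast
    then show False using f(2) loc_contrI[OF u(1)] by blast
  qed
  then obtain x where x: "x \<in> b" "c x \<notin> P" by blast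
  let ?A = "idl.span (insert f J \<union> (b - {x}))"
  have sub: "idl.span (J \<union> (b - {x})) \<subseteq> ?A" by (rule idl.span_mono) blast
  have "f \<in> ?A" by (rule idl.span_base) simp
  have "c x * x = u * f - j - (\<Sum>y\<in>b - {x}. c y * y)"
    using jy(1) c sum.remove[OF b(1) x(1), of "\<lambda>y. c y * y"] by simp
  also have "\<dots> \<in> ?A"
  proof (intro idl.span_diff idl.span_sum idl.span_scale \<open>f \<in> ?A\<close>)
    show "j \<in> ?A" using jy(2) idl.span_mono[of J "insert f J \<union> (b - {x})"] by blast
    show "y \<in> ?A" if "y \<in> b - {x}" for y using that by (intro idl.span_base) blast
  qed
  finally have cx: "x \<in> loc_contr P ?A" using x(2) by (intro loc_contrI)
  have L: "idl.subspace (loc_contr P ?A)" by (rule subspace_loc_contr[OF P idl.subspace_span])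
  have "insert f J \<union> (b - {x}) \<subseteq> loc_contr P ?A"
    using idl.span_superset[of "insert f J \<union> (b - {x})"] loc_contr_superset[OF P, of ?A] by blast
  then have "J \<union> b \<subseteq> loc_contr P ?A" using cx by blast
  then have sub2: "idl.span (J \<union> b) \<subseteq> loc_contr P ?A" by (rule idl.span_minimal[OF _ L])
  have "I \<subseteq> loc_contr P ?A"
  proof
    fix a assume "a \<in> I"
    then obtain s where "s \<notin> P" "s * a \<in> idl.span (J \<union> b)" using b(3) by (auto simp: loc_contr_def)
    then show "a \<in> loc_contr P ?A" using sub2 loc_contr_cancel[OF P] by blast
  qed
  then show ?thesis using x(1) by blast
qed

section \<open>A general sequence of generators\<close>

text \<open>Lower bounds on the height, without the extended naturals and the supremum of
  \<open>prime_height\<close>.\<close>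

definition height_ge :: "'a::comm_ring_1 set \<Rightarrow> nat \<Rightarrow> bool" where
  "height_ge P k \<longleftrightarrow> (\<exists>C. (\<forall>i\<le>k. prime_ideal (C i)) \<and> (\<forall>i<k. C i \<subset> C (Suc i)) \<and> C k = P)"

lemma height_ge_Suc:
  assumes "height_ge Q k" "prime_ideal P" "Q \<subset> P"
  shows "height_ge P (Suc k)"
proof -
  obtain C where C: "\<forall>i\<le>k. prime_ideal (C i)" "\<forall>i<k. C i \<subset> C (Suc i)" "C k = Q"
    using assms(1) by (auto simp: height_ge_def)
  show ?thesis
    unfolding height_ge_def
    by (rule exI[of _ "\<lambda>i. if i \<le> k then C i else P"]) (use C assms(2,3) in \<open>auto simp: le_Suc_eq less_Suc_eq\<close>)
qed

lemma height_ge_antimono: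
  assumes "height_ge P k" "j \<le> k"
  shows "height_ge P j"
proof -
  obtain C where C: "\<forall>i\<le>k. prime_ideal (C i)" "\<forall>i<k. C i \<subset> C (Suc i)" "C k = P"
    using assms(1) by (auto simp: height_ge_def)
  show ?thesis
    unfolding height_ge_def
    by (rule exI[of _ "\<lambda>i. C (i + (k - j))"]) (use C assms(2) in auto)
qed

text \<open>Makes it possible to extend the regular sequence to a basis of the space of
  generators.\<close>

lemma reg_independent:
  fixes fs :: "('x, 'k::field) mpoly list"
  assumes "reg {} fs" "set fs \<subseteq> irrelevant"
  shows "distinct fs \<and> kv.independent (set fs)"
  using assms
proof (induction fs rule: rev_induct)
  case Nil
  show ?case using kv.independent_empty by simp
next
  case (snoc f fs)
  then have IH: "distinct fs" "kv.independent (set fs)" and f: "nzd (idl.span (set fs)) f"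
    by (auto simp: reg_append)
  have "idl.span (set fs) \<subseteq> irrelevant"
    by (rule idl.span_minimal) (use snoc.prems(2) prime_idealD(1)[OF prime_irrelevant] in auto)
  then have "1 \<notin> idl.span (set fs)" using prime_idealD(2)[OF prime_irrelevant] by blast
  then have "f \<notin> idl.span (set fs)" using f unfolding nzd_def by (metis mult_1_left)
  then have "f \<notin> kv.span (set fs)" using kv_span_subset_idl_span by blast
  moreover from this have "f \<notin> set fs" using kv.span_base by blast
  ultimately show ?case using IH by (simp add: kv.independent_insert)
qed

lemma homog_kv_span:
  assumes "\<And>b. b \<in> B \<Longrightarrow> homog d b" "c \<in> kv.span B"
  shows "homog d c"
  using assms(2)
proof (induction rule: kv.span_induct_alt)
  case base show ?case by (simp add: homog_def)
next
  case (step c x y)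
  then have "homog (0 + d) (cst c * x)" using assms(1) by (intro homog_mult) (auto simp: homog_def cst_def mdeg_def)
  then show ?case using step(2) keys_add[of "cst c * x" y] by (auto simp: homog_def)
qed

lemma homog_irrelevant: "homog (Suc d) p \<Longrightarrow> p \<in> irrelevant"
  by (rule ccontr) (force simp: mem_irrelevant homog_def in_keys_iff mdeg_def)

text \<open>What the construction uses of an almost complete intersection. The generators share one
  positive degree, so that combinations with constant coefficients are homogeneous and lie in
  \<open>irrelevant\<close>. Primes over \<open>B\<close> that fail
  \<open>height_ge P (Suc h)\<close> have height exactly \<open>h\<close>.\<close>

locale generic_generators =
  fixes B :: "('x::finite, 'k::field) mpoly set" and h d :: nat
  assumes infinite_field: "infinite (UNIV :: 'k set)"
    and finite_B: "finite B" and card_B: "card B \<le> Suc h" and homog_B: "\<And>b. b \<in> B \<Longrightarrow> homog (Suc d) b"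
    and height_B: "\<And>P. prime_ideal P \<Longrightarrow> B \<subseteq> P \<Longrightarrow> height_ge P h"
    and local_generators:
      "\<And>P. prime_ideal P \<Longrightarrow> B \<subseteq> P \<Longrightarrow> \<not> height_ge P (Suc h) \<Longrightarrow>
        \<exists>b. finite b \<and> card b \<le> h \<and> b \<subseteq> idl.span B \<and> idl.span B \<subseteq> loc_contr P (idl.span b)"
begin

abbreviation "I \<equiv> idl.span B"

lemma kv_span_irrelevant: "f \<in> kv.span B \<Longrightarrow> f \<in> irrelevant"
  using homog_kv_span[of B "Suc d"] homog_B homog_irrelevant by blast

text \<open>The irrelevant ideal contains \<open>B\<close>, so a chain of length \<open>h\<close>
  ends in it. The bound allows sequences of length up to \<open>h\<close> to be prolonged to length
  \<open>n\<close>.\<close>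

lemma height_le_vars: "h \<le> card (UNIV :: 'x set)"
proof -
  have "B \<subseteq> irrelevant" using homog_B homog_irrelevant by blast
  from height_B[OF prime_irrelevant this] show ?thesis
    unfolding height_ge_def using irrelevant_prime_chain by metis
qed

lemma associated_height:
  assumes "set fs \<subseteq> kv.span B" "reg {} fs" "length fs \<le> h" "z \<notin> idl.span (set fs)"
    "height_ge (col (idl.span (set fs)) z) k"
  shows "k \<le> length fs"
proof -
  obtain C where C: "\<forall>i\<le>k. prime_ideal (C i)" "\<forall>i<k. C i \<subset> C (Suc i)" "C k = col (idl.span (set fs)) z"
    using assms(5) by (auto simp: height_ge_def)
  show ?thesis
  proof (rule associated_prime_chain[where C = C and k = k, OF infinite_field assms(2) _ _ _ assms(4) C(3)])
    show "set fs \<subseteq> irrelevant" using assms(1) kv_span_irrelevant by blast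
    show "\<exists>e. homog e f" if "f \<in> set fs" for f using that assms(1) homog_kv_span[of B "Suc d"] homog_B by blast
    show "length fs \<le> card (UNIV :: 'x set)" using assms(3) height_le_vars by simp
  qed (use C in auto)
qed

text \<open>The invariant is the count \<open>h - i\<close> of further local generators at every
  prime of the family; each new \<open>f\<close> is a nonzerodivisor and takes the place of one of
  them.\<close>

lemma general_regular_sequence:
  assumes "finite \<M>" "\<And>P. P \<in> \<M> \<Longrightarrow> prime_ideal P \<and>
      (\<exists>b. finite b \<and> card b \<le> h \<and> b \<subseteq> I \<and> I \<subseteq> loc_contr P (idl.span b))"
    and "i \<le> h"
  shows "\<exists>fs. length fs = i \<and> set fs \<subseteq> kv.span B \<and> reg {} fs \<and>
    (\<forall>P\<in>\<M>. \<exists>b. finite b \<and> card b \<le> h - i \<and> b \<subseteq> I \<and> I \<subseteq> loc_contr P (idl.span (set fs \<union> b)))"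
  using assms(3)
proof (induction i)
  case 0
  show ?case by (rule exI[of _ "[]"]) (use assms(2) in auto)
next
  case (Suc i)
  then obtain fs where fs: "length fs = i" "set fs \<subseteq> kv.span B" "reg {} fs"
    and gens: "\<And>P. P \<in> \<M> \<Longrightarrow> \<exists>b. finite b \<and> card b \<le> h - i \<and> b \<subseteq> I \<and> I \<subseteq> loc_contr P (idl.span (set fs \<union> b))"
    by (metis Suc_leD)
  let ?J = "idl.span (set fs)"
  obtain A where A: "finite A" "\<And>P. P \<in> A \<Longrightarrow> prime_ideal P \<and> (\<exists>z. z \<notin> ?J \<and> P = col ?J z)"
    "\<And>r. nzd ?J r \<or> (\<exists>P\<in>A. r \<in> P)"
    using zero_divisors_finite_primes[OF noetherian_polynomials idl.subspace_span, of "set fs"] by blast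
  define Q where "Q P = loc_contr P (idl.span (set fs \<union> scaled P I))" for P
  \<comment> \<open>Ideals \<open>Q P\<close> that contain \<open>B\<close> cannot be avoided; for
    those \<open>P\<close>, Nakayama's lemma shows below that \<open>?J\<close> already generates
    \<open>I\<close> locally.\<close>
  let ?avoid = "A \<union> {R \<in> Q ` \<M>. \<not> B \<subseteq> R}"
  have "idl.subspace R \<and> \<not> B \<subseteq> R" if R: "R \<in> ?avoid" for R
  proof (cases "R \<in> A")
    case True
    from A(2)[OF True] obtain z where z: "prime_ideal R" "z \<notin> ?J" "R = col ?J z" by blast
    have "\<not> B \<subseteq> R"
    proof
      assume "B \<subseteq> R"
      \<comment> \<open>Primes over \<open>B\<close> have height at least \<open>h\<close>,
        associated primes of \<open>?J\<close> at most \<open>i < h\<close>.\<close>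
      then have "height_ge (col ?J z) h" using height_B z(1,3) by blast
      then have "h \<le> i" using associated_height[OF fs(2,3) _ z(2)] fs(1) Suc.prems by simp
      then show False using Suc.prems by simp
    qed
    then show ?thesis using prime_idealD(1)[OF z(1)] by blast
  next
    case False
    then obtain P where "P \<in> \<M>" "R = Q P" "\<not> B \<subseteq> R" using R by blast
    then show ?thesis using assms(2) subspace_loc_contr[OF _ idl.subspace_span] unfolding Q_def by metis
  qed
  moreover have "finite ?avoid" using A(1) assms(1) by simp
  ultimately obtain f where f: "f \<in> kv.span B" "\<And>R. R \<in> ?avoid \<Longrightarrow> f \<notin> R"
    using avoid_ideals[OF infinite_field, of ?avoid B] by blast
  have "nzd ?J f" using A(3)[of f] f(2) by blast
  then have "reg {} (fs @ [f])" using fs(3) by (simp add: reg_append)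
  moreover have "\<exists>b. finite b \<and> card b \<le> h - Suc i \<and> b \<subseteq> I \<and> I \<subseteq> loc_contr P (idl.span (set (fs @ [f]) \<union> b))"
    if P: "P \<in> \<M>" for P
  proof -
    have pP: "prime_ideal P" using assms(2)[OF P] by blast
    obtain b where b: "finite b" "card b \<le> h - i" "b \<subseteq> I" "I \<subseteq> loc_contr P (idl.span (set fs \<union> b))"
      using gens[OF P] by blast
    show ?thesis
    proof (cases "B \<subseteq> Q P")
      case True
      have "I \<subseteq> Q P" using True unfolding Q_def
        by (intro idl.span_minimal subspace_loc_contr[OF pP idl.subspace_span])
      then have "I \<subseteq> loc_contr P ?J" unfolding Q_def by (rule Nakayama_ideal[OF pP b(1,3,4)])
      also have "\<dots> \<subseteq> loc_contr P (idl.span (set (fs @ [f]) \<union> {}))"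
        by (intro loc_contr_mono idl.span_mono) auto
      finally show ?thesis by (intro exI[of _ "{}"]) auto
    next
      case False
      then have "f \<notin> Q P" using f(2) P by blast
      moreover have "f \<in> I" using f(1) kv_span_subset_idl_span by blast
      ultimately obtain x where x: "x \<in> b" "I \<subseteq> loc_contr P (idl.span (insert f (set fs) \<union> (b - {x})))"
        using exchange_local_generator[OF pP b(1,3,4)] unfolding Q_def by blast
      have "card (b - {x}) \<le> h - Suc i" using b(1,2) x(1) by simp
      then show ?thesis using x b by (intro exI[of _ "b - {x}"]) auto
    qed
  qed
  ultimately show ?case using fs f(1) by (intro exI[of _ "fs @ [f]"]) simp
qed

theorem exists_generating_d_sequence:
  "\<exists>fs f. reg {} fs \<and> set (fs @ [f]) \<subseteq> kv.span B \<and> I = idl.span (set (fs @ [f])) \<and>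
     (\<forall>r. r * f * f \<in> idl.span (set fs) \<longrightarrow> r * f \<in> idl.span (set fs))"
proof -
  obtain \<P> where \<P>: "finite \<P>" "\<And>P. P \<in> \<P> \<Longrightarrow> prime_ideal P \<and> I \<subseteq> P"
    "\<And>Q. prime_ideal Q \<Longrightarrow> I \<subseteq> Q \<Longrightarrow> \<exists>P\<in>\<P>. P \<subseteq> Q"
    using finite_minimal_primes[OF noetherian_polynomials idl.subspace_span[of B]] by blast
  \<comment> \<open>By \<open>local_generators\<close>, the members of \<open>\<P>\<close> of height
    \<open>h\<close> are among these.\<close>
  define \<M> where "\<M> = {P\<in>\<P>. \<exists>b. finite b \<and> card b \<le> h \<and> b \<subseteq> I \<and> I \<subseteq> loc_contr P (idl.span b)}"
  have M1: "finite \<M>" using \<P>(1) by (simp add: \<M>_def)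
  have M2: "prime_ideal P \<and> (\<exists>b. finite b \<and> card b \<le> h \<and> b \<subseteq> I \<and> I \<subseteq> loc_contr P (idl.span b))"
    if "P \<in> \<M>" for P
    using that \<P>(2) by (auto simp: \<M>_def)
  obtain fs where fs: "length fs = h" "set fs \<subseteq> kv.span B" "reg {} fs"
    and gens: "\<And>P. P \<in> \<M> \<Longrightarrow> \<exists>b. finite b \<and> card b \<le> h - h \<and> b \<subseteq> I \<and> I \<subseteq> loc_contr P (idl.span (set fs \<union> b))"
    using general_regular_sequence[OF M1 M2 le_refl] by blast
  let ?J = "idl.span (set fs)"
  \<comment> \<open>After all \<open>h\<close> choices, \<open>b\<close> has at most
    \<open>h - h = 0\<close> elements.\<close>
  have loc: "I \<subseteq> loc_contr P ?J" if P: "P \<in> \<M>" for P using gens[OF P] by auto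
  have ind: "distinct fs" "kv.independent (set fs)"
    using reg_independent[OF fs(3)] fs(2) kv_span_irrelevant by blast+
  \<comment> \<open>A basis of \<open>kv.span B\<close> that extends the independent
    \<open>fs\<close> has at most \<open>h + 1\<close> elements, hence at most one besides
    \<open>fs\<close>.\<close>
  obtain B' where B': "set fs \<subseteq> B'" "B' \<subseteq> kv.span B" "kv.independent B'" "kv.span B \<subseteq> kv.span B'"
    using kv.maximal_independent_subset_extend[OF fs(2) ind(2)] by blast
  have finB': "finite B'" "card B' \<le> card B" using kv.independent_span_bound[OF finite_B B'(3,2)] by auto
  have "card (B' - set fs) \<le> 1"
    using finB' B'(1) card_B fs(1) distinct_card[OF ind(1)] by (simp add: card_Diff_subset)
  then obtain f where f: "f \<in> kv.span B" "B' \<subseteq> insert f (set fs)"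
  proof (cases "B' \<subseteq> set fs")
    case True
    \<comment> \<open>If \<open>fs\<close> already spans, \<open>f = 0\<close> completes it.\<close>
    then show ?thesis using that[of 0] kv.span_zero by blast
  next
    case False
    then obtain f where f: "f \<in> B' - set fs" by blast
    have "B' - set fs = {f}"
      using \<open>card (B' - set fs) \<le> 1\<close> f finB'(1) by (metis card_le_Suc0_iff_eq One_nat_def finite_Diff is_singletonI' is_singleton_the_elem singletonD empty_iff)
    then show ?thesis using that[of f] B'(2) f by blast
  qed
  have I: "I = idl.span (set (fs @ [f]))"
  proof
    have "B \<subseteq> kv.span (insert f (set fs))"
      using kv.span_superset[of B] B'(4) kv.span_mono[OF f(2)] by blast
    then have "B \<subseteq> idl.span (set (fs @ [f]))" using kv_span_subset_idl_span[of "insert f (set fs)"] by auto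
    then show "I \<subseteq> idl.span (set (fs @ [f]))" by (rule idl.span_minimal[OF _ idl.subspace_span])
    show "idl.span (set (fs @ [f])) \<subseteq> I"
      by (rule idl.span_minimal[OF _ idl.subspace_span]) (use fs(2) f(1) kv_span_subset_idl_span in auto)
  qed
  have "r * f \<in> ?J" if r: "r * f * f \<in> ?J" for r
  proof (rule ccontr)
    assume "r * f \<notin> ?J"
    \<comment> \<open>A multiple \<open>s * (r * f)\<close> of the offending element has a prime
      annihilator, which contains \<open>f\<close> because \<open>r * f * f\<close> lies in
      \<open>?J\<close>.\<close>
    from exists_prime_col[OF noetherian_polynomials idl.subspace_span this]
    obtain s where s: "s * (r * f) \<notin> ?J" "prime_ideal (col ?J (s * (r * f)))" by blast
    define P where "P = col ?J (s * (r * f))"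
    have P: "prime_ideal P" using s(2) by (simp add: P_def)
    have "s * (r * f * f) \<in> ?J" by (rule idl.span_scale[OF r])
    then have "f \<in> P" by (simp add: P_def col_def ac_simps)
    moreover have "set fs \<subseteq> P" unfolding P_def
      using col_superset[OF idl.subspace_span[of "set fs"]] idl.span_superset[of "set fs"] by blast
    ultimately have IP: "I \<subseteq> P" unfolding I by (intro idl.span_minimal[OF _ prime_idealD(1)[OF P]]) auto
    then have BP: "B \<subseteq> P" using idl.span_superset[of B] by blast
    have ht: "\<not> height_ge P (Suc h)"
      using associated_height[OF fs(2,3) _ s(1), of "Suc h"] fs(1) unfolding P_def by auto
    obtain P0 where P0: "P0 \<in> \<P>" "P0 \<subseteq> P" using \<P>(3)[OF P IP] by blast
    \<comment> \<open>A strictly smaller prime over \<open>I\<close> would have height at least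
      \<open>h\<close>, and \<open>P\<close> a height above \<open>h\<close>.\<close>
    have "P0 = P"
    proof (rule ccontr)
      assume "P0 \<noteq> P"
      moreover have "B \<subseteq> P0" using \<P>(2)[OF P0(1)] idl.span_superset[of B] by blast
      ultimately have "height_ge P (Suc h)"
        using height_ge_Suc[OF height_B P] P0 \<P>(2)[OF P0(1)] by blast
      then show False using ht by blast
    qed
    then have "P \<in> \<M>" using P0(1) local_generators[OF P BP ht] by (simp add: \<M>_def)
    moreover have "f \<in> I" using f(1) kv_span_subset_idl_span by blast
    ultimately obtain u where u: "u \<notin> P" "u * f \<in> ?J" using loc by (auto simp: loc_contr_def)
    have "(s * r) * (u * f) \<in> ?J" by (rule idl.span_scale[OF u(2)])
    then have "u * (s * (r * f)) \<in> ?J" by (simp add: ac_simps)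
    then show False using u(1) by (simp add: P_def col_def)
  qed
  then show ?thesis using fs f(1) I by (intro exI[of _ fs] exI[of _ f]) auto
qed

end

section \<open>Ideals of the ring of a type\<close>

abbreviation tr :: "'a::comm_ring_1 ring" where
  "tr \<equiv> ring_of_type_algebra"

lemma tr_simps [simp]:
  "carrier tr = UNIV" "x \<otimes>\<^bsub>tr\<^esub> y = x * y" "x \<oplus>\<^bsub>tr\<^esub> y = x + y" "\<zero>\<^bsub>tr\<^esub> = 0" "\<one>\<^bsub>tr\<^esub> = 1"
  by (simp_all add: ring_of_type_algebra_def)

lemma cring_tr: "cring tr"
  by (rule cring_from_type_algebra)

lemma minus_tr [simp]: "x \<ominus>\<^bsub>tr\<^esub> y = x - y"
proof -
  interpret cring tr by (rule cring_tr)
  have "\<ominus>\<^bsub>tr\<^esub> y = - y" by (rule minus_equality) simp_all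
  then show ?thesis by (simp add: a_minus_def)
qed

lemma (in cring) ideal_of_closed:
  assumes "J \<subseteq> carrier R" "\<zero> \<in> J" "\<And>x y. x \<in> J \<Longrightarrow> y \<in> J \<Longrightarrow> x \<oplus> y \<in> J"
    "\<And>x a. x \<in> J \<Longrightarrow> a \<in> carrier R \<Longrightarrow> a \<otimes> x \<in> J"
  shows "ideal J R"
proof (rule idealI[OF ring_axioms])
  have "\<ominus> x \<in> J" if "x \<in> J" for x
  proof -
    have "\<ominus> x = (\<ominus> \<one>) \<otimes> x" using that assms(1) by (simp add: l_minus subset_iff)
    then show ?thesis using assms(4)[OF that, of "\<ominus> \<one>"] by simp
  qed
  then show "subgroup J (add_monoid R)"
    by (intro add.subgroupI) (use assms in \<open>auto simp: a_inv_def[symmetric]\<close>)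
  show "a \<otimes> x \<in> J" if "a \<in> J" "x \<in> carrier R" for a x
    using assms(4)[OF that] m_comm[of a x] assms(1) that by auto
qed (rule assms(4))

lemma ideal_tr_iff: "ideal J tr \<longleftrightarrow> idl.subspace J"
proof
  interpret cring tr by (rule cring_tr)
  assume "ideal J tr"
  then interpret ideal J tr .
  show "idl.subspace J" by (rule idl.subspaceI) (use zero_closed a_closed I_l_closed in auto)
next
  interpret cring tr by (rule cring_tr)
  assume "idl.subspace J"
  then show "ideal J tr" by (intro ideal_of_closed) (auto simp: idl.subspace_def)
qed

lemma genideal_tr: "Idl\<^bsub>tr\<^esub> B = idl.span B"
proof
  interpret cring tr by (rule cring_tr)
  show "Idl\<^bsub>tr\<^esub> B \<subseteq> idl.span B"
    by (rule genideal_minimal) (auto simp: ideal_tr_iff idl.subspace_span idl.span_base)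
  show "idl.span B \<subseteq> Idl\<^bsub>tr\<^esub> B"
    by (rule idl.span_minimal) (use genideal_self[of B] genideal_ideal[of B] in \<open>auto simp: ideal_tr_iff\<close>)
qed

lemma primeideal_tr_iff: "primeideal P tr \<longleftrightarrow> prime_ideal P"
proof
  assume "primeideal P tr"
  then interpret primeideal P tr .
  have "1 \<notin> P" using one_imp_carrier I_notcarr by auto
  then show "prime_ideal P"
    using I_prime ideal_axioms by (auto simp: prime_ideal_def ideal_tr_iff)
next
  assume "prime_ideal P"
  then show "primeideal P tr"
    by (intro primeidealI cring_tr) (auto simp: prime_ideal_def ideal_tr_iff)
qed

text \<open>Dropping the lowest members shortens a chain, so if no chain of length \<open>h\<close>
  ends in \<open>P\<close>, all chains are shorter and the supremum stays below
  \<open>h\<close>.\<close>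

lemma height_ge_of_prime_height:
  assumes "prime_ideal P" "prime_height tr P \<ge> enat h"
  shows "height_ge P h"
proof (rule ccontr)
  assume no: "\<not> height_ge P h"
  have "height_ge P 0" unfolding height_ge_def using assms(1) by (intro exI[of _ "\<lambda>_. P"]) auto
  then obtain n where n: "h = Suc n" using no by (cases h) auto
  have "prime_height tr P \<le> enat n"
    unfolding prime_height_def
  proof (rule SUP_least, clarify)
    fix k C assume "\<forall>i\<le>k. primeideal (C i) tr" "\<forall>i<k. C i \<subset> C (Suc i)" "P = C k"
    then have "height_ge P k" unfolding height_ge_def by (auto simp: primeideal_tr_iff)
    then have "k \<le> n" using height_ge_antimono[of P k h] no n by (cases "k \<le> n") auto
    then show "enat k \<le> enat n" by simp
  qed
  then show False using assms(2) n by (metis enat_ord_simps(1) not_less_eq_eq order_refl order_trans)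
qed

text \<open>If all members exceeded \<open>h\<close>, the infimum would be at least
  \<open>h + 1\<close>. An empty index set, with infimum \<infinity>, is ruled out as well.\<close>

lemma INF_le_enatD:
  assumes "(INF x\<in>A. f x) \<le> enat h"
  shows "\<exists>x\<in>A. f x \<le> enat h"
proof (rule ccontr)
  assume "\<not> ?thesis"
  then have "eSuc (enat h) \<le> (INF x\<in>A. f x)" by (intro INF_greatest) (auto simp: ileI1)
  then have "eSuc (enat h) \<le> enat h" using assms by (rule order_trans)
  then show False by (simp add: eSuc_enat)
qed

section \<open>Localization at a prime\<close>

locale localization_at_prime =
  fixes P :: "'a::comm_ring_1 set"
  assumes prime: "prime_ideal P"
begin

abbreviation "fr \<equiv> loc_frac tr P"
abbreviation "L \<equiv> localization tr P"

lemma one_notin: "1 \<notin> P"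
  using prime by (simp add: prime_ideal_def)

lemma mult_notin: "s \<notin> P \<Longrightarrow> t \<notin> P \<Longrightarrow> s * t \<notin> P"
  using prime_idealD(3)[OF prime] by blast

lemma loc_rel_iff:
  "((a, s), (b, t)) \<in> loc_rel tr P \<longleftrightarrow> s \<notin> P \<and> t \<notin> P \<and> (\<exists>u. u \<notin> P \<and> u * (a * t - b * s) = 0)"
  by (auto simp: loc_rel_def)

lemma equiv_loc_rel: "equiv (UNIV \<times> - P) (loc_rel tr P)"
proof (rule equivI)
  show "loc_rel tr P \<subseteq> (UNIV \<times> - P) \<times> (UNIV \<times> - P)" by (auto simp: loc_rel_def)
  show "refl_on (UNIV \<times> - P) (loc_rel tr P)"
    using one_notin by (auto simp: refl_on_def loc_rel_iff)
  show "sym (loc_rel tr P)"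
  proof (rule symI, clarify)
    fix a s b t assume "((a, s), (b, t)) \<in> loc_rel tr P"
    then obtain u where u: "s \<notin> P" "t \<notin> P" "u \<notin> P" "u * (a * t - b * s) = 0" by (auto simp: loc_rel_iff)
    have "u * (b * s - a * t) = - (u * (a * t - b * s))" by (simp add: algebra_simps)
    then show "((b, t), (a, s)) \<in> loc_rel tr P" using u by (auto simp: loc_rel_iff)
  qed
  show "trans (loc_rel tr P)"
  proof (rule transI, clarify)
    fix a s b t c r assume "((a, s), (b, t)) \<in> loc_rel tr P" "((b, t), (c, r)) \<in> loc_rel tr P"
    then obtain u v where u: "s \<notin> P" "t \<notin> P" "u \<notin> P" "u * (a * t - b * s) = 0"
      and v: "r \<notin> P" "v \<notin> P" "v * (b * r - c * t) = 0" by (auto simp: loc_rel_iff)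
    have "(u * v * t) * (a * r - c * s) = v * r * (u * (a * t - b * s)) + u * s * (v * (b * r - c * t))"
      by (simp add: algebra_simps)
    then have "(u * v * t) * (a * r - c * s) = 0" using u(4) v(3) by simp
    moreover have "u * v * t \<notin> P" by (intro mult_notin u v)
    ultimately show "((a, s), (c, r)) \<in> loc_rel tr P" using u v by (auto simp: loc_rel_iff)
  qed
qed

lemma frac_eq_iff:
  "s \<notin> P \<Longrightarrow> t \<notin> P \<Longrightarrow> fr a s = fr b t \<longleftrightarrow> (\<exists>u. u \<notin> P \<and> u * (a * t - b * s) = 0)"
  unfolding loc_frac_def by (subst eq_equiv_class_iff[OF equiv_loc_rel]) (auto simp: loc_rel_iff)

lemma frac_eqI: "s \<notin> P \<Longrightarrow> t \<notin> P \<Longrightarrow> a * t = b * s \<Longrightarrow> fr a s = fr b t"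
  using one_notin by (subst frac_eq_iff) auto

lemma carrier_L: "x \<in> carrier L \<longleftrightarrow> (\<exists>a s. s \<notin> P \<and> x = fr a s)"
  by (auto simp: localization_def quotient_def loc_frac_def)

lemma carrier_LE:
  assumes "x \<in> carrier L"
  obtains a s where "s \<notin> P" "x = fr a s"
  using assms carrier_L by blast

lemma frac_in [simp]: "s \<notin> P \<Longrightarrow> fr a s \<in> carrier L"
  by (auto simp: carrier_L)

lemma mem_frac: "(b, t) \<in> fr a s \<longleftrightarrow> ((a, s), (b, t)) \<in> loc_rel tr P"
  by (simp add: loc_frac_def)

text \<open>The union in the definition runs over all pairs of representatives and collapses because
  they all give the same fraction.\<close>

lemma mult_frac [simp]:
  assumes "s \<notin> P" "t \<notin> P"
  shows "fr a s \<otimes>\<^bsub>L\<^esub> fr b t = fr (a * b) (s * t)"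
proof -
  have "(\<Union>((c, r), (d, q)) \<in> fr a s \<times> fr b t. fr (c * d) (r * q)) = fr (a * b) (s * t)"
  proof (rule UN_constant_eq)
    show "((a, s), (b, t)) \<in> fr a s \<times> fr b t"
      using assms one_notin by (auto simp: mem_frac loc_rel_iff)
    show "\<forall>y\<in>fr a s \<times> fr b t. (\<lambda>((c, r), (d, q)). fr (c * d) (r * q)) y = fr (a * b) (s * t)"
    proof clarsimp
      fix c r d q assume "(c, r) \<in> fr a s" "(d, q) \<in> fr b t"
      then obtain u v where u: "r \<notin> P" "u \<notin> P" "u * (a * r - c * s) = 0"
        and v: "q \<notin> P" "v \<notin> P" "v * (b * q - d * t) = 0" by (auto simp: mem_frac loc_rel_iff)
      have "(u * v) * (c * d * (s * t) - a * b * (r * q)) =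
          - (v * b * q * (u * (a * r - c * s))) - u * c * s * (v * (b * q - d * t))"
        by (simp add: algebra_simps)
      then have "(u * v) * (c * d * (s * t) - a * b * (r * q)) = 0" using u(3) v(3) by simp
      then show "fr (c * d) (r * q) = fr (a * b) (s * t)"
        using assms u v mult_notin by (subst frac_eq_iff) (blast intro: mult_notin)+
    qed
  qed
  then show ?thesis by (simp add: localization_def)
qed

lemma add_frac [simp]:
  assumes "s \<notin> P" "t \<notin> P"
  shows "fr a s \<oplus>\<^bsub>L\<^esub> fr b t = fr (a * t + b * s) (s * t)"
proof -
  have "(\<Union>((c, r), (d, q)) \<in> fr a s \<times> fr b t. fr (c * q + d * r) (r * q)) = fr (a * t + b * s) (s * t)"
  proof (rule UN_constant_eq)
    show "((a, s), (b, t)) \<in> fr a s \<times> fr b t"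
      using assms one_notin by (auto simp: mem_frac loc_rel_iff)
    show "\<forall>y\<in>fr a s \<times> fr b t. (\<lambda>((c, r), (d, q)). fr (c * q + d * r) (r * q)) y = fr (a * t + b * s) (s * t)"
    proof clarsimp
      fix c r d q assume "(c, r) \<in> fr a s" "(d, q) \<in> fr b t"
      then obtain u v where u: "r \<notin> P" "u \<notin> P" "u * (a * r - c * s) = 0"
        and v: "q \<notin> P" "v \<notin> P" "v * (b * q - d * t) = 0" by (auto simp: mem_frac loc_rel_iff)
      have "(u * v) * ((c * q + d * r) * (s * t) - (a * t + b * s) * (r * q)) =
          - (v * q * t * (u * (a * r - c * s))) - u * r * s * (v * (b * q - d * t))"
        by (simp add: algebra_simps)
      then have "(u * v) * ((c * q + d * r) * (s * t) - (a * t + b * s) * (r * q)) = 0" using u(3) v(3) by simp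
      then show "fr (c * q + d * r) (r * q) = fr (a * t + b * s) (s * t)"
        using assms u v mult_notin by (subst frac_eq_iff) (blast intro: mult_notin)+
    qed
  qed
  then show ?thesis by (simp add: localization_def)
qed

lemma zero_L: "\<zero>\<^bsub>L\<^esub> = fr 0 1" and one_L: "\<one>\<^bsub>L\<^esub> = fr 1 1"
  by (simp_all add: localization_def)

lemma cring_L: "cring L"
proof (rule cringI)
  show "abelian_group L"
  proof (rule abelian_groupI)
    show "\<exists>y\<in>carrier L. y \<oplus>\<^bsub>L\<^esub> x = \<zero>\<^bsub>L\<^esub>" if x: "x \<in> carrier L" for x
    proof -
      obtain a s where "s \<notin> P" "x = fr a s" using x by (auto simp: carrier_L)
      moreover from this have "fr (- a) s \<oplus>\<^bsub>L\<^esub> x = fr (- a * s + a * s) (s * s)" by simp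
      moreover have "fr (- a * s + a * s) (s * s) = fr 0 1"
        by (rule frac_eqI) (use \<open>s \<notin> P\<close> mult_notin one_notin in auto)
      ultimately show ?thesis by (intro bexI[of _ "fr (- a) s"]) (simp_all add: zero_L)
    qed
  qed (((elim carrier_LE)?; simp add: zero_L one_L one_notin mult_notin; (rule frac_eqI; simp add: one_notin mult_notin algebra_simps)?)+)
  show "comm_monoid L"
    by (rule comm_monoidI) (((elim carrier_LE)?; simp add: zero_L one_L one_notin mult_notin; (rule frac_eqI; simp add: one_notin mult_notin algebra_simps)?)+)
qed (((elim carrier_LE)?; simp add: zero_L one_L one_notin mult_notin; (rule frac_eqI; simp add: one_notin mult_notin algebra_simps)?)+)

lemma ideal_fractions:
  assumes J: "idl.subspace J"
  shows "ideal {fr a s | a s. a \<in> J \<and> s \<notin> P} L"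
proof (rule cring.ideal_of_closed[OF cring_L])
  show "{fr a s | a s. a \<in> J \<and> s \<notin> P} \<subseteq> carrier L" by auto
  show "\<zero>\<^bsub>L\<^esub> \<in> {fr a s | a s. a \<in> J \<and> s \<notin> P}"
    unfolding zero_L using idl.subspace_0[OF J] one_notin by blast
next
  fix x y assume "x \<in> {fr a s | a s. a \<in> J \<and> s \<notin> P}" "y \<in> {fr a s | a s. a \<in> J \<and> s \<notin> P}"
  then obtain a s b t where *: "x = fr a s" "y = fr b t" "a \<in> J" "b \<in> J" "s \<notin> P" "t \<notin> P" by blast
  have "a * t + b * s \<in> J" by (rule idl.subspace_add[OF J ideal_mult(2)[OF J *(3)] ideal_mult(2)[OF J *(4)]])
  then show "x \<oplus>\<^bsub>L\<^esub> y \<in> {fr a s | a s. a \<in> J \<and> s \<notin> P}"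
    unfolding *(1,2) add_frac[OF *(5,6)] using mult_notin[OF *(5,6)] by blast
next
  fix x y assume "x \<in> {fr a s | a s. a \<in> J \<and> s \<notin> P}" "y \<in> carrier L"
  then obtain a s b t where *: "x = fr a s" "y = fr b t" "a \<in> J" "s \<notin> P" "t \<notin> P"
    by (auto simp: carrier_L)
  have "b * a \<in> J" by (rule ideal_mult(1)[OF J *(3)])
  then show "y \<otimes>\<^bsub>L\<^esub> x \<in> {fr a s | a s. a \<in> J \<and> s \<notin> P}"
    unfolding *(1,2) mult_frac[OF *(5,4)] using mult_notin[OF *(5,4)] by blast
qed

lemma localized_ideal_subset:
  assumes "idl.subspace J"
  shows "localized_ideal tr P J \<subseteq> {fr a s | a s. a \<in> J \<and> s \<notin> P}"
  unfolding localized_ideal_def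
proof (rule ring.genideal_minimal[OF cring.axioms(1)[OF cring_L] ideal_fractions[OF assms]])
  show "(\<lambda>a. loc_frac tr P a \<one>\<^bsub>tr\<^esub>) ` J \<subseteq> {fr a s | a s. a \<in> J \<and> s \<notin> P}"
    using one_notin by auto
qed

definition "P_L = {fr a s | a s. a \<in> P \<and> s \<notin> P}"

lemma frac_in_P_L: "s \<notin> P \<Longrightarrow> fr a s \<in> P_L \<longleftrightarrow> a \<in> P"
proof
  note sP = prime_idealD(1)[OF prime]
  assume s: "s \<notin> P" and "fr a s \<in> P_L"
  then obtain b t where b: "b \<in> P" "t \<notin> P" "fr a s = fr b t" by (auto simp: P_L_def)
  then obtain u where u: "u \<notin> P" "u * (a * t - b * s) = 0" using s by (auto simp: frac_eq_iff)
  have "a * t - b * s \<in> P" using u prime_idealD(3)[OF prime, of u] idl.subspace_0[OF sP] by auto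
  then have "(a * t - b * s) + b * s \<in> P" by (intro idl.subspace_add[OF sP] ideal_mult(2)[OF sP b(1)])
  then show "a \<in> P" using prime_idealD(3)[OF prime, of a t] b(2) by simp
qed (auto simp: P_L_def)

lemma primeideal_P_L: "primeideal P_L L"
proof (rule primeidealI[OF _ cring_L])
  show "ideal P_L L" unfolding P_L_def by (rule ideal_fractions[OF prime_idealD(1)[OF prime]])
  have "fr 1 1 \<notin> P_L" using frac_in_P_L[OF one_notin, of 1] one_notin by simp
  then show "carrier L \<noteq> P_L" using frac_in[OF one_notin, of 1] by blast
  fix x y assume "x \<in> carrier L" "y \<in> carrier L" "x \<otimes>\<^bsub>L\<^esub> y \<in> P_L"
  then show "x \<in> P_L \<or> y \<in> P_L"
    by (auto simp: carrier_L frac_in_P_L mult_notin dest: prime_idealD(3)[OF prime])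
qed

definition "contr Q = {r. fr r 1 \<in> Q}"

lemma frac_in_primeideal:
  assumes "primeideal Q L" "s \<notin> P"
  shows "fr a s \<in> Q \<longleftrightarrow> a \<in> contr Q"
proof -
  interpret Q: primeideal Q L by (rule assms(1))
  have "fr a s = fr a 1 \<otimes>\<^bsub>L\<^esub> fr 1 s" using assms(2) one_notin by simp
  moreover have "fr a s \<otimes>\<^bsub>L\<^esub> fr s 1 = fr (a * s) s" using assms(2) one_notin by simp
  moreover have "fr a 1 = fr (a * s) s" by (rule frac_eqI) (use assms(2) one_notin in auto)
  ultimately show ?thesis
    unfolding contr_def using Q.I_r_closed frac_in[OF assms(2)] frac_in[OF one_notin]
    by (metis mem_Collect_eq)
qed

lemma prime_contr:
  assumes "primeideal Q L"
  shows "prime_ideal (contr Q)"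
proof -
  interpret Q: primeideal Q L by (rule assms)
  note mem = frac_in_primeideal[OF assms]
  have add: "fr a 1 \<oplus>\<^bsub>L\<^esub> fr b 1 = fr (a + b) 1" and mult: "fr a 1 \<otimes>\<^bsub>L\<^esub> fr b 1 = fr (a * b) 1" for a b
    using one_notin by simp_all
  have m: "fr a 1 \<in> Q \<longleftrightarrow> a \<in> contr Q" for a by (simp add: contr_def)
  show ?thesis
    unfolding prime_ideal_def
  proof (intro conjI allI impI)
    show "idl.subspace (contr Q)"
    proof (rule idl.subspaceI)
      show "0 \<in> contr Q" using additive_subgroup.zero_closed[OF ideal.axioms(1)[OF Q.ideal_axioms]]
        by (simp add: contr_def zero_L)
      show "x + y \<in> contr Q" if "x \<in> contr Q" "y \<in> contr Q" for x y
        using additive_subgroup.a_closed[OF ideal.axioms(1)[OF Q.ideal_axioms], of "fr x 1" "fr y 1"] that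
        by (simp add: add m)
      show "c * x \<in> contr Q" if "x \<in> contr Q" for c x
        using Q.I_l_closed[of "fr x 1" "fr c 1"] that one_notin by (simp add: m)
    qed
    show "1 \<notin> contr Q" using Q.one_imp_carrier Q.I_notcarr by (auto simp: contr_def one_L)
    fix a b assume "a * b \<in> contr Q"
    then show "a \<in> contr Q \<or> b \<in> contr Q"
      using Q.I_prime[of "fr a 1" "fr b 1"] one_notin by (simp add: m)
  qed
qed

text \<open>Contraction turns chains of primes below \<open>P_L\<close> into chains below
  \<open>P\<close>; inclusions stay strict because membership of a fraction in a prime depends on
  its numerator alone.\<close>

lemma prime_height_P_L:
  assumes "\<not> height_ge P (Suc h)"
  shows "prime_height L P_L \<le> enat h"
  unfolding prime_height_def
proof (rule SUP_least, clarify)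
  fix k and C :: "nat \<Rightarrow> ('a \<times> 'a) set set"
  assume C: "\<forall>i\<le>k. primeideal (C i) L" "\<forall>i<k. C i \<subset> C (Suc i)" "C k = P_L"
  have "height_ge P k"
    unfolding height_ge_def
  proof (rule exI[of _ "\<lambda>i. contr (C i)"], intro conjI allI impI)
    show "prime_ideal (contr (C i))" if "i \<le> k" for i using C(1) that prime_contr by blast
    show "contr (C k) = P" using frac_in_P_L[OF one_notin] by (auto simp: C(3) contr_def)
    show "contr (C i) \<subset> contr (C (Suc i))" if i: "i < k" for i
    proof -
      have p: "primeideal (C i) L" "primeideal (C (Suc i)) L" using C(1) i by auto
      obtain x where x: "x \<in> C (Suc i)" "x \<notin> C i" using C(2) i by blast
      have "C (Suc i) \<subseteq> carrier L" using p(2) by (simp add: primeideal_def ideal_def additive_subgroup.a_subset)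
      then obtain a s where a: "s \<notin> P" "x = fr a s" using x(1) carrier_L by blast
      then have "a \<in> contr (C (Suc i))" "a \<notin> contr (C i)" using x frac_in_primeideal p by auto
      moreover have "contr (C i) \<subseteq> contr (C (Suc i))" using C(2) i by (auto simp: contr_def)
      ultimately show ?thesis by blast
    qed
  qed
  then have "\<not> Suc h \<le> k" using height_ge_antimono assms by blast
  then show "enat k \<le> enat h" by simp
qed

text \<open>The height of the localized ideal is at most that of \<open>P_L\<close>, hence at most
  \<open>h\<close>, and so is its number of generators. Their numerators generate as well, since
  denominators are units.\<close>

lemma local_generators_of_min_gens:
  assumes I: "idl.subspace I" "I \<subseteq> P" and ht: "\<not> height_ge P (Suc h)"
    and eq: "min_gens L (localized_ideal tr P I) = ideal_height L (localized_ideal tr P I)"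
  shows "\<exists>b. finite b \<and> card b \<le> h \<and> b \<subseteq> I \<and> I \<subseteq> loc_contr P (idl.span b)"
proof -
  interpret L: cring L by (rule cring_L)
  have "localized_ideal tr P I \<subseteq> P_L" using localized_ideal_subset[OF I(1)] I(2) by (auto simp: P_L_def)
  then have "ideal_height L (localized_ideal tr P I) \<le> prime_height L P_L"
    unfolding ideal_height_def using primeideal_P_L by (intro INF_lower) auto
  also have "\<dots> \<le> enat h" by (rule prime_height_P_L[OF ht])
  finally have "min_gens L (localized_ideal tr P I) \<le> enat h" by (simp add: eq)
  from INF_le_enatD[OF this[unfolded min_gens_def]]
  obtain B where B: "finite B" "B \<subseteq> carrier L" "localized_ideal tr P I = Idl\<^bsub>L\<^esub> B" "card B \<le> h"
    by auto
  have "B \<subseteq> {fr a s | a s. a \<in> I \<and> s \<notin> P}"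
    using L.genideal_self[OF B(2)] B(3) localized_ideal_subset[OF I(1)] by blast
  then have "\<forall>x\<in>B. \<exists>a. a \<in> I \<and> (\<exists>s. s \<notin> P \<and> x = fr a s)" by blast
  then obtain g where g: "\<And>x. x \<in> B \<Longrightarrow> g x \<in> I" "\<And>x. x \<in> B \<Longrightarrow> \<exists>s. s \<notin> P \<and> x = fr (g x) s" by metis
  let ?b = "g ` B"
  have sub: "localized_ideal tr P I \<subseteq> {fr a s | a s. a \<in> idl.span ?b \<and> s \<notin> P}"
    unfolding B(3)
  proof (rule L.genideal_minimal[OF ideal_fractions[OF idl.subspace_span]])
    show "B \<subseteq> {fr a s | a s. a \<in> idl.span ?b \<and> s \<notin> P}"
    proof
      fix x assume x: "x \<in> B"
      then obtain s where "s \<notin> P" "x = fr (g x) s" using g(2) by blast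
      moreover have "g x \<in> idl.span ?b" using x by (intro idl.span_base) blast
      ultimately show "x \<in> {fr a s | a s. a \<in> idl.span ?b \<and> s \<notin> P}" by blast
    qed
  qed
  have "a \<in> loc_contr P (idl.span ?b)" if a: "a \<in> I" for a
  proof -
    have "(\<lambda>a. fr a 1) ` I \<subseteq> carrier L" using one_notin by auto
    from L.genideal_self[OF this] have "fr a 1 \<in> localized_ideal tr P I"
      using a by (auto simp: localized_ideal_def)
    then obtain c s where c: "fr a 1 = fr c s" "c \<in> idl.span ?b" "s \<notin> P" using sub by blast
    then obtain u where u: "u \<notin> P" "u * (a * s - c * 1) = 0" using one_notin by (auto simp: frac_eq_iff)
    then have "(u * s) * a = u * c" by (simp add: algebra_simps)
    then have "(u * s) * a \<in> idl.span ?b" using idl.span_scale[OF c(2), of u] by simp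
    then show ?thesis by (rule loc_contrI[OF mult_notin[OF u(1) c(3)]])
  qed
  then have "I \<subseteq> loc_contr P (idl.span ?b)" by blast
  moreover have "card ?b \<le> h" using card_image_le[OF B(1), of g] B(4) by simp
  ultimately show ?thesis using B(1) g(1) by (intro exI[of _ ?b]) auto
qed

end

section \<open>Almost complete intersections\<close>

instance xy_var :: (finite) finite
proof
  have "(UNIV :: 'a xy_var set) \<subseteq> XVar ` UNIV \<union> YVar ` UNIV"
  proof
    fix z :: "'a xy_var"
    show "z \<in> XVar ` UNIV \<union> YVar ` UNIV" by (cases z) auto
  qed
  then show "finite (UNIV :: 'a xy_var set)" by (rule finite_subset) simp
qed

lemma homogeneous_iff_homog: "homogeneous p \<longleftrightarrow> (\<exists>d. homog d p)"
  by (simp add: homogeneous_def homog_def mdeg_def)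

section \<open>Ideals generated in a single degree\<close>

lemma hcomp_span_low_degree:
  assumes "\<And>g. g \<in> G \<Longrightarrow> homog d g" "p \<in> idl.span G" "e < d"
  shows "hcomp e p = 0"
  using assms(2)
proof (induction rule: idl.span_induct_alt)
  case (step c x y)
  then show ?case using hcomp_mult_hom[OF assms(1)[OF step(1)], of e c] assms(3) by (simp add: hcomp_add)
qed simp

text \<open>Only the component of degree \<open>d\<close> matters in an expression of
  \<open>g\<close> by \<open>B\<close>. Generators of larger degree do not contribute to it, and
  those of smaller degree are \<open>0\<close> because the ideal has no other elements
  there.\<close>

lemma span_top_degree_generators:
  assumes G: "\<And>g. g \<in> G \<Longrightarrow> homog d g" and B: "finite B" "\<And>b. b \<in> B \<Longrightarrow> \<exists>e. homog e b" "idl.span B = idl.span G"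
  shows "idl.span {b\<in>B. homog d b} = idl.span G"
proof
  let ?B = "{b\<in>B. homog d b}"
  show "idl.span ?B \<subseteq> idl.span G" unfolding B(3)[symmetric] by (rule idl.span_mono) blast
  have "g \<in> idl.span ?B" if g: "g \<in> G" for g
  proof -
    have "g \<in> idl.span B" using g B(3) idl.span_base by blast
    then obtain c where c: "g = (\<Sum>b\<in>B. c b * b)" unfolding idl.span_finite[OF B(1)] by blast
    have "g = hcomp d g" using hcomp_hom[OF G[OF g]] by simp
    also have "\<dots> = (\<Sum>b\<in>B. hcomp d (c b * b))" unfolding c by (rule hcomp_sum)
    also have "\<dots> \<in> idl.span ?B"
    proof (rule idl.span_sum)
      fix b assume b: "b \<in> B"
      obtain e where e: "homog e b" using B(2)[OF b] by blast
      show "hcomp d (c b * b) \<in> idl.span ?B"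
      proof (cases "e = d")
        case True
        then have "b \<in> ?B" using b e by blast
        then show ?thesis unfolding hcomp_mult_hom[OF e] using True by (simp add: idl.span_scale idl.span_base)
      next
        case False
        have "b = 0" if "e < d"
        proof -
          have "b \<in> idl.span G" using b B(3) idl.span_base by blast
          then have "hcomp e b = 0" using hcomp_span_low_degree[OF G _ that] by blast
          then show ?thesis using hcomp_hom[OF e, of e] by simp
        qed
        then have "hcomp d (c b * b) = 0" using False unfolding hcomp_mult_hom[OF e] by auto
        then show ?thesis by (simp add: idl.span_zero)
      qed
    qed
    finally show ?thesis .
  qed
  then show "idl.span G \<subseteq> idl.span ?B" by (intro idl.span_minimal idl.subspace_span) blast
qed

text \<open>Keeps the infimum in \<open>homogeneous_min_gens\<close> finite, and with it the
  height.\<close>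

lemma exists_minimal_homogeneous_generating_set:
  assumes "finite G" "\<And>g. g \<in> G \<Longrightarrow> homogeneous g"
  shows "\<exists>B. minimal_homogeneous_generating_set (idl.span G) B"
proof -
  let ?A = "{B \<in> Pow G. idl.span B = idl.span G}"
  have "finite ?A" "?A \<noteq> {}" using assms(1) by auto
  from finite_has_minimal[OF this] obtain B where B: "B \<subseteq> G" "idl.span B = idl.span G"
    "\<forall>B'\<in>?A. B' \<subseteq> B \<longrightarrow> B = B'" by auto
  have "idl.span B' \<noteq> idl.span G" if "B' \<subset> B" for B'
  proof
    assume "idl.span B' = idl.span G"
    then have "B' \<in> ?A" using that B(1) by auto
    then show False using B(3) that by blast
  qed
  then show ?thesis
    unfolding minimal_homogeneous_generating_set_def genideal_tr
    using B(1,2) assms by (intro exI[of _ B]) (auto intro: finite_subset)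
qed

lemma generic_generators_of_aci:
  fixes G :: "('v::finite, 'k::field) xy_poly set"
  assumes K: "infinite (UNIV :: 'k set)" and G: "finite G" "\<And>g. g \<in> G \<Longrightarrow> homog (Suc d) g"
    and aci: "almost_complete_intersection (idl.span G)"
  shows "\<exists>B h. idl.span B = idl.span G \<and> generic_generators B h d"
proof -
  let ?I = "idl.span G"
  have mu: "homogeneous_min_gens ?I = ideal_height tr ?I + 1"
    and ci: "\<And>P. minimal_prime tr ?I P \<Longrightarrow> min_gens (localization tr P) (localized_ideal tr P ?I) =
        ideal_height (localization tr P) (localized_ideal tr P ?I)"
    using aci by (auto simp: almost_complete_intersection_def)
  obtain B0 where "minimal_homogeneous_generating_set ?I B0"
    using exists_minimal_homogeneous_generating_set[OF G(1)] G(2) homogeneous_iff_homog by blast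
  then have "homogeneous_min_gens ?I \<le> enat (card B0)"
    unfolding homogeneous_min_gens_def by (intro INF_lower) simp
  then obtain h where h: "ideal_height tr ?I = enat h"
    unfolding mu by (cases "ideal_height tr ?I") auto
  then have "homogeneous_min_gens ?I \<le> enat (Suc h)" unfolding mu by (simp add: one_enat_def)
  from INF_le_enatD[OF this[unfolded homogeneous_min_gens_def]]
  obtain B where B: "minimal_homogeneous_generating_set ?I B" "card B \<le> Suc h" by auto
  then have B': "finite B" "\<And>b. b \<in> B \<Longrightarrow> \<exists>e. homog e b" "idl.span B = ?I"
    by (auto simp: minimal_homogeneous_generating_set_def genideal_tr homogeneous_iff_homog)
  define B2 where "B2 = {b\<in>B. homog (Suc d) b}"
  have span: "idl.span B2 = ?I"
    unfolding B2_def by (rule span_top_degree_generators[OF G(2) B'(1,2,3)])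
  have sub: "B2 \<subseteq> P \<longleftrightarrow> ?I \<subseteq> P" if "prime_ideal P" for P
    unfolding span[symmetric] using idl.span_superset[of B2] idl.span_minimal[of B2 P] prime_idealD(1)[OF that] by blast
  have height: "height_ge P h" if P: "prime_ideal P" "?I \<subseteq> P" for P
  proof (rule height_ge_of_prime_height[OF P(1)])
    have "ideal_height tr ?I \<le> prime_height tr P"
      unfolding ideal_height_def by (rule INF_lower) (use P in \<open>auto simp: primeideal_tr_iff\<close>)
    then show "enat h \<le> prime_height tr P" by (simp add: h)
  qed
  have "generic_generators B2 h d"
  proof
    show "infinite (UNIV :: 'k set)" by (rule K)
    show "finite B2" using B'(1) by (simp add: B2_def)
    show "card B2 \<le> Suc h"
      using card_mono[OF B'(1), of B2] B(2) by (auto simp: B2_def)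
    show "homog (Suc d) b" if "b \<in> B2" for b using that by (simp add: B2_def)
    show "height_ge P h" if "prime_ideal P" "B2 \<subseteq> P" for P using height that sub by blast
    fix P assume P: "prime_ideal P" "B2 \<subseteq> P" "\<not> height_ge P (Suc h)"
    interpret localization_at_prime P by standard (rule P(1))
    have IP: "?I \<subseteq> P" using P sub by blast
    \<comment> \<open>A prime over \<open>?I\<close> strictly inside \<open>P\<close> has height at
      least \<open>h\<close> and would raise the height of \<open>P\<close> to
      \<open>h + 1\<close>.\<close>
    have "minimal_prime tr ?I P"
      unfolding minimal_prime_def primeideal_tr_iff
    proof (intro conjI allI impI)
      fix Q assume Q: "prime_ideal Q \<and> ?I \<subseteq> Q \<and> Q \<subseteq> P"
      show "Q = P"
      proof (rule ccontr)
        assume "Q \<noteq> P"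
        then have "height_ge P (Suc h)" using height_ge_Suc[OF height P(1), of Q] Q by blast
        then show False using P(3) by blast
      qed
    qed (use P(1) IP in auto)
    from local_generators_of_min_gens[OF idl.subspace_span IP P(3) ci[OF this]]
    show "\<exists>b. finite b \<and> card b \<le> h \<and> b \<subseteq> idl.span B2 \<and> idl.span B2 \<subseteq> loc_contr P (idl.span b)"
      unfolding span .
  qed
  then show ?thesis using span by blast
qed

section \<open>d-sequences from regular sequences\<close>

lemma span_insert_zero: "idl.span (insert 0 S) = idl.span S"
  by (auto simp: idl.span_breakdown_eq)

text \<open>For \<open>i\<close> in the regular part, the entry at \<open>i\<close> itself cancels;
  the only other pair is \<open>i = j = length fs\<close>, where the hypothesis on \<open>f\<close>
  applies.\<close>

lemma d_sequence_of_reg: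
  assumes reg: "reg {} fs" and f: "\<And>r. r * f * f \<in> idl.span (set fs) \<Longrightarrow> r * f \<in> idl.span (set fs)"
  shows "d_sequence tr (fs @ [f])"
  unfolding d_sequence_def tr_simps(4) genideal_tr span_insert_zero
proof (intro conjI allI impI)
  fix i j assume i: "i < length (fs @ [f])" and j: "i \<le> j \<and> j < length (fs @ [f])"
  let ?J = "idl.span (set (take i (fs @ [f])))"
  have "r * ((fs @ [f]) ! i * (fs @ [f]) ! j) \<in> ?J \<longleftrightarrow> r * (fs @ [f]) ! j \<in> ?J" for r
  proof
    assume "r * (fs @ [f]) ! j \<in> ?J"
    then have "(fs @ [f]) ! i * (r * (fs @ [f]) ! j) \<in> ?J" by (rule idl.span_scale)
    then show "r * ((fs @ [f]) ! i * (fs @ [f]) ! j) \<in> ?J" by (simp only: mult.left_commute)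
  next
    assume *: "r * ((fs @ [f]) ! i * (fs @ [f]) ! j) \<in> ?J"
    show "r * (fs @ [f]) ! j \<in> ?J"
    proof (cases "i < length fs")
      case True
      then have "nzd ?J ((fs @ [f]) ! i)" using reg_nth[OF reg True] by (simp add: nth_append)
      moreover have "(r * (fs @ [f]) ! j) * (fs @ [f]) ! i \<in> ?J" using * by (simp only: ac_simps)
      ultimately show ?thesis unfolding nzd_def by blast
    next
      case False
      then have "i = length fs" "j = length fs" using i j by auto
      then show ?thesis using * f[of r] by (simp add: mult.assoc)
    qed
  qed
  then show "colon tr ?J ((fs @ [f]) ! i \<otimes>\<^bsub>tr\<^esub> (fs @ [f]) ! j) = colon tr ?J ((fs @ [f]) ! j)"
    by (simp add: colon_def)
qed simp

text \<open>At the last index, \<open>x = k f\<close> modulo the ideal of \<open>fs\<close>, so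
  \<open>x f\<close> in that ideal gives \<open>k f f\<close>, then \<open>k f\<close>, then
  \<open>x\<close> in it.\<close>

lemma colon_inter_of_reg:
  assumes reg: "reg {} fs" and f: "\<And>r. r * f * f \<in> idl.span (set fs) \<Longrightarrow> r * f \<in> idl.span (set fs)"
    and i: "i < length (fs @ [f])" and x: "x \<in> idl.span (set (fs @ [f]))"
    and xi: "x * (fs @ [f]) ! i \<in> idl.span (set (take i (fs @ [f])))"
  shows "x \<in> idl.span (set (take i (fs @ [f])))"
proof (cases "i < length fs")
  case True
  then show ?thesis using reg_nth[OF reg True] xi by (simp add: nth_append nzd_def)
next
  case False
  then have i: "i = length fs" using i by simp
  let ?J = "idl.span (set fs)"
  obtain k where k: "x - k * f \<in> ?J" using x by (auto simp: idl.span_breakdown_eq)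
  have xf: "x * f \<in> ?J" using xi i by simp
  have "x * f - f * (x - k * f) \<in> ?J" by (rule idl.span_diff[OF xf idl.span_scale[OF k]])
  then have "k * f * f \<in> ?J" by (simp add: algebra_simps)
  then have "k * f \<in> ?J" by (rule f)
  with k have "(x - k * f) + k * f \<in> ?J" by (rule idl.span_add)
  then show ?thesis using i by simp
qed

section \<open>Evaluation of polynomials in the Rees algebra\<close>

definition mval :: "('a::comm_ring_1 \<Rightarrow>\<^sub>0 nat) \<Rightarrow> 'a" where
  "mval m = (\<Prod>a\<in>Poly_Mapping.keys m. a ^ Poly_Mapping.lookup m a)"

text \<open>The substitution of \<open>a\<close> for the variable of \<open>a\<close>, obtained by
  setting \<open>t = 1\<close>; on homogeneous polynomials no information is lost, since the degree
  determines the power of \<open>t\<close>.\<close>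

definition peval :: "(('a::comm_ring_1 \<Rightarrow>\<^sub>0 nat) \<Rightarrow>\<^sub>0 'a) \<Rightarrow> 'a" where
  "peval p = poly (rees_eval p) 1"

lemma mval_zero [simp]: "mval 0 = 1"
  by (simp add: mval_def)

lemma mval_add: "mval (m + n) = mval m * mval n"
proof -
  let ?A = "Poly_Mapping.keys m \<union> Poly_Mapping.keys n"
  have *: "mval l = (\<Prod>a\<in>?A. a ^ Poly_Mapping.lookup l a)" if "Poly_Mapping.keys l \<subseteq> ?A" for l
    unfolding mval_def by (rule prod.mono_neutral_left) (use that in \<open>auto simp: in_keys_iff\<close>)
  show ?thesis using *[of m] *[of n] *[of "m + n"] keys_add[of m n]
    by (simp add: lookup_add power_add prod.distrib)
qed

text \<open>Summation over any finite superset of the keys gives two polynomials a common index set,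
  from which additivity follows.\<close>

lemma rees_eval_superset:
  assumes "finite F" "Poly_Mapping.keys p \<subseteq> F"
  shows "rees_eval p = (\<Sum>m\<in>F. monom (Poly_Mapping.lookup p m * mval m) (mdeg m))"
proof -
  have "(\<Prod>a\<in>A. monom a 1 ^ e a) = monom (\<Prod>a\<in>A. a ^ e a) (\<Sum>a\<in>A. e a)"
    for A :: "'a set" and e
    by (induction A rule: infinite_finite_induct) (simp_all add: monom_power mult_monom)
  then have "rees_eval p = (\<Sum>m\<in>Poly_Mapping.keys p. monom (Poly_Mapping.lookup p m * mval m) (mdeg m))"
    by (simp add: rees_eval_def mval_def mdeg_def smult_monom)
  also have "\<dots> = (\<Sum>m\<in>F. monom (Poly_Mapping.lookup p m * mval m) (mdeg m))"
    by (rule sum.mono_neutral_left) (use assms in \<open>auto simp: in_keys_iff\<close>)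
  finally show ?thesis .
qed

lemma rees_eval_add: "rees_eval (p + q) = rees_eval p + rees_eval q"
proof -
  let ?F = "Poly_Mapping.keys p \<union> Poly_Mapping.keys q"
  show ?thesis
    using rees_eval_superset[of ?F p] rees_eval_superset[of ?F q] rees_eval_superset[of ?F "p + q"] keys_add[of p q]
    by (simp add: lookup_add distrib_right add_monom[symmetric] sum.distrib)
qed

lemma rees_eval_zero [simp]: "rees_eval 0 = 0"
  by (simp add: rees_eval_def)

lemma rees_eval_diff: "rees_eval (p - q) = rees_eval p - rees_eval q"
  using rees_eval_add[of "p - q" q] by simp

lemma rees_eval_sum: "rees_eval (sum f A) = (\<Sum>a\<in>A. rees_eval (f a))"
  by (induction A rule: infinite_finite_induct) (simp_all add: rees_eval_add)

lemma rees_eval_single: "rees_eval (Poly_Mapping.single m c) = monom (c * mval m) (mdeg m)"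
  using rees_eval_superset[of "{m}" "Poly_Mapping.single m c"] by simp

lemma rees_eval_mult: "rees_eval (p * q) = rees_eval p * rees_eval q"
proof -
  let ?s = "\<lambda>p m. Poly_Mapping.single m (Poly_Mapping.lookup p m)"
  have "p * q = (\<Sum>m\<in>Poly_Mapping.keys p. ?s p m) * (\<Sum>n\<in>Poly_Mapping.keys q. ?s q n)"
    using poly_mapping_sum_single[of p] poly_mapping_sum_single[of q] by simp
  also have "rees_eval \<dots> = (\<Sum>m\<in>Poly_Mapping.keys p. rees_eval (?s p m)) * (\<Sum>n\<in>Poly_Mapping.keys q. rees_eval (?s q n))"
    unfolding sum_product rees_eval_sum
    by (intro sum.cong refl) (simp add: mult_single rees_eval_single mult_monom mval_add mdeg_add ac_simps)
  also have "\<dots> = rees_eval p * rees_eval q"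
    using poly_mapping_sum_single[of p] poly_mapping_sum_single[of q] by (simp flip: rees_eval_sum)
  finally show ?thesis .
qed

lemma rees_eval_homog:
  assumes "homog k p"
  shows "rees_eval p = monom (peval p) k"
proof -
  have "rees_eval p = (\<Sum>m\<in>Poly_Mapping.keys p. monom (Poly_Mapping.lookup p m * mval m) (mdeg m))"
    by (rule rees_eval_superset) auto
  also have "\<dots> = (\<Sum>m\<in>Poly_Mapping.keys p. monom (Poly_Mapping.lookup p m * mval m) k)"
    by (rule sum.cong) (use assms in \<open>auto simp: homog_def\<close>)
  also have "\<dots> = monom (\<Sum>m\<in>Poly_Mapping.keys p. Poly_Mapping.lookup p m * mval m) k"
    by (simp add: monom_sum)
  finally show ?thesis by (simp add: peval_def poly_monom)
qed

lemma peval_simps: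
  "peval (p + q) = peval p + peval q" "peval (p - q) = peval p - peval q" "peval (p * q) = peval p * peval q"
  "peval 0 = 0" "peval (sum f A) = (\<Sum>a\<in>A. peval (f a))"
  "peval (Poly_Mapping.single m c) = c * mval m" "peval (sym_var a) = a" "peval (Poly_Mapping.single 0 c) = c"
  by (simp_all add: peval_def rees_eval_add rees_eval_diff rees_eval_mult rees_eval_sum rees_eval_single poly_monom
      poly_sum sym_var_def mval_def)

lemma homog_sym_var: "homog 1 (sym_var a)"
  by (simp add: homog_def sym_var_def mdeg_def)

lemma homog_const: "homog 0 (Poly_Mapping.single 0 c)"
  by (simp add: homog_def mdeg_def)

lemma homog_add: "homog k p \<Longrightarrow> homog k q \<Longrightarrow> homog k (p + q)"
  using keys_add[of p q] by (auto simp: homog_def)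

lemma homog_diff: "homog k p \<Longrightarrow> homog k q \<Longrightarrow> homog k (p - q)"
  by (auto simp: homog_def in_keys_iff lookup_minus)

lemma homog_zero: "homog k 0"
  by (simp add: homog_def)

lemma homog_sum: "(\<And>a. a \<in> A \<Longrightarrow> homog k (f a)) \<Longrightarrow> homog k (sum f A)"
  by (induction A rule: infinite_finite_induct) (simp_all add: homog_add homog_zero)

lemma homog_zero_degree:
  assumes "homog 0 p"
  shows "p = Poly_Mapping.single 0 (peval p)"
proof -
  have m: "m = 0" if "mdeg m = 0" for m :: "'a \<Rightarrow>\<^sub>0 nat"
    using that by (intro poly_mapping_eqI) (auto simp: mdeg_def in_keys_iff)
  have "p = Poly_Mapping.single 0 (Poly_Mapping.lookup p 0)"
  proof (rule poly_mapping_eqI)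
    fix m
    show "Poly_Mapping.lookup p m = Poly_Mapping.lookup (Poly_Mapping.single 0 (Poly_Mapping.lookup p 0)) m"
    proof (cases "m = 0")
      case False
      then have "m \<notin> Poly_Mapping.keys p" using m[of m] assms by (auto simp: homog_def)
      then show ?thesis using False by (simp add: lookup_single in_keys_iff)
    qed simp
  qed
  then show ?thesis by (metis peval_simps(8))
qed

section \<open>The symmetric algebra\<close>

lemma cring_subring:
  assumes "subring_set A"
  shows "cring (ring_of_type_algebra \<lparr>carrier := A\<rparr>)"
proof -
  note D = subring_setD[OF assms]
  show ?thesis
  proof (rule cringI)
    show "abelian_group (ring_of_type_algebra \<lparr>carrier := A\<rparr>)"
    proof (rule abelian_groupI)
      fix x assume "x \<in> carrier (ring_of_type_algebra \<lparr>carrier := A\<rparr>)"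
      then show "\<exists>y\<in>carrier (ring_of_type_algebra \<lparr>carrier := A\<rparr>).
          y \<oplus>\<^bsub>ring_of_type_algebra \<lparr>carrier := A\<rparr>\<^esub> x = \<zero>\<^bsub>ring_of_type_algebra \<lparr>carrier := A\<rparr>\<^esub>"
        using D(6) by (intro bexI[of _ "- x"]) simp_all
    qed (use D in \<open>simp_all add: ac_simps\<close>)
    show "comm_monoid (ring_of_type_algebra \<lparr>carrier := A\<rparr>)"
      by (rule comm_monoidI) (use D in \<open>simp_all add: ac_simps\<close>)
  qed (simp add: distrib_right)
qed

definition sym_carrier :: "'a::comm_ring_1 set \<Rightarrow> (('a \<Rightarrow>\<^sub>0 nat) \<Rightarrow>\<^sub>0 'a) set" where
  "sym_carrier I = {p. \<forall>m\<in>Poly_Mapping.keys p. Poly_Mapping.keys m \<subseteq> I}"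

definition sym_ideal :: "'a::comm_ring_1 set \<Rightarrow> (('a \<Rightarrow>\<^sub>0 nat) \<Rightarrow>\<^sub>0 'a) set" where
  "sym_ideal I = Idl\<^bsub>sym_free I\<^esub> (sym_rels I)"

lemma sym_free_eq: "sym_free I = ring_of_type_algebra \<lparr>carrier := sym_carrier I\<rparr>"
  by (simp add: sym_free_def sym_carrier_def)

lemma subring_sym_carrier: "subring_set (sym_carrier I)"
  unfolding subring_set_def
proof (intro conjI ballI)
  show "1 \<in> sym_carrier I" by (simp add: sym_carrier_def)
  fix p q assume pq: "p \<in> sym_carrier I" "q \<in> sym_carrier I"
  show "p - q \<in> sym_carrier I"
    unfolding sym_carrier_def
  proof (intro CollectI ballI)
    fix m assume "m \<in> Poly_Mapping.keys (p - q)"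
    then have "m \<in> Poly_Mapping.keys p \<or> m \<in> Poly_Mapping.keys q" by (auto simp: in_keys_iff lookup_minus)
    then show "Poly_Mapping.keys m \<subseteq> I" using pq by (auto simp: sym_carrier_def)
  qed
  show "p * q \<in> sym_carrier I"
    unfolding sym_carrier_def
  proof (intro CollectI ballI)
    fix m assume "m \<in> Poly_Mapping.keys (p * q)"
    then obtain a b where ab: "m = a + b" "a \<in> Poly_Mapping.keys p" "b \<in> Poly_Mapping.keys q"
      using keys_mult[of p q] by blast
    then have "Poly_Mapping.keys a \<subseteq> I" "Poly_Mapping.keys b \<subseteq> I" using pq by (auto simp: sym_carrier_def)
    then show "Poly_Mapping.keys m \<subseteq> I" using keys_add[of a b] unfolding ab(1) by blast
  qed
qed

lemmas sym_carrier_closed = subring_setD[OF subring_sym_carrier]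

lemma sym_var_carrier: "a \<in> I \<Longrightarrow> sym_var a \<in> sym_carrier I"
  by (simp add: sym_carrier_def sym_var_def)

lemma const_carrier: "Poly_Mapping.single 0 c \<in> sym_carrier I"
  by (simp add: sym_carrier_def)

lemma cring_sym_free: "cring (sym_free I)"
  unfolding sym_free_eq by (rule cring_subring[OF subring_sym_carrier])

lemma sym_free_simps [simp]:
  "carrier (sym_free I) = sym_carrier I" "x \<otimes>\<^bsub>sym_free I\<^esub> y = x * y" "x \<oplus>\<^bsub>sym_free I\<^esub> y = x + y"
  "\<zero>\<^bsub>sym_free I\<^esub> = 0" "\<one>\<^bsub>sym_free I\<^esub> = 1"
  by (simp_all add: sym_free_eq)

lemma sym_rels_carrier:
  assumes "idl.subspace I"
  shows "sym_rels I \<subseteq> sym_carrier I"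
  unfolding sym_rels_def
  using idl.subspace_add[OF assms] ideal_mult(1)[OF assms]
  by (auto intro!: sym_carrier_closed(4,5) sym_var_carrier const_carrier)

lemma sym_ideal_facts:
  assumes "idl.subspace I"
  shows "ideal (sym_ideal I) (sym_free I)" "sym_rels I \<subseteq> sym_ideal I" "sym_ideal I \<subseteq> sym_carrier I"
proof -
  interpret cring "sym_free I" by (rule cring_sym_free)
  have c: "sym_rels I \<subseteq> carrier (sym_free I)" using sym_rels_carrier[OF assms] by simp
  show i: "ideal (sym_ideal I) (sym_free I)" unfolding sym_ideal_def by (rule genideal_ideal[OF c])
  show "sym_rels I \<subseteq> sym_ideal I" unfolding sym_ideal_def by (rule genideal_self[OF c])
  show "sym_ideal I \<subseteq> sym_carrier I"
    using additive_subgroup.a_subset[OF ideal.axioms(1)[OF i]] by simp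
qed

lemma sym_ideal_closed:
  assumes "idl.subspace I"
  shows "0 \<in> sym_ideal I" "x \<in> sym_ideal I \<Longrightarrow> y \<in> sym_ideal I \<Longrightarrow> x + y \<in> sym_ideal I"
    "x \<in> sym_ideal I \<Longrightarrow> a \<in> sym_carrier I \<Longrightarrow> a * x \<in> sym_ideal I"
    "x \<in> sym_ideal I \<Longrightarrow> y \<in> sym_ideal I \<Longrightarrow> x - y \<in> sym_ideal I"
proof -
  note i = sym_ideal_facts(1)[OF assms]
  show "0 \<in> sym_ideal I" using additive_subgroup.zero_closed[OF ideal.axioms(1)[OF i]] by simp
  show add: "x + y \<in> sym_ideal I" if "x \<in> sym_ideal I" "y \<in> sym_ideal I" for x y
    using additive_subgroup.a_closed[OF ideal.axioms(1)[OF i] that] by simp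
  show mult: "a * x \<in> sym_ideal I" if "x \<in> sym_ideal I" "a \<in> sym_carrier I" for a x
    using ideal.I_l_closed[OF i, of x a] that by simp
  have m1: "- 1 \<in> sym_carrier I" by (rule sym_carrier_closed(6)[OF sym_carrier_closed(2)])
  show "x - y \<in> sym_ideal I" if "x \<in> sym_ideal I" "y \<in> sym_ideal I"
    using add[OF that(1) mult[OF that(2) m1]] by simp
qed

lemma sym_ideal_sum: "idl.subspace I \<Longrightarrow> (\<And>a. a \<in> A \<Longrightarrow> f a \<in> sym_ideal I) \<Longrightarrow> sum f A \<in> sym_ideal I"
  by (induction A rule: infinite_finite_induct) (simp_all add: sym_ideal_closed)

lemma rees_eval_sym_ideal:
  assumes "idl.subspace I" "p \<in> sym_ideal I"
  shows "rees_eval p = 0"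
proof -
  interpret cring "sym_free I" by (rule cring_sym_free)
  let ?K = "{p \<in> sym_carrier I. rees_eval p = 0}"
  have "ideal ?K (sym_free I)"
    by (rule ideal_of_closed) (use sym_carrier_closed in \<open>auto simp: rees_eval_add rees_eval_mult\<close>)
  moreover have "sym_rels I \<subseteq> ?K"
  proof
    fix r assume r: "r \<in> sym_rels I"
    have "rees_eval (sym_var (a + b) - sym_var a - sym_var b) = 0" for a b :: 'a
      by (simp add: rees_eval_diff sym_var_def rees_eval_single mval_def mdeg_def diff_monom)
    moreover have "rees_eval (sym_var (c * a) - Poly_Mapping.single 0 c * sym_var a) = 0" for a c :: 'a
      by (simp add: rees_eval_diff rees_eval_mult sym_var_def rees_eval_single mval_def mdeg_def mult_monom)
    ultimately have "rees_eval r = 0" using r by (auto simp: sym_rels_def)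
    then show "r \<in> ?K" using r sym_rels_carrier[OF assms(1)] by blast
  qed
  ultimately have "sym_ideal I \<subseteq> ?K" unfolding sym_ideal_def by (rule genideal_minimal)
  then show ?thesis using assms(2) by blast
qed

lemma mval_in_ideal:
  assumes I: "idl.subspace I" and m: "Poly_Mapping.keys m \<subseteq> I" "m \<noteq> 0"
  shows "mval m \<in> I"
proof -
  obtain a where a: "a \<in> Poly_Mapping.keys m" using m(2) by (metis all_not_in_conv keys_eq_empty)
  have "mval m = a ^ Poly_Mapping.lookup m a * (\<Prod>b\<in>Poly_Mapping.keys m - {a}. b ^ Poly_Mapping.lookup m b)"
    unfolding mval_def by (rule prod.remove) (use a in auto)
  moreover obtain n where "Poly_Mapping.lookup m a = Suc n" using a by (cases "Poly_Mapping.lookup m a") (auto simp: in_keys_iff)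
  ultimately have "mval m = (a ^ n * (\<Prod>b\<in>Poly_Mapping.keys m - {a}. b ^ Poly_Mapping.lookup m b)) * a" by (simp add: ac_simps)
  then show ?thesis using ideal_mult(1)[OF I] a m(1) by auto
qed

lemma peval_in_ideal:
  assumes I: "idl.subspace I" and p: "p \<in> sym_carrier I" "homog (Suc k) p"
  shows "peval p \<in> I"
proof -
  have "peval p = (\<Sum>m\<in>Poly_Mapping.keys p. Poly_Mapping.lookup p m * mval m)"
    by (subst poly_mapping_sum_single[of p]) (simp only: peval_simps)
  also have "\<dots> \<in> I"
  proof (rule idl.subspace_sum[OF I], rule ideal_mult(1)[OF I], rule mval_in_ideal[OF I])
    fix m assume m: "m \<in> Poly_Mapping.keys p"
    then show "Poly_Mapping.keys m \<subseteq> I" using p(1) by (auto simp: sym_carrier_def)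
    show "m \<noteq> 0" using m p(2) by (auto simp: homog_def mdeg_def)
  qed
  finally show ?thesis .
qed

lemma span_take:
  assumes "i \<le> length ds" "a \<in> idl.span (set (take i ds))"
  shows "\<exists>c. a = (\<Sum>j<i. c j * ds ! j)"
  using assms(2)
proof (induction rule: idl.span_induct_alt)
  case base
  show ?case by (rule exI[of _ "\<lambda>_. 0"]) simp
next
  case (step r x y)
  obtain j where j: "j < i" "x = ds ! j" using step(1) assms(1) by (auto simp: in_set_conv_nth)
  obtain c where c: "y = (\<Sum>j<i. c j * ds ! j)" using step(2) by blast
  have "(\<Sum>l<i. (c l + (if l = j then r else 0)) * ds ! l) = y + (\<Sum>l<i. if l = j then r * ds ! l else 0)"
    unfolding c sum.distrib[symmetric] by (rule sum.cong) (auto simp: distrib_right)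
  also have "\<dots> = r * x + y" using j by (simp add: sum.delta)
  finally show ?case by (intro exI[of _ "\<lambda>l. c l + (if l = j then r else 0)"]) simp
qed

section \<open>Ideals of linear type\<close>

text \<open>A property of all d-sequences, here available from \<open>colon_inter_of_reg\<close>,
  and the only input to the proof of linear type.\<close>

locale colon_condition =
  fixes ds :: "'a::comm_ring_1 list"
  assumes colon: "\<And>i x. i < length ds \<Longrightarrow> x \<in> idl.span (set ds) \<Longrightarrow>
    x * ds ! i \<in> idl.span (set (take i ds)) \<Longrightarrow> x \<in> idl.span (set (take i ds))"
begin

abbreviation "I \<equiv> idl.span (set ds)"
abbreviation "A \<equiv> sym_carrier I"
abbreviation "N \<equiv> sym_ideal I"

lemma I: "idl.subspace I"
  by (rule idl.subspace_span)

lemmas N_closed = sym_ideal_closed[OF I]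

lemma ds_in: "i \<le> length ds \<Longrightarrow> j < i \<Longrightarrow> ds ! j \<in> idl.span (set (take i ds))"
  by (intro idl.span_base) (auto simp: in_set_conv_nth)

lemma ds_I: "j < length ds \<Longrightarrow> ds ! j \<in> I"
  using ds_in[of "length ds" j] by simp

text \<open>Reduces the variables, one for each element of the ideal, to those of the finitely many
  generators.\<close>

lemma sym_var_combination:
  "n \<le> length ds \<Longrightarrow> sym_var (\<Sum>j<n. c j * ds ! j) - (\<Sum>j<n. Poly_Mapping.single 0 (c j) * sym_var (ds ! j)) \<in> N"
proof (induction n)
  case 0
  \<comment> \<open>The empty sum needs the variable of \<open>0\<close> in \<open>N\<close>: the
    scalar relation with \<open>r = a = 0\<close>.\<close>
  have "sym_var (0 * 0) - Poly_Mapping.single 0 0 * sym_var 0 \<in> sym_rels I"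
    unfolding sym_rels_def using idl.subspace_0[OF I] by blast
  then show ?case using sym_ideal_facts(2)[OF I] by auto
next
  case (Suc n)
  let ?y = "\<Sum>j<n. c j * ds ! j"
  have y: "?y \<in> I" using Suc.prems ds_I by (intro idl.span_sum idl.span_scale) auto
  have d1: "ds ! n \<in> I" using ds_I Suc.prems by simp
  note d = d1 idl.span_scale[OF d1, of "c n"]
  have "sym_var (?y + c n * ds ! n) - sym_var ?y - sym_var (c n * ds ! n) \<in> sym_rels I"
    unfolding sym_rels_def using y d(2) by blast
  moreover have "sym_var (c n * ds ! n) - Poly_Mapping.single 0 (c n) * sym_var (ds ! n) \<in> sym_rels I"
    unfolding sym_rels_def using d(1) by blast
  ultimately have "(sym_var (?y + c n * ds ! n) - sym_var ?y - sym_var (c n * ds ! n)) +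
      (sym_var (c n * ds ! n) - Poly_Mapping.single 0 (c n) * sym_var (ds ! n)) +
      (sym_var ?y - (\<Sum>j<n. Poly_Mapping.single 0 (c j) * sym_var (ds ! j))) \<in> N"
    using Suc sym_ideal_facts(2)[OF I] by (intro N_closed(2)) auto
  then show ?case by (simp add: algebra_simps)
qed

text \<open>Modulo the relations, \<open>F\<close> lies in the ideal of the variables of the first
  \<open>i\<close> generators. The index \<open>k\<close> is the degree of the cofactors, so
  \<open>F\<close> is congruent to a form of degree \<open>k + 1\<close>.\<close>

definition fil :: "nat \<Rightarrow> nat \<Rightarrow> (('a \<Rightarrow>\<^sub>0 nat) \<Rightarrow>\<^sub>0 'a) \<Rightarrow> bool" where
  "fil k i F \<longleftrightarrow> (\<exists>G. (\<forall>j<i. G j \<in> A \<and> homog k (G j)) \<and> F - (\<Sum>j<i. sym_var (ds ! j) * G j) \<in> N)"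

lemma fil_congruent:
  assumes "fil k i F" "F' - F \<in> N"
  shows "fil k i F'"
proof -
  obtain G where G: "\<forall>j<i. G j \<in> A \<and> homog k (G j)" "F - (\<Sum>j<i. sym_var (ds ! j) * G j) \<in> N"
    using assms(1) by (auto simp: fil_def)
  have "(F' - F) + (F - (\<Sum>j<i. sym_var (ds ! j) * G j)) \<in> N" by (rule N_closed(2)[OF assms(2) G(2)])
  then show ?thesis unfolding fil_def using G(1) by (intro exI[of _ G]) simp
qed

lemma fil_add:
  assumes "fil k i F" "fil k i F'"
  shows "fil k i (F + F')"
proof -
  obtain G where G: "\<forall>j<i. G j \<in> A \<and> homog k (G j)" "F - (\<Sum>j<i. sym_var (ds ! j) * G j) \<in> N"
    using assms(1) by (auto simp: fil_def)
  obtain G' where G': "\<forall>j<i. G' j \<in> A \<and> homog k (G' j)" "F' - (\<Sum>j<i. sym_var (ds ! j) * G' j) \<in> N"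
    using assms(2) by (auto simp: fil_def)
  have "(F - (\<Sum>j<i. sym_var (ds ! j) * G j)) + (F' - (\<Sum>j<i. sym_var (ds ! j) * G' j)) \<in> N"
    by (rule N_closed(2)[OF G(2) G'(2)])
  then have "(F + F') - (\<Sum>j<i. sym_var (ds ! j) * (G j + G' j)) \<in> N"
    by (simp add: distrib_left sum.distrib algebra_simps)
  then show ?thesis unfolding fil_def using G(1) G'(1)
    by (intro exI[of _ "\<lambda>j. G j + G' j"]) (auto intro: homog_add sym_carrier_closed(3))
qed

lemma fil_combination:
  assumes "\<And>j. j < i \<Longrightarrow> G j \<in> A \<and> homog k (G j)"
  shows "fil k i (\<Sum>j<i. sym_var (ds ! j) * G j)"
  unfolding fil_def using assms N_closed(1) by (intro exI[of _ G]) simp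

lemma fil_zero: "fil k i 0"
  unfolding fil_def
  by (rule exI[of _ "\<lambda>_. 0"]) (simp add: homog_zero N_closed(1) sym_carrier_closed(1))

lemma fil_sum: "(\<And>a. a \<in> S \<Longrightarrow> fil k i (f a)) \<Longrightarrow> fil k i (sum f S)"
  by (induction S rule: infinite_finite_induct) (simp_all add: fil_add fil_zero)

text \<open>Each monomial of positive degree contains a variable, which the linear relations express
  by the variables of the generators.\<close>

lemma fil_top:
  assumes F: "F \<in> A" "homog (Suc k) F"
  shows "fil k (length ds) F"
proof -
  have "fil k (length ds) (Poly_Mapping.single m (Poly_Mapping.lookup F m))" if m: "m \<in> Poly_Mapping.keys F" for m
  proof -
    have mI: "Poly_Mapping.keys m \<subseteq> I" and md: "mdeg m = Suc k" using F m by (auto simp: sym_carrier_def homog_def)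
    then have "m \<noteq> 0" by (auto simp: mdeg_def)
    then obtain a where a: "a \<in> Poly_Mapping.keys m" by (metis all_not_in_conv keys_eq_empty)
    define m' where "m' = m - Poly_Mapping.single a 1"
    have mm: "m = Poly_Mapping.single a 1 + m'"
      using a by (intro poly_mapping_eqI) (auto simp: m'_def lookup_add lookup_minus lookup_single when_def in_keys_iff)
    have "mdeg m = Suc (mdeg m')" unfolding mm mdeg_add by (simp add: mdeg_def)
    then have md': "mdeg m' = k" using md by simp
    have m'I: "Poly_Mapping.keys m' \<subseteq> I" using mI unfolding mm by (auto simp: in_keys_iff lookup_add)
    define q where "q = Poly_Mapping.single m' (Poly_Mapping.lookup F m)"
    have q: "q \<in> A" "homog k q" using m'I md' by (auto simp: q_def sym_carrier_def homog_def)
    have eq: "Poly_Mapping.single m (Poly_Mapping.lookup F m) = sym_var a * q"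
      unfolding q_def sym_var_def mult_single mm[symmetric] by simp
    have "a \<in> idl.span (set (take (length ds) ds))" using a mI by auto
    then obtain c where c: "a = (\<Sum>j<length ds. c j * ds ! j)" using span_take[of "length ds" ds a] by auto
    have "q * (sym_var a - (\<Sum>j<length ds. Poly_Mapping.single 0 (c j) * sym_var (ds ! j))) \<in> N"
      by (rule N_closed(3)[OF _ q(1)]) (use sym_var_combination[of "length ds" c] c in simp)
    then have *: "sym_var a * q - (\<Sum>j<length ds. sym_var (ds ! j) * (Poly_Mapping.single 0 (c j) * q)) \<in> N"
      by (simp add: right_diff_distrib sum_distrib_left ac_simps)
    have "fil k (length ds) (\<Sum>j<length ds. sym_var (ds ! j) * (Poly_Mapping.single 0 (c j) * q))"
      by (rule fil_combination)
        (use q homog_mult[OF homog_const, of k q] sym_carrier_closed(5)[OF const_carrier] in auto)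
    then show ?thesis unfolding eq using * by (rule fil_congruent)
  qed
  then have "fil k (length ds) (\<Sum>m\<in>Poly_Mapping.keys F. Poly_Mapping.single m (Poly_Mapping.lookup F m))"
    by (rule fil_sum)
  then show ?thesis using poly_mapping_sum_single[of F] by simp
qed

lemma peval_N: "p \<in> N \<Longrightarrow> peval p = 0"
  using rees_eval_sym_ideal[OF I] by (simp add: peval_def)

lemma peval_congruent: "F - F' \<in> N \<Longrightarrow> peval F = peval F'"
  using peval_N[of "F - F'"] by (simp add: peval_simps)

lemma combination_carrier:
  assumes "i \<le> length ds" "\<And>j. j < i \<Longrightarrow> G j \<in> A \<and> homog k (G j)"
  shows "(\<Sum>j<i. sym_var (ds ! j) * G j) \<in> A" "homog (Suc k) (\<Sum>j<i. sym_var (ds ! j) * G j)"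
proof -
  show "(\<Sum>j<i. sym_var (ds ! j) * G j) \<in> A"
    using assms ds_I by (intro subring_sum[OF subring_sym_carrier] sym_carrier_closed(5) sym_var_carrier) auto
  show "homog (Suc k) (\<Sum>j<i. sym_var (ds ! j) * G j)"
    using assms homog_mult[OF homog_sym_var, of k] by (intro homog_sum) auto
qed

lemma peval_combination_in:
  assumes "i \<le> length ds"
  shows "peval (\<Sum>j<i. sym_var (ds ! j) * G j) \<in> idl.span (set (take i ds))"
  unfolding peval_simps using ds_in[OF assms]
  by (intro idl.span_sum ideal_mult(2)[OF idl.subspace_span]) auto

text \<open>The intersection of \<open>I\<^sup>k\<^sup>+\<^sup>1\<close> with the ideal of the first \<open>i\<close> generators is the product
  of the latter with \<open>I\<^sup>k\<close>.\<close>

lemma fil_of_peval: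
  assumes "i \<le> length ds" "F \<in> A" "homog (Suc k) F" "peval F \<in> idl.span (set (take i ds))"
  shows "\<exists>F'. F' \<in> A \<and> homog (Suc k) F' \<and> fil k i F' \<and> peval F' = peval F"
  using assms
proof (induction k arbitrary: i F)
  case 0
  obtain c where c: "peval F = (\<Sum>j<i. c j * ds ! j)" using span_take 0 by blast
  let ?G = "\<lambda>j. Poly_Mapping.single 0 (c j)"
  have G: "?G j \<in> A \<and> homog 0 (?G j)" for j by (simp add: const_carrier homog_const)
  have "peval (\<Sum>j<i. sym_var (ds ! j) * ?G j) = peval F"
    unfolding c peval_simps by (simp add: mult.commute)
  moreover have "fil 0 i (\<Sum>j<i. sym_var (ds ! j) * ?G j)" by (rule fil_combination) (rule G)
  moreover have "(\<Sum>j<i. sym_var (ds ! j) * ?G j) \<in> A" by (rule combination_carrier(1)[OF 0(1)]) (rule G)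
  moreover have "homog (Suc 0) (\<Sum>j<i. sym_var (ds ! j) * ?G j)"
    by (rule combination_carrier(2)[OF 0(1)]) (rule G)
  ultimately show ?case by (intro exI[of _ "\<Sum>j<i. sym_var (ds ! j) * ?G j"] conjI)
next
  case (Suc k)
  from Suc.prems(1) show ?case using Suc.prems(2-4)
  \<comment> \<open>Downward induction on \<open>i\<close>, starting from the full list of
    generators, where \<open>fil_top\<close> applies.\<close>
  proof (induction i arbitrary: F rule: inc_induct)
    case base
    then show ?case using fil_top by blast
  next
    case (step i)
    have "set (take i ds) \<subseteq> set (take (Suc i) ds)" by (rule set_take_subset_set_take) simp
    then have "peval F \<in> idl.span (set (take (Suc i) ds))" using step.prems(3) idl.span_mono by blast
    then obtain F1 where F1: "fil (Suc k) (Suc i) F1" "peval F1 = peval F"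
      using step.IH step.prems(1,2) by blast
    then obtain G where G: "\<And>j. j < Suc i \<Longrightarrow> G j \<in> A \<and> homog (Suc k) (G j)"
      "F1 - (\<Sum>j<Suc i. sym_var (ds ! j) * G j) \<in> N" by (auto simp: fil_def)
    let ?H = "\<Sum>j<i. sym_var (ds ! j) * G j"
    have ev: "peval F = peval ?H + ds ! i * peval (G i)"
      using peval_congruent[OF G(2)] F1(2) by (simp add: peval_simps)
    have il: "i < length ds" "i \<le> length ds" using step.hyps by auto
    have "peval F - peval ?H \<in> idl.span (set (take i ds))"
      by (rule idl.span_diff[OF step.prems(3) peval_combination_in[OF il(2)]])
    then have "peval (G i) * ds ! i \<in> idl.span (set (take i ds))" using ev by (simp add: mult.commute)
    \<comment> \<open>\<open>G i\<close> has positive degree, so its value lies in \<open>I\<close>,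
      as the colon condition demands.\<close>
    then have "peval (G i) \<in> idl.span (set (take i ds))"
      using colon[OF il(1)] peval_in_ideal[OF I] G(1)[of i] by blast
    then obtain F2 where F2: "F2 \<in> A" "homog (Suc k) F2" "fil k i F2" "peval F2 = peval (G i)"
      using Suc.IH[OF il(2)] G(1)[of i] by blast
    obtain G2 where G2: "\<And>j. j < i \<Longrightarrow> G2 j \<in> A \<and> homog k (G2 j)" "F2 - (\<Sum>j<i. sym_var (ds ! j) * G2 j) \<in> N"
      using F2(3) by (auto simp: fil_def)
    have v: "sym_var (ds ! i) \<in> A" by (rule sym_var_carrier[OF ds_I[OF il(1)]])
    let ?K = "\<lambda>j. G j + sym_var (ds ! i) * G2 j"
    have K: "?K j \<in> A \<and> homog (Suc k) (?K j)" if "j < i" for j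
      using G(1)[of j] G2(1)[OF that] that v homog_mult[OF homog_sym_var, of k "G2 j"]
      by (auto intro: sym_carrier_closed(3,5) homog_add)
    have "sym_var (ds ! i) * (F2 - (\<Sum>j<i. sym_var (ds ! j) * G2 j)) \<in> N" by (rule N_closed(3)[OF G2(2) v])
    moreover have "sym_var (ds ! i) * (F2 - (\<Sum>j<i. sym_var (ds ! j) * G2 j)) =
        (?H + sym_var (ds ! i) * F2) - (\<Sum>j<i. sym_var (ds ! j) * ?K j)"
      by (simp add: right_diff_distrib distrib_left sum.distrib sum_distrib_left ac_simps)
    ultimately have "(?H + sym_var (ds ! i) * F2) - (\<Sum>j<i. sym_var (ds ! j) * ?K j) \<in> N"
      by (simp only:)
    then have "fil (Suc k) i (?H + sym_var (ds ! i) * F2)"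
      by (rule fil_congruent[OF fil_combination[of i ?K "Suc k"], rotated]) (rule K)
    moreover have "?H + sym_var (ds ! i) * F2 \<in> A"
      by (rule sym_carrier_closed(3)[OF combination_carrier(1)[where G = G and k = "Suc k", OF il(2)] sym_carrier_closed(5)[OF v F2(1)]])
        (use G(1) in simp)
    moreover have "homog (Suc (Suc k)) (?H + sym_var (ds ! i) * F2)"
      by (rule homog_add[OF combination_carrier(2)[where G = G and k = "Suc k", OF il(2)]])
        (use G(1) homog_mult[OF homog_sym_var F2(2)] in simp_all)
    moreover have "peval (?H + sym_var (ds ! i) * F2) = peval F"
      unfolding ev F2(4)[symmetric] by (simp add: peval_simps)
    ultimately show ?case by blast
  qed
qed

text \<open>Outer induction on the degree, inner on \<open>i\<close>. In
  \<open>F = H + sym_var (ds ! i) * G i\<close> the colon condition puts the value of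
  \<open>G i\<close> into the ideal of the first \<open>i\<close> generators, so some
  \<open>F2\<close> in the first \<open>i\<close> variables has the same value. The difference
  \<open>G i - F2\<close> is a relation of lower degree, hence in \<open>N\<close>, and the variable
  of \<open>ds ! i\<close> is eliminated. In degree one, relations are linear and lie in
  \<open>N\<close> by \<open>sym_var_combination\<close>.\<close>

lemma in_N_of_fil:
  assumes "i \<le> length ds" "fil k i F" "peval F = 0"
  shows "F \<in> N"
  using assms
proof (induction k arbitrary: i F)
  case 0
  then obtain G where G: "\<And>j. j < i \<Longrightarrow> G j \<in> A \<and> homog 0 (G j)" "F - (\<Sum>j<i. sym_var (ds ! j) * G j) \<in> N"
    by (auto simp: fil_def)
  define c where "c j = peval (G j)" for j
  have *: "(\<Sum>j<i. sym_var (ds ! j) * G j) = (\<Sum>j<i. Poly_Mapping.single 0 (c j) * sym_var (ds ! j))"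
  proof (rule sum.cong[OF refl])
    fix j assume "j \<in> {..<i}"
    then have "G j = Poly_Mapping.single 0 (c j)" unfolding c_def using G(1) by (intro homog_zero_degree) simp
    then show "sym_var (ds ! j) * G j = Poly_Mapping.single 0 (c j) * sym_var (ds ! j)" by (simp add: mult.commute)
  qed
  have "(\<Sum>j<i. c j * ds ! j) = peval F"
    unfolding peval_congruent[OF G(2)] * by (simp add: peval_simps)
  then have sum0: "(\<Sum>j<i. c j * ds ! j) = 0" using 0 by simp
  have z: "sym_var 0 \<in> N" using sym_var_combination[of 0 c] by simp
  have "sym_var 0 - (\<Sum>j<i. Poly_Mapping.single 0 (c j) * sym_var (ds ! j)) \<in> N"
    using sym_var_combination[OF 0(1), of c] unfolding sum0 .
  from N_closed(2)[OF G(2)[unfolded *] N_closed(4)[OF z this]] show ?case by simp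
next
  case (Suc k)
  note outer = Suc.IH
  from Suc.prems show ?case
  proof (induction i arbitrary: F)
    case 0
    then show ?case by (simp add: fil_def)
  next
    case (Suc i)
    then obtain G where G: "\<And>j. j < Suc i \<Longrightarrow> G j \<in> A \<and> homog (Suc k) (G j)"
      "F - (\<Sum>j<Suc i. sym_var (ds ! j) * G j) \<in> N" by (auto simp: fil_def)
    let ?H = "\<Sum>j<i. sym_var (ds ! j) * G j"
    have ev: "0 = peval ?H + ds ! i * peval (G i)"
      using peval_congruent[OF G(2)] Suc.prems(3) by (simp add: peval_simps)
    have il: "i < length ds" "i \<le> length ds" using Suc.prems by auto
    have "peval (G i) * ds ! i = - peval ?H" using ev by (simp add: eq_neg_iff_add_eq_0 ac_simps)
    also have "\<dots> \<in> idl.span (set (take i ds))" by (rule idl.span_neg[OF peval_combination_in[OF il(2)]])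
    finally have "peval (G i) \<in> idl.span (set (take i ds))"
      using colon[OF il(1)] peval_in_ideal[OF I] G(1)[of i] by blast
    then obtain F2 where F2: "F2 \<in> A" "homog (Suc k) F2" "fil k i F2" "peval F2 = peval (G i)"
      using fil_of_peval[OF il(2)] G(1)[of i] by blast
    have Gi: "G i \<in> A" "homog (Suc k) (G i)" using G(1)[of i] by auto
    \<comment> \<open>The difference may involve all generators, so the outer hypothesis is applied
      with the full list.\<close>
    have "fil k (length ds) (G i - F2)"
      by (rule fil_top[OF sym_carrier_closed(4)[OF Gi(1) F2(1)] homog_diff[OF Gi(2) F2(2)]])
    then have d: "G i - F2 \<in> N"
      using outer[of "length ds" "G i - F2"] F2(4) by (simp add: peval_simps)
    have v: "sym_var (ds ! i) \<in> A" by (rule sym_var_carrier[OF ds_I[OF il(1)]])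
    obtain G2 where G2: "\<And>j. j < i \<Longrightarrow> G2 j \<in> A \<and> homog k (G2 j)" "F2 - (\<Sum>j<i. sym_var (ds ! j) * G2 j) \<in> N"
      using F2(3) by (auto simp: fil_def)
    let ?K = "\<lambda>j. G j + sym_var (ds ! i) * G2 j"
    have K: "?K j \<in> A \<and> homog (Suc k) (?K j)" if "j < i" for j
      using G(1)[of j] G2(1)[OF that] that v homog_mult[OF homog_sym_var, of k "G2 j"]
      by (auto intro: sym_carrier_closed(3,5) homog_add)
    have "(F - (\<Sum>j<Suc i. sym_var (ds ! j) * G j)) +
        sym_var (ds ! i) * ((G i - F2) + (F2 - (\<Sum>j<i. sym_var (ds ! j) * G2 j))) \<in> N"
      by (intro N_closed(2,3) G(2) G2(2) d v)
    moreover have "(F - (\<Sum>j<Suc i. sym_var (ds ! j) * G j)) +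
        sym_var (ds ! i) * ((G i - F2) + (F2 - (\<Sum>j<i. sym_var (ds ! j) * G2 j))) =
        F - (\<Sum>j<i. sym_var (ds ! j) * ?K j)"
      by (simp add: right_diff_distrib distrib_left sum.distrib sum_distrib_left ac_simps)
    ultimately have "F - (\<Sum>j<i. sym_var (ds ! j) * ?K j) \<in> N" by (simp only:)
    then have "fil (Suc k) i F"
      by (rule fil_congruent[OF fil_combination[of i ?K "Suc k"], rotated]) (rule K)
    then show ?case using Suc.IH il(2) Suc.prems(3) by blast
  qed
qed

text \<open>The coefficient of \<open>t^d\<close> in the image is the value of the component of
  degree \<open>d\<close>, so the components can be treated separately.\<close>

lemma rees_eval_kernel:
  assumes p: "p \<in> A" "rees_eval p = 0"
  shows "p \<in> N"
proof -
  let ?D = "mdeg ` Poly_Mapping.keys p"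
  have dec: "(\<Sum>d\<in>?D. hcomp d p) = p" by (rule sum_hcomp) auto
  have hA: "hcomp d p \<in> A" for d using p(1) by (auto simp: sym_carrier_def in_keys_iff lookup_hcomp split: if_splits)
  have "peval (hcomp d p) = 0" if d: "d \<in> ?D" for d
  proof -
    have "(\<Sum>e\<in>?D. monom (peval (hcomp e p)) e) = (\<Sum>e\<in>?D. rees_eval (hcomp e p))"
      by (rule sum.cong[OF refl]) (rule rees_eval_homog[OF homog_hcomp, symmetric])
    also have "\<dots> = rees_eval (\<Sum>e\<in>?D. hcomp e p)" by (rule rees_eval_sum[symmetric])
    also have "\<dots> = 0" unfolding dec by (rule p(2))
    finally have "0 = coeff (\<Sum>e\<in>?D. monom (peval (hcomp e p)) e) d" by (metis coeff_0)
    also have "\<dots> = peval (hcomp d p)" using d by (simp add: coeff_sum coeff_monom sum.delta)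
    finally show ?thesis by simp
  qed
  then have "hcomp d p \<in> N" if "d \<in> ?D" for d
  proof (cases d)
    case 0
    have "hcomp d p = Poly_Mapping.single 0 (peval (hcomp d p))"
      using homog_hcomp[of 0 p] unfolding 0 by (rule homog_zero_degree)
    then show ?thesis using \<open>\<And>d. d \<in> ?D \<Longrightarrow> peval (hcomp d p) = 0\<close>[OF that] N_closed(1) by simp
  next
    case (Suc k)
    have "fil k (length ds) (hcomp d p)" by (rule fil_top[OF hA]) (use homog_hcomp[of d p] Suc in simp)
    then show ?thesis using in_N_of_fil \<open>\<And>d. d \<in> ?D \<Longrightarrow> peval (hcomp d p) = 0\<close>[OF that] by blast
  qed
  then have "(\<Sum>d\<in>?D. hcomp d p) \<in> N" by (rule sym_ideal_sum[OF I])
  then show ?thesis unfolding dec .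
qed

section \<open>Powers of the ideal and the image of the evaluation\<close>

abbreviation "power_I k \<equiv> I [^]\<^bsub>ideals_set ring_of_type_algebra\<^esub> (k::nat)"

lemma power_I_simps:
  "power_I 0 = UNIV" "power_I (Suc k) = ideal_prod ring_of_type_algebra (power_I k) I"
  by (simp_all add: nat_pow_def ideals_set_def)

lemma subspace_power_I: "idl.subspace (power_I k)"
proof (induction k)
  case (Suc k)
  interpret cring tr by (rule cring_tr)
  show ?case unfolding power_I_simps(2) ideal_tr_iff[symmetric]
    by (rule ideal_prod_is_ideal) (use Suc I in \<open>auto simp: ideal_tr_iff\<close>)
next
  case 0
  show ?case unfolding power_I_simps by simp
qed

lemma mval_in_power: "Poly_Mapping.keys m \<subseteq> I \<Longrightarrow> mval m \<in> power_I (mdeg m)"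
proof (induction "mdeg m" arbitrary: m)
  case 0
  show ?case unfolding 0(1)[symmetric] power_I_simps by simp
next
  case (Suc k)
  then have "m \<noteq> 0" by (auto simp: mdeg_def)
  then obtain a where a: "a \<in> Poly_Mapping.keys m" by (metis all_not_in_conv keys_eq_empty)
  define m' where "m' = m - Poly_Mapping.single a 1"
  have mm: "m = m' + Poly_Mapping.single a 1"
    using a by (intro poly_mapping_eqI) (auto simp: m'_def lookup_add lookup_minus lookup_single when_def in_keys_iff)
  have d: "mdeg m = Suc (mdeg m')" unfolding mm mdeg_add by (simp add: mdeg_def)
  have "Poly_Mapping.keys m' \<subseteq> I" using Suc.prems unfolding mm by (auto simp: in_keys_iff lookup_add)
  then have "mval m' \<in> power_I (mdeg m')" using Suc.hyps d by simp
  moreover have "a \<in> I" using a Suc.prems by blast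
  ultimately have "mval m' \<otimes>\<^bsub>tr\<^esub> a \<in> power_I (mdeg m)" unfolding d power_I_simps by (rule ideal_prod.prod)
  moreover have "mval m = mval m' * a" unfolding mm mval_add by (simp add: mval_def)
  ultimately show ?case by simp
qed

lemma power_I_peval: "y \<in> power_I k \<Longrightarrow> \<exists>p. p \<in> A \<and> homog k p \<and> peval p = y"
proof (induction k arbitrary: y)
  case 0
  show ?case by (rule exI[of _ "Poly_Mapping.single 0 y"]) (simp add: const_carrier homog_const peval_simps)
next
  case (Suc k)
  from Suc.prems[unfolded power_I_simps] show ?case
  proof (induction y rule: ideal_prod.induct)
    case (prod i j)
    obtain p where p: "p \<in> A" "homog k p" "peval p = i" using Suc.IH[OF prod(1)] by blast
    have "sym_var j * p \<in> A" by (rule sym_carrier_closed(5)[OF sym_var_carrier[OF prod(2)] p(1)])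
    moreover have "homog (Suc k) (sym_var j * p)" using homog_mult[OF homog_sym_var p(2)] by simp
    ultimately show ?case using p(3) by (intro exI[of _ "sym_var j * p"]) (simp add: peval_simps mult.commute)
  next
    case (sum s1 s2)
    then obtain p q where "p \<in> A \<and> homog (Suc k) p \<and> peval p = s1" "q \<in> A \<and> homog (Suc k) q \<and> peval q = s2" by blast
    then show ?case by (intro exI[of _ "p + q"]) (simp add: peval_simps sym_carrier_closed(3) homog_add)
  qed
qed

lemma coeff_rees_eval:
  assumes "p \<in> A"
  shows "coeff (rees_eval p) k \<in> power_I k"
proof -
  have "rees_eval p = (\<Sum>m\<in>Poly_Mapping.keys p. monom (Poly_Mapping.lookup p m * mval m) (mdeg m))"
    by (rule rees_eval_superset) auto
  then have "coeff (rees_eval p) k = (\<Sum>m\<in>Poly_Mapping.keys p. if mdeg m = k then Poly_Mapping.lookup p m * mval m else 0)"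
    by (simp add: coeff_sum coeff_monom)
  also have "\<dots> \<in> power_I k"
  proof (rule idl.subspace_sum[OF subspace_power_I])
    fix m assume m: "m \<in> Poly_Mapping.keys p"
    then have "mval m \<in> power_I (mdeg m)" using assms by (intro mval_in_power) (auto simp: sym_carrier_def)
    then show "(if mdeg m = k then Poly_Mapping.lookup p m * mval m else 0) \<in> power_I k"
      using ideal_mult(1)[OF subspace_power_I] idl.subspace_0[OF subspace_power_I] by auto
  qed
  finally show ?thesis .
qed

lemma rees_carrier: "carrier (rees_algebra I) = {f. \<forall>k. coeff f k \<in> power_I k}"
  by (simp add: rees_algebra_def)

lemma rees_eval_image: "rees_eval ` A = carrier (rees_algebra I)"
  unfolding rees_carrier
proof (intro equalityI subsetI)
  fix f assume "f \<in> rees_eval ` A"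
  then show "f \<in> {f. \<forall>k. coeff f k \<in> power_I k}" using coeff_rees_eval by auto
next
  fix f assume "f \<in> {f. \<forall>k. coeff f k \<in> power_I k}"
  then have "\<forall>k. \<exists>p. p \<in> A \<and> homog k p \<and> peval p = coeff f k" using power_I_peval by simp
  then obtain p where p: "\<And>k. p k \<in> A \<and> homog k (p k) \<and> peval (p k) = coeff f k" by metis
  have "rees_eval (\<Sum>k\<le>degree f. p k) = (\<Sum>k\<le>degree f. monom (coeff f k) k)"
    unfolding rees_eval_sum
  proof (rule sum.cong[OF refl])
    fix k
    have "homog k (p k)" "peval (p k) = coeff f k" using p by blast+
    then show "rees_eval (p k) = monom (coeff f k) k" using rees_eval_homog[of k "p k"] by simp
  qed
  also have "\<dots> = f" by (rule poly_as_sum_of_monoms)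
  finally have "rees_eval (\<Sum>k\<le>degree f. p k) = f" .
  moreover have "(\<Sum>k\<le>degree f. p k) \<in> A" using p by (intro subring_sum[OF subring_sym_carrier]) blast
  ultimately show "f \<in> rees_eval ` A" by force
qed

text \<open>As the image of a subring under the multiplicative \<open>rees_eval\<close>, it is
  closed under products; no powers of \<open>I\<close> are multiplied.\<close>

lemma subring_rees: "subring_set {f. \<forall>k. coeff f k \<in> power_I k}"
proof -
  let ?S = "{f. \<forall>k. coeff f k \<in> power_I k}"
  have S: "?S = rees_eval ` A" using rees_eval_image rees_carrier by simp
  have "rees_eval 1 = 1"
    using rees_eval_single[of 0 1] by (simp add: mval_def mdeg_def flip: single_one)
  then have "1 \<in> rees_eval ` A" using sym_carrier_closed(2) by (metis image_eqI)
  then show ?thesis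
    unfolding subring_set_def S
    by (auto simp flip: rees_eval_diff rees_eval_mult intro!: imageI sym_carrier_closed)
qed

text \<open>The map in \<open>linear_type\<close> is the one induced on the quotient by the kernel,
  so the isomorphism theorem applies once kernel and image are known.\<close>

theorem linear_type_I: "linear_type I"
proof -
  have R: "rees_algebra I = ring_of_type_algebra \<lparr>carrier := {f. \<forall>k. coeff f k \<in> power_I k}\<rparr>"
    by (simp add: rees_algebra_def)
  interpret S: cring "sym_free I" by (rule cring_sym_free)
  interpret R: cring "rees_algebra I" unfolding R by (rule cring_subring[OF subring_rees])
  have one: "rees_eval 1 = 1"
    using rees_eval_single[of 0 1] by (simp add: mval_def mdeg_def flip: single_one)
  have "rees_eval \<in> ring_hom (sym_free I) (rees_algebra I)"
  proof (rule ring_hom_memI)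
    show "rees_eval x \<in> carrier (rees_algebra I)" if "x \<in> carrier (sym_free I)" for x
      using that rees_eval_image by auto
  qed (simp_all add: R rees_eval_mult rees_eval_add one)
  then interpret h: ring_hom_ring "sym_free I" "rees_algebra I" rees_eval
    by (intro ring_hom_ringI2 S.ring_axioms R.ring_axioms)
  have "a_kernel (sym_free I) (rees_algebra I) rees_eval = N"
    unfolding a_kernel_def' using rees_eval_kernel rees_eval_sym_ideal[OF I] sym_ideal_facts(3)[OF I]
    by (auto simp: R)
  then show ?thesis
    using h.FactRing_iso_set rees_eval_image
    unfolding linear_type_def symmetric_algebra_def sym_ideal_def[symmetric] by simp
qed

end

section \<open>Lovasz-Saks-Schrijver ideals\<close>

lemma LSS_ideal_span:
  fixes E :: "'v::finite set set"
  shows "\<exists>G :: ('v, 'k::field) xy_poly set. LSS_ideal E = idl.span G \<and> finite G \<and> (\<forall>g\<in>G. homog (Suc 1) g)"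
proof -
  let ?f = "\<lambda>i j. poly_var (XVar i) * poly_var (XVar j) + poly_var (YVar i) * poly_var (YVar j) :: ('v, 'k) xy_poly"
  let ?G = "{?f i j | i j. {i, j} \<in> E}"
  have "?G \<subseteq> (\<lambda>(i, j). ?f i j) ` UNIV" by auto
  then have "finite ?G" by (rule finite_subset) simp
  moreover have "homog (Suc 1) (?f i j)" for i j
  proof -
    have v: "homog 1 (poly_var z :: ('v, 'k) xy_poly)" for z
      by (simp add: homog_def poly_var_def mdeg_def)
    show ?thesis
      using homog_mult[OF v v, of "XVar i" "XVar j"] homog_mult[OF v v, of "YVar i" "YVar j"]
      by (intro homog_add) simp_all
  qed
  ultimately show ?thesis
    unfolding LSS_ideal_def genideal_tr by (intro exI[of _ ?G]) auto
qed

theorem theorem5p6: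
  fixes E :: "'v::finite set set"
  assumes "simple_graph E"
    and "infinite (UNIV :: 'k::field set)"
    and "CHAR('k) \<noteq> 2"
    and "almost_complete_intersection (LSS_ideal E :: ('v, 'k) xy_poly set)"
  shows "(\<exists>ds :: ('v, 'k) xy_poly list. d_sequence xy_ring ds \<and> (\<forall>d\<in>set ds. homogeneous d) \<and>
            LSS_ideal E = Idl\<^bsub>xy_ring\<^esub> (set ds)) \<and>
         linear_type (LSS_ideal E :: ('v, 'k) xy_poly set)"
proof -
  obtain G :: "('v, 'k) xy_poly set" where G: "LSS_ideal E = idl.span G" "finite G" "\<And>g. g \<in> G \<Longrightarrow> homog (Suc 1) g"
    using LSS_ideal_span by blast
  have aci: "almost_complete_intersection (idl.span G)" using assms(4) G(1) by simp
  obtain B h where B: "idl.span B = idl.span G" "generic_generators B h 1"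
    using generic_generators_of_aci[OF assms(2) G(2,3) aci] by blast
  interpret generic_generators B h 1 by (rule B(2))
  obtain fs f where fs: "reg {} fs" "set (fs @ [f]) \<subseteq> kv.span B" "idl.span B = idl.span (set (fs @ [f]))"
    "\<And>r. r * f * f \<in> idl.span (set fs) \<Longrightarrow> r * f \<in> idl.span (set fs)"
    using exists_generating_d_sequence by blast
  interpret cc: colon_condition "fs @ [f]"
    by standard (rule colon_inter_of_reg[OF fs(1,4)])
  have LSS: "LSS_ideal E = idl.span (set (fs @ [f]))" using G(1) B(1) fs(3) by simp
  have "d_sequence xy_ring (fs @ [f])" by (rule d_sequence_of_reg[OF fs(1,4)])
  moreover have "homogeneous d" if "d \<in> set (fs @ [f])" for d
    using homog_kv_span[OF homog_B] that fs(2) homogeneous_iff_homog by blast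
  ultimately show ?thesis
    using cc.linear_type_I unfolding LSS genideal_tr by blast
qed

end
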